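(* The limits $\alpha_k$ satisfy the following upper bounds: $\alpha_{2}\le 0.315514$, $\alpha_{3}\le 0.47276$, $\alpha_{4}\le 0.56578$, $\alpha_{5}\le 0.6325$, $\alpha_{6}\le 0.68424$, $\alpha_{7}\le 0.72016$, $\alpha_{8}\le 0.74896$, $\alpha_{9}\le 0.77264$, $\alpha_{10}\le 0.7925$, $\alpha_{11}\le 0.8095$, $\alpha_{12}\le 0.82432$, $\alpha_{13}\le 0.83744$, $\alpha_{14}\le 0.84646$, $\alpha_{15}\le 0.85608$, $\alpha_{16}\le 0.86462$, $\alpha_{17}\le 0.87228$, $\alpha_{18}\le 0.87916$, $\alpha_{19}\le 0.88536$, $\alpha_{20}\le 0.89102$, $\alpha_{21}\le 0.89614$, $\alpha_{22}\le 0.90084$, $\alpha_{23}\le 0.90514$, $\alpha_{24}\le 0.90912$, $\alpha_{25}\le 0.91278$, $\alpha_{32}\le 0.93228$, $\alpha_{100}\le 0.97946$, $\alpha_{1000}\le 0.9982$.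
   Context: For strings $u,v$ over a finite alphabet, the edit distance (Levenshtein distance) $d_e(u,v)$ is the minimum number of single-letter substitutions, deletions and insertions necessary to transform $u$ into $v$. For a positive integer $k$, let $X_1,X_2,\ldots,Y_1,Y_2,\ldots$ be independent random variables, each uniform on $\{1,\ldots,k\}$, and define $$\alpha_k=\lim_{n\to\infty}\frac{\mathbb{E}\left[d_e(X_1\ldots X_n,\,Y_1\ldots Y_n)\right]}{n},$$ where the limit exists because the sequence of expectations is subadditive (Fekete's lemma). *)

theory Defs
  imports "HOL-Probability.Probability"
begin

inductive edit_step :: "'a list \<Rightarrow> 'a list \<Rightarrow> bool" where
  substitution: "edit_step (u @ a # v) (u @ b # v)"
| deletion: "edit_step (u @ a # v) (u @ v)"
| insertion: "edit_step (u @ v) (u @ a # v)"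

definition edit_distance :: "'a list \<Rightarrow> 'a list \<Rightarrow> nat" where
  "edit_distance u v = (LEAST m. (edit_step ^^ m) u v)"

text \<open>The set of which \<^const>\<open>edit_distance\<close> takes the minimum is never empty.\<close>

lemma edit_step_delete_all: "(edit_step ^^ length u) u []"
proof (induction u)
  case (Cons a u)
  have "edit_step (a # u) u"
    using deletion[of "[]" a u] by simp
  from relpowp_Suc_I2[OF this Cons] show ?case by simp
qed simp

lemma edit_step_insert_all: "(edit_step ^^ length v) [] v"
proof (induction v)
  case (Cons a v)
  have "edit_step v (a # v)"
    using insertion[of "[]" v a] by simp
  from relpowp_Suc_I[OF Cons this] show ?case by simp
qed simp

lemma edit_path_exists: "(edit_step ^^ (length u + length v)) u v"
  using edit_step_delete_all[of u] edit_step_insert_all[of v]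
  by (auto simp: relpowp_add)

text \<open>
  The letters live on the canonical product space: the coordinates indexed by \<^term>\<open>Inl i\<close> form
  the first random string and those indexed by \<^term>\<open>Inr i\<close> the second one. Index 0 exists
  but is not used.
\<close>

definition letter_space :: "nat \<Rightarrow> (nat + nat \<Rightarrow> nat) measure" where
  "letter_space k = (\<Pi>\<^sub>M i\<in>UNIV. measure_pmf (pmf_of_set {1..k}))"

definition letter_X :: "nat \<Rightarrow> (nat + nat \<Rightarrow> nat) \<Rightarrow> nat" where
  "letter_X i \<omega> = \<omega> (Inl i)"

definition letter_Y :: "nat \<Rightarrow> (nat + nat \<Rightarrow> nat) \<Rightarrow> nat" where
  "letter_Y i \<omega> = \<omega> (Inr i)"

lemma prob_space_letter_space: "prob_space (letter_space k)"
  unfolding letter_space_def by (intro prob_space_PiM prob_space_measure_pmf)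

lemma letter_uniform:
  "distr (letter_space k) (measure_pmf (pmf_of_set {1..k})) (letter_X i) = measure_pmf (pmf_of_set {1..k})"
  "distr (letter_space k) (measure_pmf (pmf_of_set {1..k})) (letter_Y i) = measure_pmf (pmf_of_set {1..k})"
  unfolding letter_space_def letter_X_def letter_Y_def
  by (intro distr_PiM_component prob_space_measure_pmf UNIV_I)+

lemma letters_independent:
  "prob_space.indep_vars (letter_space k) (\<lambda>_. measure_pmf (pmf_of_set {1..k}))
     (case_sum letter_X letter_Y) UNIV"
proof -
  let ?U = "measure_pmf (pmf_of_set {1..k})"
  interpret prob_space "letter_space k" by (rule prob_space_letter_space)
  have eq: "case_sum letter_X letter_Y = (\<lambda>i \<omega>. \<omega> i)"
    by (auto simp: fun_eq_iff letter_X_def letter_Y_def split: sum.split)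
  have rv: "random_variable ?U (\<lambda>\<omega>. \<omega> i)" for i
    unfolding letter_space_def by (rule measurable_component_singleton) simp
  have marg: "distr (letter_space k) ?U (\<lambda>\<omega>. \<omega> i) = ?U" for i
    unfolding letter_space_def by (intro distr_PiM_component prob_space_measure_pmf UNIV_I)
  have "distr (letter_space k) (\<Pi>\<^sub>M i\<in>UNIV. ?U) (\<lambda>\<omega>. \<omega>) = letter_space k"
    unfolding letter_space_def by (rule distr_id)
  then have "indep_vars (\<lambda>_. ?U) (\<lambda>i \<omega>. \<omega> i) UNIV"
    by (subst indep_vars_iff_distr_eq_PiM)
       (use rv in \<open>simp_all only: marg restrict_UNIV UNIV_not_empty simp_thms\<close>, simp only: letter_space_def)
  then show ?thesis unfolding eq .
qed

definition expected_edit_distance :: "nat \<Rightarrow> nat \<Rightarrow> real" where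
  "expected_edit_distance k n =
     (\<integral>\<omega>. real (edit_distance (map (\<lambda>i. letter_X i \<omega>) [1..<n + 1])
                              (map (\<lambda>i. letter_Y i \<omega>) [1..<n + 1])) \<partial>letter_space k)"

definition edit_constant :: "nat \<Rightarrow> real" (\<open>\<alpha>\<close>) where
  "\<alpha> k = lim (\<lambda>n. expected_edit_distance k n / real n)"

end

theory Submission
  imports Defs "HOL-Real_Asymp.Real_Asymp"
begin

text \<open>
  An upper bound on \<open>\<alpha> k\<close> is the cost per letter of any alignment strategy that reads the two random
  strings from left to right. The strategies used here reveal one letter at a time, of the string of
  their choice, and remember part of the frontier of the dynamic programme for the edit distance: on
  the boundary of the rectangle of revealed prefixes, how the best known cost rises or falls from
  cell to cell, together with the revealed letters that lie next to those cells. Revealing a letter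
  changes this frontier in an explicit way (\<open>cross\<close>, \<open>best_cross\<close>). Forgetting the cells that are
  farthest from the corner restricts the alignments that are still possible, so it can only raise
  the cost; this is what keeps the set of states finite (\<open>affordable_take\<close>).

  For a finite set of states, a potential \<open>v\<close> (in units of \<open>1 / Q\<close>) certifies the rate \<open>R / Q\<close> per letter if
  for every state the expected cost of one step plus the expected new potential is at most \<open>v\<close>
  plus the rate (\<open>pays\<close>). Only the pattern of equal and different letters matters, so the states are
  stored up to renaming of the letters and up to exchanging the two strings. The potentials are
  stored in a trie, and the inequality is checked at all leaves by rewriting. Induction on the number of
  letters then bounds the expected cost after \<open>n\<close> letters by \<open>(v + R * n) / Q\<close>
  (\<open>sound_search\<close>).

  A strategy decides by itself how many of the \<open>n\<close> letters come from which string. It therefore bounds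
  the mean of the minimum, over all \<open>i\<close>, of the distance between a prefix of length \<open>i\<close> and one of length
  \<open>n - i\<close>. For fixed \<open>i\<close>, the mean distance is at least \<open>\<alpha> k * n / 2\<close>, because a pair of lengths \<open>(i, n - i)\<close>
  followed by a pair of lengths \<open>(n - i, i)\<close> gives two strings of length \<open>n\<close>. Distances
  concentrate around their means, so the minimum does not change the rate (\<open>mean_cheapest_ge\<close>). Hence
  \<open>\<alpha> k \<le> 2 * R / Q\<close> (\<open>edit_constant_le\<close>), and one certificate for every \<open>k\<close> gives the theorem.
\<close>

section \<open>Edit distance\<close>

lemma edit_step_sym: "edit_step u v \<Longrightarrow> edit_step v u"
  by (induction rule: edit_step.induct) (auto intro: edit_step.intros)

lemma edit_step_context: "edit_step u v \<Longrightarrow> edit_step (p @ u @ q) (p @ v @ q)"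
proof (induction rule: edit_step.induct)
  case (substitution u a v b)
  show ?case using edit_step.substitution[of "p @ u" a "v @ q" b] by simp
next
  case (deletion u a v)
  show ?case using edit_step.deletion[of "p @ u" a "v @ q"] by simp
next
  case (insertion u v a)
  show ?case using edit_step.insertion[of "p @ u" "v @ q" a] by simp
qed

lemma relpowp_image:
  assumes "(R ^^ m) u v" and "\<And>u v. R u v \<Longrightarrow> R (f u) (f v)"
  shows "(R ^^ m) (f u) (f v)"
  using assms(1)
proof (induction m arbitrary: v)
  case (Suc m)
  then obtain w where "(R ^^ m) u w" "R w v" by auto
  with Suc.IH[of w] assms(2) show ?case by auto
qed simp

lemma edit_path: "(edit_step ^^ edit_distance u v) u v"
  unfolding edit_distance_def by (rule LeastI_ex) (use edit_path_exists in blast)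

lemma edit_distance_le: "(edit_step ^^ m) u v \<Longrightarrow> edit_distance u v \<le> m"
  unfolding edit_distance_def by (rule Least_le)

lemma edit_distance_triangle: "edit_distance u w \<le> edit_distance u v + edit_distance v w"
  by (rule edit_distance_le) (use edit_path[of u v] edit_path[of v w] in \<open>auto simp: relpowp_add\<close>)

lemma edit_distance_self [simp]: "edit_distance u u = 0"
  using edit_distance_le[of 0 u u] by simp

lemma edit_distance_step: "edit_step u v \<Longrightarrow> edit_distance u v \<le> 1"
  by (rule edit_distance_le) (use relpowp_Suc_I[of 0 edit_step u u v] in simp)

lemma edit_distance_commute: "edit_distance u v = edit_distance v u"
proof -
  have "edit_distance v u \<le> edit_distance u v" for u v :: "'a list"
  proof (rule edit_distance_le)
    have "(edit_step ^^ m) u w \<Longrightarrow> (edit_step ^^ m) w u" for m w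
    proof (induction m arbitrary: w)
      case (Suc m)
      then obtain z where "(edit_step ^^ m) u z" "edit_step z w" by auto
      with Suc.IH[of z] edit_step_sym show ?case by (blast intro: relpowp_Suc_I2)
    qed simp
    then show "(edit_step ^^ edit_distance u v) v u" using edit_path by blast
  qed
  then show ?thesis by (simp add: antisym)
qed

lemma edit_distance_context: "edit_distance (p @ u @ q) (p @ v @ q) \<le> edit_distance u v"
  by (rule edit_distance_le, rule relpowp_image[where f = "\<lambda>u. p @ u @ q", OF edit_path])
    (rule edit_step_context)

lemma edit_distance_append:
  "edit_distance (u @ u') (v @ v') \<le> edit_distance u v + edit_distance u' v'"
  using edit_distance_triangle[of "u @ u'" "v @ v'" "v @ u'"]
    edit_distance_context[of "[]" u u' v] edit_distance_context[of v u' "[]" v'] by simp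

lemma edit_distance_length: "edit_distance u v \<le> length u + length v"
  by (rule edit_distance_le) (rule edit_path_exists)

lemma edit_distance_Cons1: "edit_distance (a # u) v \<le> 1 + edit_distance u v"
  using edit_distance_append[of "[a]" u "[]" v] edit_distance_length[of "[a]" "[]"] by simp

lemma edit_distance_Cons_Cons:
  "edit_distance (a # u) (b # v) \<le> (if a = b then 0 else 1) + edit_distance u v"
  using edit_distance_append[of "[a]" u "[b]" v]
    edit_distance_step[OF edit_step.substitution[of "[]" a "[]" b]] by auto

lemma edit_distance_subst1:
  "edit_distance (u @ a # v) w \<le> 1 + edit_distance (u @ b # v) w"
  using edit_distance_triangle[of "u @ a # v" w "u @ b # v"]
    edit_distance_step[OF edit_step.substitution[of u a v b]] by simp

lemma edit_distance_subst:
  "\<bar>real (edit_distance (u @ a # v) w) - real (edit_distance (u @ b # v) w)\<bar> \<le> 1"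
  "\<bar>real (edit_distance w (u @ a # v)) - real (edit_distance w (u @ b # v))\<bar> \<le> 1"
  using edit_distance_subst1[of u a v w b] edit_distance_subst1[of u b v w a]
  by (auto simp: edit_distance_commute[of w])

text \<open>
  Two pairs of cutting points on the same antidiagonal that are close to each other give nearly the
  same distance. This reduces the minimum over an antidiagonal to a coarse grid.
\<close>

lemma edit_distance_take:
  assumes "j \<le> m" "n \<le> l"
  shows "edit_distance (take j x) (take l y) \<le> edit_distance (take m x) (take n y) + (m - j) + (l - n)"
proof -
  have x: "take m x = take j x @ take (m - j) (drop j x)"
    using assms by (metis le_add_diff_inverse take_add)
  have y: "take l y = take n y @ take (l - n) (drop n y)"
    using assms by (metis le_add_diff_inverse take_add)
  have "edit_distance (take j x) (take m x) \<le> m - j"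
    using edit_distance_append[of "take j x" "[]" "take j x" "take (m - j) (drop j x)"]
      edit_distance_length[of "[]" "take (m - j) (drop j x)"] unfolding x by simp
  moreover have "edit_distance (take n y) (take l y) \<le> l - n"
    using edit_distance_append[of "take n y" "[]" "take n y" "take (l - n) (drop n y)"]
      edit_distance_length[of "[]" "take (l - n) (drop n y)"] unfolding y by simp
  ultimately show ?thesis
    using edit_distance_triangle[of "take j x" "take l y" "take m x"]
      edit_distance_triangle[of "take m x" "take l y" "take n y"] by linarith
qed

section \<open>Averages over random words\<close>

text \<open>
  The expectation over a uniformly random word is defined by recursion on the first letter, so that
  revealing a letter is unfolding the definition.
\<close>

primrec mean :: "'a set \<Rightarrow> nat \<Rightarrow> ('a list \<Rightarrow> real) \<Rightarrow> real" where
  "mean A 0 f = f []"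
| "mean A (Suc n) f = (\<Sum>a\<in>A. mean A n (\<lambda>w. f (a # w))) / card A"

locale alphabet =
  fixes A :: "'a set"
  assumes fin: "finite A" and ne: "A \<noteq> {}"
begin

lemma card_pos: "real (card A) > 0"
  using fin ne by (simp add: card_gt_0_iff)

lemma mean_mono:
  assumes "\<And>w. length w = n \<Longrightarrow> set w \<subseteq> A \<Longrightarrow> f w \<le> g w"
  shows "mean A n f \<le> mean A n g"
  using assms
proof (induction n arbitrary: f g)
  case (Suc n)
  have "mean A n (\<lambda>w. f (a # w)) \<le> mean A n (\<lambda>w. g (a # w))" if "a \<in> A" for a
    by (rule Suc.IH) (use Suc.prems that in auto)
  then show ?case using card_pos by (auto intro!: divide_right_mono sum_mono)
qed simp

lemma mean_cong:
  assumes "\<And>w. length w = n \<Longrightarrow> set w \<subseteq> A \<Longrightarrow> f w = g w"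
  shows "mean A n f = mean A n g"
  using assms by (intro antisym mean_mono) auto

lemma mean_const [simp]: "mean A n (\<lambda>_. c) = c"
  by (induction n) (use card_pos in auto)

lemma mean_add: "mean A n (\<lambda>w. f w + g w) = mean A n f + mean A n g"
  by (induction n arbitrary: f g) (simp_all add: sum.distrib add_divide_distrib)

lemma mean_cmult: "mean A n (\<lambda>w. c * f w) = c * mean A n f"
  by (induction n arbitrary: f) (simp_all flip: sum_distrib_left)

lemma mean_diff: "mean A n (\<lambda>w. f w - g w) = mean A n f - mean A n g"
  using mean_add[of n f "\<lambda>w. -1 * g w"] unfolding mean_cmult by simp

lemma mean_sum: "mean A n (\<lambda>w. \<Sum>i\<in>I. f i w) = (\<Sum>i\<in>I. mean A n (f i))"
  by (induction I rule: infinite_finite_induct) (simp_all add: mean_add)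

lemma mean_divide: "mean A n (\<lambda>w. f w / c) = mean A n f / c"
  using mean_cmult[of n "1 / c" f] by simp

lemma mean_swap: "mean A m (\<lambda>x. mean A n (\<lambda>y. f x y)) = mean A n (\<lambda>y. mean A m (\<lambda>x. f x y))"
  by (induction m arbitrary: f) (simp_all add: mean_sum mean_divide)

lemma mean_append: "mean A (m + n) f = mean A m (\<lambda>u. mean A n (\<lambda>v. f (u @ v)))"
  by (induction m arbitrary: f) simp_all

lemma mean_take: "m \<le> n \<Longrightarrow> mean A n (\<lambda>w. f (take m w)) = mean A m f"
proof -
  assume "m \<le> n"
  then obtain l where "n = m + l" using le_Suc_ex by blast
  moreover have "mean A (m + l) (\<lambda>w. f (take m w)) = mean A m f"
    unfolding mean_append by (rule mean_cong) simp
  ultimately show ?thesis by simp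
qed

lemma mean_abs: "\<bar>mean A n f\<bar> \<le> mean A n (\<lambda>w. \<bar>f w\<bar>)"
proof -
  have "mean A n f \<le> mean A n (\<lambda>w. \<bar>f w\<bar>)" "mean A n (\<lambda>w. -1 * f w) \<le> mean A n (\<lambda>w. \<bar>f w\<bar>)"
    by (rule mean_mono; simp)+
  then show ?thesis unfolding mean_cmult by simp
qed

text \<open>
  The variance splits into the contributions of the single letters: given the letters before it, one
  letter moves the conditional mean by at most 1.
\<close>

lemma mean_variance:
  assumes "\<And>u a b v. length u + length v + 1 = n \<Longrightarrow> a \<in> A \<Longrightarrow> b \<in> A \<Longrightarrow> \<bar>f (u @ a # v) - f (u @ b # v)\<bar> \<le> 1"
  shows "mean A n (\<lambda>w. (f w - mean A n f)\<^sup>2) \<le> n"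
  using assms
proof (induction n arbitrary: f)
  case (Suc n)
  define e where "e a = mean A n (\<lambda>w. f (a # w))" for a
  define E where "E = mean A (Suc n) f"
  have E: "E = (\<Sum>a\<in>A. e a) / card A" by (simp add: E_def e_def)
  have one: "(e a - E)\<^sup>2 \<le> 1" if a: "a \<in> A" for a
  proof -
    have "\<bar>e a - e b\<bar> \<le> 1" if b: "b \<in> A" for b
    proof -
      have "\<bar>e a - e b\<bar> \<le> mean A n (\<lambda>w. \<bar>f (a # w) - f (b # w)\<bar>)"
        unfolding e_def mean_diff[symmetric] by (rule mean_abs)
      also have "\<dots> \<le> mean A n (\<lambda>_. 1)"
        by (rule mean_mono) (use Suc.prems[of "[]"] a b in auto)
      finally show ?thesis by simp
    qed
    then have "(\<Sum>b\<in>A. \<bar>e a - e b\<bar>) \<le> (\<Sum>b\<in>A. 1)" by (intro sum_mono)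
    moreover have "e a - E = (\<Sum>b\<in>A. e a - e b) / card A"
      using card_pos by (simp add: E sum_subtractf field_simps)
    ultimately have "\<bar>e a - E\<bar> \<le> 1"
      using order_trans[OF sum_abs[of "\<lambda>b. e a - e b" A]] card_pos by (simp add: abs_divide)
    then show ?thesis by (simp add: abs_square_le_1)
  qed
  have var: "mean A n (\<lambda>w. (f (a # w) - E)\<^sup>2) \<le> real n + 1" if a: "a \<in> A" for a
  proof -
    have "(f (a # w) - E)\<^sup>2 = (f (a # w) - e a)\<^sup>2 + (2 * (e a - E) * (f (a # w) - e a) + (e a - E)\<^sup>2)" for w
      by (simp add: power2_eq_square algebra_simps)
    then have "mean A n (\<lambda>w. (f (a # w) - E)\<^sup>2) =
      mean A n (\<lambda>w. (f (a # w) - e a)\<^sup>2) + (2 * (e a - E) * (mean A n (\<lambda>w. f (a # w)) - e a) + (e a - E)\<^sup>2)"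
      by (simp only: mean_add mean_cmult mean_diff mean_const)
    moreover have "mean A n (\<lambda>w. (f (a # w) - e a)\<^sup>2) \<le> n"
      unfolding e_def by (rule Suc.IH) (use Suc.prems[of "a # _"] in auto)
    ultimately show ?thesis using one[OF a] by (simp add: e_def)
  qed
  have "(\<Sum>a\<in>A. mean A n (\<lambda>w. (f (a # w) - E)\<^sup>2)) \<le> (\<Sum>a\<in>A. real n + 1)"
    by (intro sum_mono var)
  then show ?case using card_pos unfolding E_def[symmetric] by (simp add: field_simps)
qed simp

text \<open>
  From the variance bound and \<open>2 * z \<le> z\<^sup>2 / s + s\<close> with \<open>s\<close> the square root of \<open>n\<close>.
\<close>

lemma mean_deviation:
  assumes "\<And>u a b v. length u + length v + 1 = n \<Longrightarrow> a \<in> A \<Longrightarrow> b \<in> A \<Longrightarrow> \<bar>f (u @ a # v) - f (u @ b # v)\<bar> \<le> 1"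
  shows "mean A n (\<lambda>w. \<bar>f w - mean A n f\<bar>) \<le> sqrt n"
proof (cases "n = 0")
  case False
  define s where "s = sqrt n"
  have s: "s > 0" "s\<^sup>2 = n" using False by (auto simp: s_def)
  have "mean A n (\<lambda>w. \<bar>f w - mean A n f\<bar>) \<le> mean A n (\<lambda>w. ((f w - mean A n f)\<^sup>2 / s + s) / 2)"
  proof (rule mean_mono)
    fix w
    define z where "z = \<bar>f w - mean A n f\<bar>"
    have "0 \<le> (z - s)\<^sup>2" by simp
    then have "2 * z * s \<le> z\<^sup>2 + s * s" by (simp add: power2_eq_square algebra_simps)
    then have "z \<le> (z\<^sup>2 / s + s) / 2" using s(1) by (simp add: field_simps)
    then show "\<bar>f w - mean A n f\<bar> \<le> ((f w - mean A n f)\<^sup>2 / s + s) / 2" by (simp add: z_def)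
  qed
  also have "\<dots> = (mean A n (\<lambda>w. (f w - mean A n f)\<^sup>2) / s + s) / 2"
    by (simp only: mean_divide mean_add mean_const)
  also have "\<dots> \<le> (n / s + s) / 2"
    using mean_variance[of n f, OF assms] s(1) by (simp add: divide_right_mono)
  also have "\<dots> = s" using s by (simp add: field_simps power2_eq_square)
  finally show ?thesis by (simp add: s_def)
qed simp

end


text \<open>
  Fekete's lemma. The convergence has to be proved here as well, because \<open>lim\<close> is a meaningful value only for
  a convergent sequence.
\<close>

lemma subadditive_limit:
  fixes a :: "nat \<Rightarrow> real"
  assumes sub: "\<And>m n. a (m + n) \<le> a m + a n" and nonneg: "\<And>n. 0 \<le> a n" and zero: "a 0 = 0" and "m > 0"
  shows "lim (\<lambda>n. a n / n) \<le> a m / m"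
proof -
  have mult: "a (q * l) \<le> q * a l" for q l
  proof (induction q)
    case (Suc q)
    then show ?case using sub[of l "q * l"] by (simp add: algebra_simps)
  qed (simp add: zero)
  have le: "a n / n \<le> a l / l + l * a 1 / n" if "n > 0" "l > 0" for n l
  proof -
    have "a n \<le> a (n div l * l) + a (n mod l)" using sub[of "n div l * l" "n mod l"] by simp
    also have "\<dots> \<le> (n div l) * a l + (n mod l) * a 1"
      using mult[of "n div l" l] mult[of "n mod l" 1] by simp
    also have "\<dots> \<le> (n / l) * a l + l * a 1"
    proof (intro add_mono mult_right_mono nonneg)
      show "real (n div l) \<le> n / l"
        using that by (simp add: pos_le_divide_eq flip: of_nat_mult)
      show "real (n mod l) \<le> l" using that by (simp add: less_imp_le)
    qed
    finally have "a n \<le> (n / l) * a l + l * a 1" .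
    then have "a n / n \<le> ((n / l) * a l + l * a 1) / n" by (rule divide_right_mono) simp
    also have "\<dots> = a l / l + l * a 1 / n" using that by (simp add: field_simps)
    finally show ?thesis .
  qed
  define L where "L = Inf ((\<lambda>n. a n / n) ` {1..})"
  have bdd: "bdd_below ((\<lambda>n. a n / n) ` {1..})"
    by (rule bdd_belowI[of _ 0]) (use nonneg in auto)
  have L: "L \<le> a n / n" if "n > 0" for n
    unfolding L_def by (rule cInf_lower[OF _ bdd]) (use that in auto)
  have "(\<lambda>n. a n / n) \<longlonglongrightarrow> L"
  proof (rule tendstoI)
    fix e :: real assume "e > 0"
    then obtain l where l: "l > 0" "a l / l < L + e / 2"
      using cInf_lessD[of "(\<lambda>n. a n / n) ` {1..}" "L + e / 2"]
      unfolding L_def by (auto simp: Suc_le_eq)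
    have "(\<lambda>n. l * a 1 / real n) \<longlonglongrightarrow> 0" by real_asymp
    then have "\<forall>\<^sub>F n in sequentially. l * a 1 / real n < e / 2"
      by (rule order_tendstoD) (use \<open>e > 0\<close> in simp)
    then show "\<forall>\<^sub>F n in sequentially. dist (a n / n) L < e"
      using eventually_gt_at_top[of 0]
    proof eventually_elim
      case (elim n)
      then have "0 \<le> a n / n - L" "a n / n - L < e" using L[of n] le[of n l] l by linarith+
      then show ?case by (simp add: dist_real_def)
    qed
  qed
  then show ?thesis using L[OF \<open>m > 0\<close>] by (simp add: limI)
qed

section \<open>Independent letters\<close>

context alphabet
begin

lemma mean_Suc_right: "mean A (Suc n) f = mean A n (\<lambda>w. (\<Sum>a\<in>A. f (a # w)) / card A)"
  by (simp add: mean_divide mean_sum)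

end

lemma measurable_letters:
  fixes p :: "nat pmf" and G :: "nat list \<Rightarrow> real"
  assumes "set js \<subseteq> J"
  shows "(\<lambda>\<omega>. G (map \<omega> js)) \<in> borel_measurable (\<Pi>\<^sub>M i\<in>J. measure_pmf p)"
  using assms
proof (induction js arbitrary: G)
  case (Cons j js)
  have "(\<lambda>\<omega>. \<omega> j) \<in> measurable (\<Pi>\<^sub>M i\<in>J. measure_pmf p) (measure_pmf p)"
    by (rule measurable_component_singleton) (use Cons.prems in simp)
  then show ?case
    using Cons measurable_compose_countable[where f = "\<lambda>a \<omega>. G (a # map \<omega> js)" and g = "\<lambda>\<omega>. \<omega> j"
        and M = "\<Pi>\<^sub>M i\<in>J. measure_pmf p" and N = borel] by simp
qed simp

lemma integral_letters:
  fixes A :: "nat set" and F :: "nat list \<Rightarrow> real"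
  assumes A: "finite A" "A \<noteq> {}" and "distinct is" "\<And>w. length w = length is \<Longrightarrow> \<bar>F w\<bar> \<le> C"
  shows "(\<integral>\<omega>. F (map \<omega> is) \<partial>(\<Pi>\<^sub>M i\<in>set is. measure_pmf (pmf_of_set A))) = mean A (length is) F"
  using assms(3,4)
proof (induction "is" arbitrary: F)
  case Nil
  interpret prob_space "\<Pi>\<^sub>M i\<in>{}. measure_pmf (pmf_of_set A)"
    by (intro prob_space_PiM prob_space_measure_pmf)
  show ?case by (simp add: prob_space)
next
  case (Cons i "is")
  let ?p = "measure_pmf (pmf_of_set A)"
  interpret alphabet A by standard (use A in auto)
  interpret P: product_sigma_finite "\<lambda>_. ?p"
    by standard
  interpret prob_space "\<Pi>\<^sub>M i\<in>insert i (set is). ?p"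
    by (intro prob_space_PiM prob_space_measure_pmf)
  have "(\<lambda>\<omega>. F (map \<omega> (i # is))) \<in> borel_measurable (\<Pi>\<^sub>M i\<in>insert i (set is). ?p)"
    by (rule measurable_letters) simp
  then have "integrable (\<Pi>\<^sub>M i\<in>insert i (set is). ?p) (\<lambda>\<omega>. F (map \<omega> (i # is)))"
    by (intro integrable_const_bound[where B = C]) (use Cons.prems in auto)
  then have "(\<integral>\<omega>. F (map \<omega> (i # is)) \<partial>(\<Pi>\<^sub>M i\<in>insert i (set is). ?p)) =
      (\<integral>x. (\<integral>y. F (map (x(i := y)) (i # is)) \<partial>?p) \<partial>(\<Pi>\<^sub>M i\<in>set is. ?p))"
    using Cons.prems by (intro P.product_integral_insert) auto
  also have "\<dots> = (\<integral>x. (\<lambda>w. (\<Sum>a\<in>A. F (a # w)) / card A) (map x is) \<partial>(\<Pi>\<^sub>M i\<in>set is. ?p))"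
  proof (intro Bochner_Integration.integral_cong refl)
    fix x :: "'a \<Rightarrow> nat"
    have "map (x(i := y)) (i # is) = y # map x is" for y using Cons.prems by auto
    then show "(\<integral>y. F (map (x(i := y)) (i # is)) \<partial>?p) = (\<Sum>a\<in>A. F (a # map x is)) / card A"
      by (simp only: integral_pmf_of_set[OF A(2,1)])
  qed
  also have "\<dots> = mean A (length is) (\<lambda>w. (\<Sum>a\<in>A. F (a # w)) / card A)"
  proof (rule Cons.IH)
    show "distinct is" using Cons.prems by simp
    fix w :: "nat list" assume "length w = length is"
    then have "(\<Sum>a\<in>A. \<bar>F (a # w)\<bar>) \<le> (\<Sum>a\<in>A. C)" by (intro sum_mono Cons.prems) simp
    then show "\<bar>(\<Sum>a\<in>A. F (a # w)) / card A\<bar> \<le> C"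
      using order_trans[OF sum_abs[of "\<lambda>a. F (a # w)" A]] card_pos by (simp add: field_simps abs_divide)
  qed
  finally show ?case by (simp add: mean_Suc_right del: mean.simps)
qed

lemma expected_edit_distance_mean:
  assumes "k > 0"
  shows "expected_edit_distance k n =
    mean {1..k} n (\<lambda>x. mean {1..k} n (\<lambda>y. real (edit_distance x y)))"
proof -
  interpret alphabet "{1..k}" by standard (use assms in auto)
  let ?p = "measure_pmf (pmf_of_set {1..k})"
  interpret product_prob_space "\<lambda>_. ?p" UNIV by standard
  define js :: "(nat + nat) list" where "js = map Inl [1..<n + 1] @ map Inr [1..<n + 1]"
  define F where "F w = real (edit_distance (take n w) (drop n w))" for w :: "nat list"
  have js: "length js = n + n" "distinct js" by (auto simp: js_def distinct_map)
  have "expected_edit_distance k n = (\<integral>\<omega>. F (map \<omega> js) \<partial>letter_space k)"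
    unfolding expected_edit_distance_def F_def js_def letter_X_def letter_Y_def by (simp add: comp_def)
  also have "\<dots> = (\<integral>\<omega>. F (map (restrict \<omega> (set js)) js) \<partial>(\<Pi>\<^sub>M i\<in>UNIV. ?p))"
    unfolding letter_space_def by (intro Bochner_Integration.integral_cong refl arg_cong[where f = F]) simp
  also have "\<dots> = (\<integral>\<omega>. F (map \<omega> js) \<partial>distr (\<Pi>\<^sub>M i\<in>UNIV. ?p) (\<Pi>\<^sub>M i\<in>set js. ?p) (\<lambda>\<omega>. restrict \<omega> (set js)))"
    by (rule integral_distr[symmetric]) (rule measurable_restrict_subset measurable_letters subset_UNIV order_refl)+
  also have "distr (\<Pi>\<^sub>M i\<in>UNIV. ?p) (\<Pi>\<^sub>M i\<in>set js. ?p) (\<lambda>\<omega>. restrict \<omega> (set js)) = (\<Pi>\<^sub>M i\<in>set js. ?p)"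
    by (rule distr_PiM_restrict_finite) auto
  also have "(\<integral>\<omega>. F (map \<omega> js) \<partial>(\<Pi>\<^sub>M i\<in>set js. ?p)) = mean {1..k} (length js) F"
  proof (rule integral_letters)
    fix w :: "nat list" assume "length w = length js"
    then show "\<bar>F w\<bar> \<le> real (n + n)"
      using edit_distance_length[of "take n w" "drop n w"] by (simp add: F_def js)
  qed (use assms js in auto)
  also have "\<dots> = mean {1..k} n (\<lambda>x. mean {1..k} n (\<lambda>y. real (edit_distance x y)))"
    unfolding js mean_append by (intro mean_cong) (simp add: F_def)
  finally show ?thesis .
qed

section \<open>Cutting along an antidiagonal\<close>

context alphabet
begin

definition mean_edit :: "nat \<Rightarrow> nat \<Rightarrow> real" where
  "mean_edit m n = mean A m (\<lambda>x. mean A n (\<lambda>y. real (edit_distance x y)))"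

lemma mean_edit_commute: "mean_edit m n = mean_edit n m"
  unfolding mean_edit_def by (subst mean_swap) (simp add: edit_distance_commute)

lemma mean_edit_add: "mean_edit (m + m') (n + n') \<le> mean_edit m n + mean_edit m' n'"
proof -
  have "mean_edit (m + m') (n + n') =
      mean A m (\<lambda>x. mean A n (\<lambda>y. mean A m' (\<lambda>x'. mean A n' (\<lambda>y'. real (edit_distance (x @ x') (y @ y'))))))"
    unfolding mean_edit_def mean_append by (subst mean_swap[of m' n]) simp
  also have "\<dots> \<le> mean A m (\<lambda>x. mean A n (\<lambda>y. mean A m' (\<lambda>x'. mean A n' (\<lambda>y'.
      real (edit_distance x y) + real (edit_distance x' y')))))"
    by (intro mean_mono) (use edit_distance_append in \<open>simp flip: of_nat_add\<close>)
  also have "\<dots> = mean_edit m n + mean_edit m' n'"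
    by (simp add: mean_add mean_edit_def)
  finally show ?thesis .
qed

text \<open>
  Glueing a pair of words of lengths \<open>(m, n)\<close> and one of lengths \<open>(n, m)\<close> gives two words of length
  \<open>m + n\<close>; by symmetry both pairs have the same mean distance. So unequal lengths
  do not beat equal ones.
\<close>

lemma mean_edit_limit_le:
  assumes "m + n > 0"
  shows "lim (\<lambda>n. mean_edit n n / n) * (m + n) / 2 \<le> mean_edit m n"
proof -
  have "lim (\<lambda>n. mean_edit n n / n) \<le> mean_edit (m + n) (m + n) / (m + n)"
  proof (rule subadditive_limit)
    show "0 \<le> mean_edit n n" for n
      unfolding mean_edit_def using mean_mono[of n "\<lambda>_. 0" "\<lambda>x. mean A n (\<lambda>y. real (edit_distance x y))"]
        mean_mono[of n "\<lambda>_. 0" "\<lambda>y. real (edit_distance _ y)"] by simp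
    show "mean_edit 0 0 = 0" by (simp add: mean_edit_def)
  qed (use assms mean_edit_add in auto)
  also have "\<dots> \<le> (mean_edit m n + mean_edit n m) / (m + n)"
    using mean_edit_add[of m n n m] by (simp add: divide_right_mono add.commute)
  finally show ?thesis using assms by (simp add: mean_edit_commute[of n m] field_simps)
qed

text \<open>
  The minimum is taken over the ways to distribute \<open>N\<close> letters to the two strings.
\<close>

definition cheapest :: "nat \<Rightarrow> (nat \<Rightarrow> nat \<Rightarrow> real) \<Rightarrow> real" where
  "cheapest N f = Min ((\<lambda>m. f m (N - m)) ` {..N})"

text \<open>
  The minimum over the antidiagonal is within \<open>2 * g ^ 3\<close> of the minimum over \<open>g + 1\<close> equally spaced points,
  and this in turn is below the smallest mean by at most the sum of the \<open>g + 1\<close>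
  deviations, each of mean at most \<open>g\<^sup>2\<close>. Both errors are small against \<open>N = g ^ 4\<close>.
\<close>

lemma mean_cheapest_ge:
  fixes g N :: nat
  assumes "g > 0" and N: "N = g ^ 4"
  shows "lim (\<lambda>n. mean_edit n n / n) * N / 2 - 5 * g ^ 3 \<le>
    mean A N (\<lambda>x. mean A N (\<lambda>y. cheapest N (\<lambda>m n. real (edit_distance (take m x) (take n y)))))"
proof -
  define L where "L = lim (\<lambda>n. mean_edit n n / n)"
  define h :: nat where "h = g ^ 3"
  define d where "d j x y = real (edit_distance (take (j * h) x) (take (N - j * h) y))" for j :: nat and x y :: "'a list"
  define dev where "dev j x y = \<bar>d j x y - mean_edit (j * h) (N - j * h)\<bar>" for j :: nat and x y
  have gh: "g * h = N" by (simp add: h_def N power_numeral_reduce)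
  have "N > 0" using assms by simp
  have pos: "h > 0" using assms by (simp add: h_def)
  have dev: "mean A N (\<lambda>x. mean A N (\<lambda>y. dev j x y)) \<le> sqrt N" if "j \<le> g" for j
  proof -
    have jh: "j * h \<le> N" using that gh[symmetric] by simp
    define F where "F w = real (edit_distance (take (j * h) w) (drop (j * h) w))" for w :: "'a list"
    have "mean_edit (j * h) (N - j * h) = mean A (j * h + (N - j * h)) F"
      unfolding mean_edit_def mean_append by (intro mean_cong) (simp add: F_def)
    then have F: "mean A N F = mean_edit (j * h) (N - j * h)" using jh by simp
    have "mean A N (\<lambda>x. mean A N (\<lambda>y. dev j x y)) =
        mean A (j * h) (\<lambda>x. mean A (N - j * h) (\<lambda>y. \<bar>real (edit_distance x y) - mean_edit (j * h) (N - j * h)\<bar>))"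
      unfolding dev_def d_def using jh
      by (subst mean_take[of "N - j * h" N, simplified])
        (rule mean_take[of "j * h" N "\<lambda>x. mean A (N - j * h) (\<lambda>y. \<bar>real (edit_distance x y) - _\<bar>)"])
    also have "\<dots> = mean A (j * h + (N - j * h)) (\<lambda>w. \<bar>F w - mean_edit (j * h) (N - j * h)\<bar>)"
      unfolding mean_append by (intro mean_cong) (simp add: F_def)
    also have "\<dots> = mean A N (\<lambda>w. \<bar>F w - mean A N F\<bar>)" using jh by (simp add: F)
    also have "\<dots> \<le> sqrt N"
    proof (rule mean_deviation)
      fix u v :: "'a list" and a b :: 'a
      show "\<bar>F (u @ a # v) - F (u @ b # v)\<bar> \<le> 1"
      proof (cases "j * h \<le> length u")
        case True
        then show ?thesis by (simp add: F_def edit_distance_subst)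
      next
        case False
        then obtain i where "j * h - length u = Suc i" by (metis diff_is_0_eq not0_implies_Suc)
        then show ?thesis using False by (simp add: F_def edit_distance_subst)
      qed
    qed
    finally show ?thesis .
  qed
  have point: "L * N / 2 - 2 * h - (\<Sum>j\<le>g. dev j x y) \<le> cheapest N (\<lambda>m n. real (edit_distance (take m x) (take n y)))"
    for x y
  proof -
    have "L * N / 2 - 2 * h - (\<Sum>j\<le>g. dev j x y) \<le> real (edit_distance (take m x) (take (N - m) y))"
      if m: "m \<le> N" for m
    proof -
      define j where "j = m div h"
      have j: "j \<le> g" using div_le_mono[OF m, of h] gh[symmetric] pos by (simp add: j_def)
      have jm: "j * h \<le> m" "m \<le> j * h + h"
        using pos mod_less_divisor[of h m] div_mult_mod_eq[of m h] unfolding j_def by linarith+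
      have "edit_distance (take (j * h) x) (take (N - j * h) y)
          \<le> edit_distance (take m x) (take (N - m) y) + (m - j * h) + (N - j * h - (N - m))"
        by (rule edit_distance_take) (use jm in auto)
      also have "\<dots> \<le> edit_distance (take m x) (take (N - m) y) + 2 * h" using jm m by simp
      finally have "d j x y \<le> real (edit_distance (take m x) (take (N - m) y)) + 2 * h"
        by (simp add: d_def flip: of_nat_add of_nat_mult)
      moreover have "L * N / 2 \<le> mean_edit (j * h) (N - j * h)"
        using mean_edit_limit_le[of "j * h" "N - j * h"] \<open>N > 0\<close> jm m unfolding L_def by simp
      moreover have "dev j x y \<le> (\<Sum>j\<le>g. dev j x y)"
        using j by (intro member_le_sum) (auto simp: dev_def)
      ultimately show ?thesis unfolding dev_def by linarith
    qed
    then show ?thesis unfolding cheapest_def by (subst Min_ge_iff) auto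
  qed
  have "(\<Sum>j\<le>g. mean A N (\<lambda>x. mean A N (\<lambda>y. dev j x y))) \<le> (\<Sum>j\<le>g. sqrt N)"
    by (intro sum_mono dev) simp
  also have "sqrt N = real g ^ 2" by (simp add: N real_sqrt_unique flip: power_mult)
  finally have devs: "(\<Sum>j\<le>g. mean A N (\<lambda>x. mean A N (\<lambda>y. dev j x y))) \<le> (real g + 1) * real g ^ 2"
    by (simp add: add.commute)
  have "L * N / 2 - 2 * h - (\<Sum>j\<le>g. mean A N (\<lambda>x. mean A N (\<lambda>y. dev j x y)))
      = mean A N (\<lambda>x. mean A N (\<lambda>y. L * N / 2 - 2 * h - (\<Sum>j\<le>g. dev j x y)))"
    by (simp add: mean_diff mean_sum)
  also have "\<dots> \<le> mean A N (\<lambda>x. mean A N (\<lambda>y. cheapest N (\<lambda>m n. real (edit_distance (take m x) (take n y)))))"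
    by (intro mean_mono point)
  finally have *: "L * N / 2 - 2 * h - (\<Sum>j\<le>g. mean A N (\<lambda>x. mean A N (\<lambda>y. dev j x y))) \<le> \<dots>" .
  have "real g ^ 2 \<le> real g ^ 3" using assms by (intro power_increasing) auto
  moreover have "(real g + 1) * real g ^ 2 = real g ^ 3 + real g ^ 2"
    by (simp add: algebra_simps power_numeral_reduce)
  moreover have "0 \<le> real g ^ 3" by simp
  ultimately have "(real g + 1) * real g ^ 2 \<le> 3 * real g ^ 3" by linarith
  then show ?thesis using * devs unfolding L_def[symmetric] h_def by simp
qed

end

section \<open>Frontiers of the dynamic programme\<close>

text \<open>
  Neighbouring cells of the dynamic programme differ by \<open>-1\<close>, \<open>0\<close> or \<open>1\<close>.
\<close>

datatype slope = Down | Level | Up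

primrec rise :: "slope \<Rightarrow> int" where
  "rise Down = -1" | "rise Level = 0" | "rise Up = 1"

text \<open>
  When the prefixes of lengths \<open>a\<close> and \<open>b\<close> are revealed, the frontier consists of two flanks that meet in the
  cell \<open>(a, b)\<close>: the cells \<open>(i, b)\<close> and the cells \<open>(a, j)\<close>. A flank lists, starting at the corner and going
  outwards, the letter between two neighbouring cells and the rise of the cost from the outer
  to the inner of the two cells.
\<close>

type_synonym flank = "(nat \<times> slope) list"

definition slope_of :: "int \<Rightarrow> slope" where
  "slope_of i = (if i < 0 then Down else if i = 0 then Level else Up)"

text \<open>
  One square of the dynamic programme: from the rises along the outer side \<open>v\<close> and along the old side \<open>e\<close>,
  and from whether the two letters agree, the rises along the inner and along the new side.
  The three arguments of the minimum are deletion, insertion, and diagonal step.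
\<close>

definition cell :: "bool \<Rightarrow> slope \<Rightarrow> slope \<Rightarrow> slope \<times> slope" where
  "cell b v e = (let n = min 1 (min (rise v - rise e + 1) ((if b then 0 else 1) - rise e))
     in (slope_of n, slope_of (n + rise e - rise v)))"

lemma cell_simps:
  "cell False Down Down = (Up, Up)"
  "cell False Down Level = (Level, Up)"
  "cell False Down Up = (Down, Up)"
  "cell False Level Down = (Up, Level)"
  "cell False Level Level = (Up, Up)"
  "cell False Level Up = (Level, Up)"
  "cell False Up Down = (Up, Down)"
  "cell False Up Level = (Up, Level)"
  "cell False Up Up = (Level, Level)"
  "cell True Down Down = (Up, Up)"
  "cell True Down Level = (Level, Up)"
  "cell True Down Up = (Down, Up)"
  "cell True Level Down = (Up, Level)"
  "cell True Level Level = (Level, Level)"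
  "cell True Level Up = (Down, Level)"
  "cell True Up Down = (Up, Down)"
  "cell True Up Level = (Level, Down)"
  "cell True Up Up = (Down, Down)"
  by (simp_all add: cell_def slope_of_def)

lemma cell_spec:
  "cell b v e = (n, h) \<Longrightarrow> rise n = min 1 (min (rise v - rise e + 1) ((if b then 0 else 1) - rise e))
     \<and> rise h = rise n + rise e - rise v"
  by (cases b; cases v; cases e) (auto simp: cell_simps)

text \<open>
  Revealing the letter \<open>c\<close> of one string replaces the flank of the other string by the next row of the dynamic
  programme. The row is computed from the far end, where a forgotten cell can only be
  left by a deletion: hence \<open>Up\<close>. The first component is the rise from the old corner to the
  new one.
\<close>

fun cross :: "nat \<Rightarrow> flank \<Rightarrow> slope \<times> flank" where
  "cross c [] = (Up, [])"
| "cross c ((y, e) # T) =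
    (case cross c T of (v, T') \<Rightarrow> case cell (c = y) v e of (n, h) \<Rightarrow> (n, (y, h) # T'))"

text \<open>
  An outermost cell with slope \<open>Down\<close> is never better than its inner neighbour, so removing it
  loses nothing.
\<close>

fun trim :: "flank \<Rightarrow> flank" where
  "trim [] = []"
| "trim (p # S) = (case trim S of [] \<Rightarrow> if snd p = Down then [] else [p] | q # S' \<Rightarrow> p # q # S')"

fun net :: "flank \<Rightarrow> int" where
  "net [] = 0" | "net (p # S) = rise (snd p) + net S"

text \<open>
  The two strings play symmetric roles; putting the shorter flank first
  stores each state in one orientation only.
\<close>

fun tidy :: "flank \<times> flank \<Rightarrow> flank \<times> flank" where
  "tidy (S, T) = (if length (trim S) \<le> length (trim T) then (trim S, trim T) else (trim T, trim S))"

text \<open>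
  Of the two outermost cells, the one with the larger cost is given up. Any other
  choice would be sound as well. On a tie it is the second flank, which is the longer one.
\<close>

fun shorten :: "flank \<times> flank \<Rightarrow> flank \<times> flank" where
  "shorten (S, T) = (if S \<noteq> [] \<and> (T = [] \<or> net S < net T) then (butlast S, T) else (S, butlast T))"

section \<open>The cost still to be paid from a frontier\<close>

fun ren :: "(nat \<Rightarrow> nat) \<Rightarrow> flank \<Rightarrow> flank" where
  "ren f [] = []"
| "ren f ((x, v) # S) = (f x, v) # ren f S"

abbreviation letters :: "flank \<Rightarrow> nat set" where "letters S \<equiv> fst ` set S"

lemma ren_ren: "ren f (ren g S) = ren (\<lambda>x. f (g x)) S"
  by (induction S rule: ren.induct[of _ f]) auto

lemma ren_cong: "(\<And>x. x \<in> letters S \<Longrightarrow> f x = g x) \<Longrightarrow> ren f S = ren g S"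
  by (induction f S rule: ren.induct) auto

lemma ren_take: "ren f (take i S) = take i (ren f S)"
  by (induction S arbitrary: i rule: ren.induct[of _ f]) (auto simp: take_Cons')

lemma letters_cross: "letters (snd (cross c T)) = letters T"
proof -
  have "map fst (snd (cross c T)) = map fst T"
    by (induction c T rule: cross.induct) (auto split: prod.splits)
  then show ?thesis by (metis set_map)
qed

lemma cross_ren:
  "inj_on f (insert c (letters T)) \<Longrightarrow> cross (f c) (ren f T) = apsnd (ren f) (cross c T)"
proof (induction c T rule: cross.induct)
  case (2 c y e T)
  have "cross (f c) (ren f T) = apsnd (ren f) (cross c T)"
    by (rule 2) (rule inj_on_subset[OF 2(2)], auto)
  moreover have "f c = f y \<longleftrightarrow> c = y" using 2(2) by (auto simp: inj_on_def)
  ultimately show ?case by (auto split: prod.splits)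
qed simp

text \<open>
  The cost, relative to the corner, of reaching the end of both strings through a cell of the
  given flank, when \<open>xs\<close> and \<open>ys\<close> are the parts still unread. From a cell further out, the letters
  between this cell and the corner are still to be aligned.
\<close>

fun best :: "flank \<Rightarrow> nat list \<Rightarrow> nat list \<Rightarrow> int" where
  "best [] xs ys = edit_distance xs ys"
| "best ((x, v) # S) xs ys = min (edit_distance xs ys) (best S (x # xs) ys - rise v)"

definition price :: "flank \<Rightarrow> flank \<Rightarrow> nat list \<Rightarrow> nat list \<Rightarrow> int" where
  "price S T xs ys = min (best S xs ys) (best T ys xs)"

lemma price_commute: "price S T xs ys = price T S ys xs"
  by (simp add: price_def min.commute)

lemma best_le: "best S xs ys \<le> edit_distance xs ys"
  by (cases S) auto

lemma best_take: "best S xs ys \<le> best (take i S) xs ys"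
proof (induction S arbitrary: i xs)
  case (Cons p S i xs)
  obtain a v where "p = (a, v)" by fastforce
  moreover have "best S (a # xs) ys \<le> best (take (i - 1) S) (a # xs) ys" by (rule Cons.IH)
  ultimately show ?case
    by (cases "i = 0") (simp_all add: take_Cons' min_le_iff_disj del: diff_Suc_1)
qed simp

lemma price_take: "price S T xs ys \<le> price (take i S) (take j T) xs ys"
  unfolding price_def using best_take[of S xs ys i] best_take[of T ys xs j] by linarith

text \<open>
  An induction outwards along the flank; each way to attain the minimum in \<open>cell\<close> is an alignment step
  out of one of the old cells.
\<close>

lemma best_cross: "cross c T = (v, T') \<Longrightarrow> best T ys (c # xs) \<le> rise v + best T' ys xs"
proof (induction c T arbitrary: v T' ys rule: cross.induct)
  case (1 c)
  have "edit_distance ys (c # xs) \<le> 1 + edit_distance ys xs"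
    using edit_distance_Cons1[of c xs ys] by (simp add: edit_distance_commute)
  with 1 show ?case by auto
next
  case (2 c y e T)
  obtain w U where w: "cross c T = (w, U)" by fastforce
  obtain n h where n: "cell (c = y) w e = (n, h)" by fastforce
  have T': "v = n" "T' = (y, h) # U" using 2(2) w n by auto
  have IH: "best T (y # ys) (c # xs) \<le> rise w + best U (y # ys) xs" by (rule 2(1)[OF w])
  have sp: "rise n = min 1 (min (rise w - rise e + 1) ((if c = y then 0 else 1) - rise e))"
    "rise h = rise n + rise e - rise w" using cell_spec[OF n] by auto
  have a: "int (edit_distance ys (c # xs)) \<le> 1 + edit_distance ys xs"
    using edit_distance_Cons1[of c xs ys] by (simp add: edit_distance_commute)
  have b: "int (edit_distance (y # ys) (c # xs)) \<le> (if c = y then 0 else 1) + edit_distance ys xs"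
    using edit_distance_Cons_Cons[of y ys c xs] by (auto split: if_splits)
  have d: "int (edit_distance (y # ys) xs) \<le> 1 + edit_distance ys xs"
    using edit_distance_Cons1[of y ys xs] by simp
  note bl = best_le[of T "y # ys" "c # xs"] best_le[of U "y # ys" xs]
  have "best ((y, e) # T) ys (c # xs) \<le> rise n + edit_distance ys xs"
    using a b d bl IH unfolding sp by (auto simp: min_def split: if_splits)
  moreover have "best ((y, e) # T) ys (c # xs) \<le> rise n + (best U (y # ys) xs - rise h)"
    using IH sp(2) by simp
  ultimately show ?case unfolding T' by simp
qed

lemma price_read:
  assumes "cross c T = (v, T')"
  shows "price S T (c # xs) ys \<le> rise v + price ((c, v) # S) T' xs ys"
  using best_cross[OF assms, of ys xs] best_le[of T ys "c # xs"] best_le[of T' ys xs]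
  unfolding price_def by (auto simp: edit_distance_commute[of ys xs])

context
  fixes A :: "nat set" and Q :: nat
  assumes fin: "finite A" and ne: "A \<noteq> {}"
begin

interpretation alphabet A by standard (use fin ne in auto)

text \<open>
  The number of letters still to be read from both strings together is \<open>n\<close>; the
  words are longer, because it depends on the letters how the \<open>n\<close> letters are distributed. Costs are in
  units of \<open>1 / Q\<close>.
\<close>

definition affordable :: "nat \<Rightarrow> real \<Rightarrow> flank \<Rightarrow> flank \<Rightarrow> bool" where
  "affordable n b S T \<longleftrightarrow> (\<forall>l\<ge>n. \<forall>m\<ge>n. Q * mean A l (\<lambda>xs. mean A m (\<lambda>ys.
     cheapest n (\<lambda>i j. real_of_int (price S T (take i xs) (take j ys))))) \<le> b)"

lemma cheapest_le: "(\<And>i. i \<le> n \<Longrightarrow> f i (n - i) \<le> g i (n - i)) \<Longrightarrow> cheapest n f \<le> cheapest n g"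
  unfolding cheapest_def by (rule Min.boundedI) (auto intro!: Min.coboundedI[THEN order_trans])

lemma cheapest_commute: "cheapest n f = cheapest n (\<lambda>i j. f j i)"
proof -
  have "{..n} = (\<lambda>i. n - i) ` {..n}"
  proof (intro equalityI subsetI)
    fix i assume "i \<in> {..n}"
    then show "i \<in> (\<lambda>i. n - i) ` {..n}" by (intro image_eqI[of _ _ "n - i"]) auto
  qed auto
  then have "(\<lambda>i. f i (n - i)) ` {..n} = (\<lambda>i. f i (n - i)) ` (\<lambda>i. n - i) ` {..n}" by simp
  also have "\<dots> = (\<lambda>i. f (n - i) i) ` {..n}" unfolding image_image by (intro image_cong) auto
  finally show ?thesis unfolding cheapest_def by simp
qed

lemma affordable_swap: "affordable n b S T \<Longrightarrow> affordable n b T S"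
  unfolding affordable_def
  by (subst mean_swap, subst cheapest_commute, subst price_commute) blast

lemma affordable_take:
  assumes "affordable n b (take i S) (take j T)"
  shows "affordable n b S T"
  unfolding affordable_def
proof (intro allI impI)
  fix l m assume lm: "n \<le> l" "n \<le> m"
  have "Q * mean A l (\<lambda>xs. mean A m (\<lambda>ys. cheapest n (\<lambda>i j. real_of_int (price S T (take i xs) (take j ys)))))
    \<le> Q * mean A l (\<lambda>xs. mean A m (\<lambda>ys. cheapest n (\<lambda>i' j'.
          real_of_int (price (take i S) (take j T) (take i' xs) (take j' ys)))))"
    by (intro mult_left_mono mean_mono cheapest_le) (simp_all add: price_take)
  also have "\<dots> \<le> b" using assms lm unfolding affordable_def by blast
  finally show "Q * mean A l (\<lambda>xs. mean A m (\<lambda>ys.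
    cheapest n (\<lambda>i j. real_of_int (price S T (take i xs) (take j ys))))) \<le> b" .
qed

lemma affordable_0: "0 \<le> b \<Longrightarrow> affordable 0 b S T"
proof -
  assume b: "0 \<le> b"
  have "real_of_int (price S T [] []) \<le> 0"
    using best_le[of S "[]" "[]"] by (simp add: price_def min_def)
  then have "Q * real_of_int (price S T [] []) \<le> 0" by (simp add: mult_nonneg_nonpos)
  with b show ?thesis by (simp add: affordable_def cheapest_def)
qed

text \<open>
  The step of the strategy that reveals a letter: \<open>p c\<close> is what is needed if the letter is \<open>c\<close>. The reversed
  roles of the two flanks are covered by \<open>affordable_swap\<close>.
\<close>

lemma affordable_read:
  fixes p :: "nat \<Rightarrow> real" and b :: real
  assumes step: "\<And>c v T'. c \<in> A \<Longrightarrow> cross c T = (v, T') \<Longrightarrow> affordable n (p c - Q * rise v) ((c, v) # S) T'"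
    and sum: "(\<Sum>c\<in>A. p c) \<le> card A * b"
  shows "affordable (Suc n) b S T"
  unfolding affordable_def
proof (intro allI impI)
  fix l m assume lm: "Suc n \<le> l" "Suc n \<le> m"
  then obtain l' where l: "l = Suc l'" "n \<le> l'" by (cases l) auto
  define f where "f c = mean A l' (\<lambda>xs. mean A m (\<lambda>ys.
    cheapest (Suc n) (\<lambda>i j. real_of_int (price S T (take i (c # xs)) (take j ys)))))" for c
  have "Q * f c \<le> p c" if "c \<in> A" for c
  proof -
    obtain v T' where c: "cross c T = (v, T')" by fastforce
    have "cheapest (Suc n) (\<lambda>i j. real_of_int (price S T (take i (c # xs)) (take j ys))) \<le>
        rise v + cheapest n (\<lambda>i j. real_of_int (price ((c, v) # S) T' (take i xs) (take j ys)))" for xs ys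
    proof -
      have "cheapest n (\<lambda>i j. real_of_int (price ((c, v) # S) T' (take i xs) (take j ys)))
        \<in> (\<lambda>i. real_of_int (price ((c, v) # S) T' (take i xs) (take (n - i) ys))) ` {..n}"
        unfolding cheapest_def by (rule Min_in) auto
      then obtain i where i: "i \<le> n" "cheapest n (\<lambda>i j. real_of_int (price ((c, v) # S) T' (take i xs) (take j ys)))
        = real_of_int (price ((c, v) # S) T' (take i xs) (take (n - i) ys))" by auto
      have "cheapest (Suc n) (\<lambda>i j. real_of_int (price S T (take i (c # xs)) (take j ys)))
        \<le> real_of_int (price S T (take (Suc i) (c # xs)) (take (Suc n - Suc i) ys))"
        unfolding cheapest_def by (rule Min_le[OF _ image_eqI[OF refl]]) (use i in auto)
      also have "\<dots> \<le> rise v + real_of_int (price ((c, v) # S) T' (take i xs) (take (n - i) ys))"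
        using price_read[OF c, of S "take i xs" "take (n - i) ys"] by simp
      finally show ?thesis using i by simp
    qed
    then have "f c \<le> mean A l' (\<lambda>xs. mean A m (\<lambda>ys.
        rise v + cheapest n (\<lambda>i j. real_of_int (price ((c, v) # S) T' (take i xs) (take j ys)))))"
      unfolding f_def by (intro mean_mono)
    also have "\<dots> = rise v + mean A l' (\<lambda>xs. mean A m (\<lambda>ys.
        cheapest n (\<lambda>i j. real_of_int (price ((c, v) # S) T' (take i xs) (take j ys)))))"
      by (simp add: mean_add)
    finally have "Q * f c \<le> Q * (rise v + mean A l' (\<lambda>xs. mean A m (\<lambda>ys.
        cheapest n (\<lambda>i j. real_of_int (price ((c, v) # S) T' (take i xs) (take j ys))))))"
      by (rule mult_left_mono) simp
    also have "\<dots> \<le> p c"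
      using step[OF that c] l lm unfolding affordable_def by (auto simp: algebra_simps)
    finally show ?thesis .
  qed
  then have "(\<Sum>c\<in>A. Q * f c) \<le> (\<Sum>c\<in>A. p c)" by (rule sum_mono)
  with sum have "Q * (\<Sum>c\<in>A. f c) \<le> card A * b" by (simp add: sum_distrib_left)
  then show "Q * mean A l (\<lambda>xs. mean A m (\<lambda>ys.
      cheapest (Suc n) (\<lambda>i j. real_of_int (price S T (take i xs) (take j ys))))) \<le> b"
    using card_pos unfolding l by (simp add: f_def field_simps)
qed

end

section \<open>Certificates\<close>

text \<open>
  A certificate is a trie whose keys are states, first the one flank and then the other, both
  starting at the corner. The first argument of \<open>N\<close> continues where the present flank ends; the lists
  contain the children by slope and by letter. Letters are numbered in the order in which they
  occur in the key. A leaf carries the potential, and tells which string to read next: \<open>X\<close> the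
  one of the first flank, \<open>Y\<close> the one of the second. \<open>E\<close> is the empty trie. The short
  names keep the certificates readable.
\<close>

datatype trie = E | X nat | Y nat | N trie "trie list" "trie list" "trie list"

text \<open>
  The list \<open>seen\<close> assigns numbers to the letters that occurred so far; a new letter gets the next number.
\<close>

fun pick :: "nat \<Rightarrow> nat list \<Rightarrow> trie list \<Rightarrow> trie" where
  "pick x seen [] = E"
| "pick x [] (t # ts) = t"
| "pick x (y # ys) (t # ts) = (if x = y then t else pick x ys ts)"

fun enlist :: "nat \<Rightarrow> nat list \<Rightarrow> nat list" where
  "enlist x [] = [x]"
| "enlist x (y # ys) = (if x = y then y # ys else y # enlist x ys)"

fun descend :: "trie \<Rightarrow> nat list \<Rightarrow> flank \<Rightarrow> trie \<times> nat list" where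
  "descend (N t lo mi hi) seen [] = (t, seen)"
| "descend (N t lo mi hi) seen ((x, d) # S) =
    descend (pick x seen (case d of Down \<Rightarrow> lo | Level \<Rightarrow> mi | Up \<Rightarrow> hi)) (enlist x seen) S"
| "descend E seen S = (E, seen)"
| "descend (X v) seen [] = (X v, seen)"
| "descend (X v) seen (p # S) = (E, seen)"
| "descend (Y v) seen [] = (Y v, seen)"
| "descend (Y v) seen (p # S) = (E, seen)"

definition lookup :: "trie \<Rightarrow> flank \<Rightarrow> flank \<Rightarrow> trie" where
  "lookup t S T = (case descend t [] S of (u, seen) \<Rightarrow> fst (descend u seen T))"

lemma length_trim: "length (trim S) \<le> length S"
  by (induction S) (auto split: list.splits)

lemma length_tidy: "tidy p = (S, T) \<Longrightarrow> length S + length T \<le> length (fst p) + length (snd p)"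
  using length_trim[of "fst p"] length_trim[of "snd p"] by (cases p) (auto split: if_splits)

lemma shorten_less:
  assumes "\<not> (length S \<le> 0 \<and> length T \<le> 0)"
  shows "length (fst (tidy (shorten (S, T)))) + length (snd (tidy (shorten (S, T)))) < length S + length T"
proof -
  have "length (fst (shorten (S, T))) + length (snd (shorten (S, T))) < length S + length T"
    using assms by (cases S; cases T) auto
  moreover obtain U V where "tidy (shorten (S, T)) = (U, V)" by fastforce
  ultimately show ?thesis using length_tidy[of "shorten (S, T)" U V] by simp
qed

text \<open>
  States that are not in the trie are shortened until they are. The value 0 for the empty frontier is a
  default that does not occur if the trie contains the empty state.
\<close>

function search :: "trie \<Rightarrow> flank \<times> flank \<Rightarrow> nat" where
  "search t (S, T) = (case lookup t S T of X v \<Rightarrow> v | Y v \<Rightarrow> v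
    | _ \<Rightarrow> if length S \<le> 0 \<and> length T \<le> 0 then 0 else search t (tidy (shorten (S, T))))"
  by pat_completeness auto
termination
  using shorten_less by (relation "Wellfounded.measure (\<lambda>(t, p). length (fst p) + length (snd p))") auto

text \<open>
  The potential after reading \<open>c\<close>, plus the increase of the cost. The increase is raised by \<open>Q\<close> to stay within the
  natural numbers; the constant \<open>D\<close> in \<open>pays\<close> compensates for this.
\<close>

definition after :: "(flank \<Rightarrow> flank \<Rightarrow> nat) \<Rightarrow> nat \<Rightarrow> flank \<Rightarrow> flank \<Rightarrow> nat \<Rightarrow> nat" where
  "after P Q S T c = (case cross c T of (v, T') \<Rightarrow>
     (case v of Down \<Rightarrow> 0 | Level \<Rightarrow> Q | Up \<Rightarrow> Q + Q) + P ((c, v) # S) T')"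

fun total :: "(flank \<Rightarrow> flank \<Rightarrow> nat) \<Rightarrow> nat \<Rightarrow> flank \<Rightarrow> flank \<Rightarrow> nat \<Rightarrow> nat" where
  "total P Q S T 0 = 0"
| "total P Q S T (Suc c) = after P Q S T c + total P Q S T c"

text \<open>
  With \<open>m\<close> letters in the state and an alphabet of size \<open>k\<close>, the \<open>k - m\<close> letters that do not occur in the state are
  interchangeable, so \<open>m\<close> stands for all of them.
\<close>

definition pays :: "(flank \<Rightarrow> flank \<Rightarrow> nat) \<Rightarrow> nat \<Rightarrow> nat \<Rightarrow> nat \<Rightarrow> nat \<Rightarrow> nat \<Rightarrow> flank \<Rightarrow> flank \<Rightarrow> bool" where
  "pays P Q k D v m S T \<longleftrightarrow> total P Q S T m + (k - m) * after P Q S T m \<le> k * v + D"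

fun below :: "(nat \<Rightarrow> flank \<Rightarrow> trie \<Rightarrow> bool) \<Rightarrow> nat \<Rightarrow> flank \<Rightarrow> trie \<Rightarrow> bool"
  and below_list :: "(nat \<Rightarrow> flank \<Rightarrow> trie \<Rightarrow> bool) \<Rightarrow> nat \<Rightarrow> flank \<Rightarrow> slope \<Rightarrow> nat \<Rightarrow> trie list \<Rightarrow> bool" where
  "below F m S E = True"
| "below F m S (X v) = F m S (X v)"
| "below F m S (Y v) = F m S (Y v)"
| "below F m S (N t lo mi hi) = (F m S t \<and> below_list F m S Down 0 lo \<and> below_list F m S Level 0 mi \<and> below_list F m S Up 0 hi)"
| "below_list F m S d i [] = True"
| "below_list F m S d i (t # ts) =
    (below F (if i = m then Suc m else m) (S @ [(i, d)]) t \<and> below_list F m S d (Suc i) ts)"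

fun leaf_ok :: "(nat \<Rightarrow> nat \<Rightarrow> flank \<Rightarrow> flank \<Rightarrow> bool) \<Rightarrow> flank \<Rightarrow> nat \<Rightarrow> flank \<Rightarrow> trie \<Rightarrow> bool" where
  "leaf_ok C S m T E = True"
| "leaf_ok C S m T (X v) = C v m S T"
| "leaf_ok C S m T (Y v) = C v m T S"
| "leaf_ok C S m T (N t lo mi hi) = False"

definition right_ok :: "(nat \<Rightarrow> nat \<Rightarrow> flank \<Rightarrow> flank \<Rightarrow> bool) \<Rightarrow> nat \<Rightarrow> flank \<Rightarrow> trie \<Rightarrow> bool" where
  "right_ok C m S t = below (leaf_ok C S) m [] t"

definition place :: "nat \<Rightarrow> nat list \<Rightarrow> nat" where
  "place x seen = length (takeWhile (\<lambda>y. x \<noteq> y) seen)"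

lemma below_pick:
  assumes "below_list F m S d i ts"
  shows "below F (if i + place x seen = m then Suc m else m) (S @ [(i + place x seen, d)]) (pick x seen ts)"
  using assms
proof (induction x seen ts arbitrary: i rule: pick.induct)
  case (3 x y ys t ts)
  then show ?case using "3.IH"[of "Suc i"] by (auto simp: place_def)
qed (auto simp: place_def)

lemma enlist_eq: "enlist x seen = (if x \<in> set seen then seen else seen @ [x])"
  by (induction x seen rule: enlist.induct) auto

lemma place_nth: "enlist x seen ! place x seen = x" "place x seen < length (enlist x seen)"
  "(if place x seen = length seen then Suc (length seen) else length seen) = length (enlist x seen)"
  by (induction x seen rule: enlist.induct) (auto simp: place_def split: if_splits)

text \<open>
  A search in the trie is a renaming of the searched flank to the numbers on
  the path: \<open>seen'\<close> is the renaming, \<open>S1\<close> is the renamed flank.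
\<close>

lemma descend_below:
  assumes "descend t seen S = (u, seen')" "below F (length seen) S0 t" "distinct seen" "u \<noteq> E"
    and "letters S0 \<subseteq> {..<length seen}"
  shows "\<exists>S1 new. seen' = seen @ new \<and> distinct seen' \<and> set new \<subseteq> letters S \<and>
    S = ren ((!) seen') S1 \<and> letters S1 \<subseteq> {..<length seen'} \<and> F (length seen') (S0 @ S1) u"
  using assms
proof (induction t seen S arbitrary: S0 rule: descend.induct)
  case (2 t lo mi hi seen x d S)
  let ?ts = "case d of Down \<Rightarrow> lo | Level \<Rightarrow> mi | Up \<Rightarrow> hi"
  let ?p = "place x seen" and ?e = "enlist x seen"
  have "below_list F (length seen) S0 d 0 ?ts" using 2(3) by (cases d) auto
  then have "below F (length ?e) (S0 @ [(?p, d)]) (pick x seen ?ts)"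
    using below_pick[of F "length seen" S0 d 0 ?ts x seen] place_nth(3)[of x seen] by simp
  moreover have "distinct ?e" using 2(4) by (auto simp: enlist_eq)
  moreover have "letters (S0 @ [(?p, d)]) \<subseteq> {..<length ?e}"
    using 2(6) place_nth(2)[of x seen] by (auto simp: enlist_eq split: if_splits)
  ultimately obtain S1 new where 1: "seen' = ?e @ new" "distinct seen'" "set new \<subseteq> letters S"
    "S = ren ((!) seen') S1" "letters S1 \<subseteq> {..<length seen'}" "F (length seen') ((S0 @ [(?p, d)]) @ S1) u"
    using 2(1)[of "S0 @ [(?p, d)]"] 2(2,5) by auto
  have "seen' ! ?p = x" using place_nth(1,2)[of x seen] by (simp add: 1(1) nth_append)
  then have "(x, d) # S = ren ((!) seen') ((?p, d) # S1)" using 1(4) by simp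
  moreover have "letters ((?p, d) # S1) \<subseteq> {..<length seen'}"
    using 1(1,5) place_nth(2)[of x seen] by auto
  moreover obtain new' where "seen' = seen @ new'" "set new' \<subseteq> letters ((x, d) # S)"
    using 1(1,3) by (auto simp: enlist_eq split: if_splits)
  ultimately show ?case using 1(2,6) by (intro exI[of _ "(?p, d) # S1"] exI[of _ new']) auto
qed (auto intro!: exI[of _ "[]"])

lemma lookup_ok:
  assumes "below (right_ok C) 0 [] t" "lookup t S T = w" "w \<noteq> E"
  shows "\<exists>seen S1 T1. distinct seen \<and> set seen \<subseteq> letters S \<union> letters T \<and> S = ren ((!) seen) S1 \<and> T = ren ((!) seen) T1
    \<and> letters S1 \<union> letters T1 \<subseteq> {..<length seen} \<and> leaf_ok C S1 (length seen) T1 w"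
proof -
  obtain u seen1 where u: "descend t [] S = (u, seen1)" by fastforce
  obtain w' seen2 where w: "descend u seen1 T = (w', seen2)" by fastforce
  have w': "w' = w" using assms(2) by (simp add: lookup_def u w)
  then have "u \<noteq> E" using w assms(3) by (cases T) auto
  from descend_below[OF u, of "right_ok C" "[]"] assms(1) this
  obtain S1 where 1: "distinct seen1" "set seen1 \<subseteq> letters S" "S = ren ((!) seen1) S1"
    "letters S1 \<subseteq> {..<length seen1}" "right_ok C (length seen1) S1 u" by auto
  from descend_below[OF w, of "leaf_ok C S1" "[]"] 1(1,5) assms(3) w'
  obtain T1 new where 2: "seen2 = seen1 @ new" "distinct seen2" "set new \<subseteq> letters T" "T = ren ((!) seen2) T1"
    "letters T1 \<subseteq> {..<length seen2}" "leaf_ok C S1 (length seen2) T1 w"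
    by (auto simp: right_ok_def)
  have "S = ren ((!) seen2) S1"
    unfolding 1(3) by (rule ren_cong) (use 1(4) 2(1) in \<open>auto simp: nth_append\<close>)
  then show ?thesis using 1 2 by (intro exI[of _ seen2] exI[of _ S1] exI[of _ T1]) auto
qed

lemma trim_take: "\<exists>i. trim S = take i S"
proof (induction S)
  case (Cons p S)
  then obtain i where i: "trim S = take i S" by blast
  show ?case
  proof (cases "trim S")
    case Nil
    then show ?thesis
      by (cases "snd p = Down") (auto intro: exI[of _ 0] exI[of _ "Suc 0"])
  next
    case (Cons q S')
    then have "trim (p # S) = take (Suc i) (p # S)" using i by simp
    then show ?thesis ..
  qed
qed simp

lemma letters_trim: "letters (trim S) \<subseteq> letters S"
  using trim_take[of S] set_take_subset by (metis image_mono)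

lemma letters_tidy: "tidy (S, T) = (U, V) \<Longrightarrow> letters U \<union> letters V \<subseteq> letters S \<union> letters T"
  using Un_mono[OF letters_trim[of S] letters_trim[of T]] by (simp add: Un_commute split: if_splits)

context
  fixes A :: "nat set" and Q R :: nat
  assumes fin: "finite A" and ne: "A \<noteq> {}"
begin

interpretation alphabet A by standard (use fin ne in auto)

abbreviation "afford \<equiv> affordable A Q"
lemmas afford_swap = affordable_swap[OF fin ne] and afford_take = affordable_take[OF fin ne]
  and afford_read = affordable_read[OF fin ne] and afford_0 = affordable_0[OF fin ne]

lemma affordable_tidy:
  assumes "tidy (S, T) = (U, V)" "afford n b (ren f U) (ren f V)"
  shows "afford n b (ren f S) (ren f T)"
proof -
  obtain i j where ij: "trim S = take i S" "trim T = take j T" using trim_take by metis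
  have "afford n b (ren f (trim S)) (ren f (trim T))"
    using assms afford_swap by (auto split: if_splits)
  then have "afford n b (take i (ren f S)) (take j (ren f T))" by (simp add: ij ren_take)
  then show ?thesis by (rule afford_take)
qed

lemma affordable_shorten:
  assumes "shorten (S, T) = (U, V)" "afford n b (ren f U) (ren f V)"
  shows "afford n b (ren f S) (ren f T)"
proof -
  have "U = take (length U) S \<and> V = take (length V) T"
    using assms(1) by (auto simp: butlast_conv_take split: if_splits)
  then obtain i j where "U = take i S" "V = take j T" by blast
  then have "afford n b (take i (ren f S)) (take j (ren f T))" using assms(2) by (simp add: ren_take)
  then show ?thesis by (rule afford_take)
qed

text \<open>
  The claim is made for all injective renamings \<open>f\<close> of the letters at once. Then the induction can go from a
  concrete state to its renamed copy in the trie and on to the successors of that copy, and it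
  never has to compare the potentials of a state and of its renamed copy.
\<close>

definition sound :: "(flank \<Rightarrow> flank \<Rightarrow> nat) \<Rightarrow> nat \<Rightarrow> bool" where
  "sound P n \<longleftrightarrow> (\<forall>f S T. inj_on f (letters S \<union> letters T) \<longrightarrow> f ` (letters S \<union> letters T) \<subseteq> A \<longrightarrow>
     afford n (P S T + R * n) (ren f S) (ren f T))"

lemma total_sum: "total P Q S T m = (\<Sum>i<m. after P Q S T i)"
  by (induction m) auto

lemma after_eq: "cross c T = (v, T') \<Longrightarrow>
    real (after P Q S T c) = P ((c, v) # S) T' + Q * rise v + Q"
  by (cases v) (auto simp: after_def)

text \<open>
  The alphabet splits into the \<open>m\<close> letters of the state and the others. The successor for one of the others
  is a renaming of the successor for the number \<open>m\<close>, so the sum over the alphabet collapses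
  to the sum in \<open>pays\<close>.
\<close>

lemma affordable_leaf:
  assumes P: "sound P n" and pays: "pays P Q (card A) (card A * (R + Q)) v m S T"
    and f: "inj_on f {..<m}" "f ` {..<m} \<subseteq> A" and m: "letters S \<union> letters T \<subseteq> {..<m}"
  shows "afford (Suc n) (v + R * Suc n) (ren f S) (ren f T)"
proof -
  have mle: "m \<le> card A" using card_inj_on_le[OF f fin] by simp
  define idx where "idx c = (if c \<in> f ` {..<m} then the_inv_into {..<m} f c else m)" for c
  define p where "p c = real (after P Q S T (idx c)) - Q + R * n" for c
  have idx: "idx (f i) = i" if "i < m" for i
    using that f by (simp add: idx_def the_inv_into_f_f)
  show ?thesis
  proof (rule afford_read[where p = p])
    fix c v' T'
    assume c: "c \<in> A" and cr: "cross c (ren f T) = (v', T')"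
    \<comment> \<open>A letter \<open>c\<close> that does not occur in the state gets the number \<open>m\<close>.\<close>
    define g where "g = f(m := c)"
    define h where "h = (if c \<in> f ` {..<m} then f else g)"
    have hS: "ren h S = ren f S" "ren h T = ren f T"
      using m by (auto simp: h_def g_def intro!: ren_cong)
    have hc: "h (idx c) = c" using f(1) by (auto simp: h_def g_def idx_def the_inv_into_f_f)
    have inj: "inj_on h (insert (idx c) {..<m})"
      using f(1) by (auto simp: h_def g_def idx_def inj_on_def the_inv_into_f_f)
    have img: "h ` insert (idx c) {..<m} \<subseteq> A"
      using f c hc by (auto simp: h_def g_def)
    obtain w U where w: "cross (idx c) T = (w, U)" by fastforce
    have "cross c (ren f T) = apsnd (ren h) (cross (idx c) T)"
      using cross_ren[of h "idx c" T] inj_on_subset[OF inj, of "insert (idx c) (letters T)"] m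
      by (auto simp: hc hS)
    then have v': "v' = w" "T' = ren h U" using cr w by auto
    have "letters U = letters T" using letters_cross[of "idx c" T] w by simp
    then have sub: "letters ((idx c, w) # S) \<union> letters U \<subseteq> insert (idx c) {..<m}" using m by auto
    have "afford n (P ((idx c, w) # S) U + R * n) (ren h ((idx c, w) # S)) (ren h U)"
      using P inj_on_subset[OF inj sub] image_mono[OF sub, of h] img unfolding sound_def by blast
    moreover have "P ((idx c, w) # S) U + R * n = p c - Q * rise v'"
      using after_eq[OF w, of P S] by (simp add: p_def v')
    ultimately show "afford n (p c - Q * rise v') ((c, v') # ren f S) T'"
      by (simp add: hc hS v')
  next
    have "(\<Sum>c\<in>A. p c) = (\<Sum>c\<in>f ` {..<m}. p c) + (\<Sum>c\<in>A - f ` {..<m}. p c)"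
      using sum.subset_diff[OF f(2) fin, of p] by simp
    also have "(\<Sum>c\<in>f ` {..<m}. p c) = (\<Sum>i<m. real (after P Q S T i) - Q + R * n)"
      by (simp add: sum.reindex[OF f(1)] p_def idx)
    also have "(\<Sum>c\<in>A - f ` {..<m}. p c) = (\<Sum>c\<in>A - f ` {..<m}. real (after P Q S T m) - Q + R * n)"
      by (rule sum.cong) (auto simp: p_def idx_def)
    also have "\<dots> = real (card A - m) * (real (after P Q S T m) - Q + R * n)"
      using f fin by (simp add: card_Diff_subset card_image finite_subset)
    finally have "(\<Sum>c\<in>A. p c) = (\<Sum>i<m. real (after P Q S T i) - Q + R * n)
      + real (card A - m) * (real (after P Q S T m) - Q + R * n)" .
    moreover obtain d where "card A = m + d" using mle le_Suc_ex by blast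
    ultimately have "(\<Sum>c\<in>A. p c) = real (total P Q S T m + (card A - m) * after P Q S T m)
        + real (card A) * (real (R * n) - Q)"
      by (simp add: total_sum sum.distrib sum_subtractf algebra_simps)
    also have "\<dots> \<le> real (card A * v + card A * (R + Q)) + real (card A) * (real (R * n) - Q)"
      using pays unfolding pays_def by (intro add_right_mono of_nat_mono)
    finally show "(\<Sum>c\<in>A. p c) \<le> real (card A) * real (v + R * Suc n)"
      by (simp add: algebra_simps)
  qed
qed

lemma affordable_search:
  assumes P: "sound P n" and ok: "below (right_ok (pays P Q (card A) (card A * (R + Q)))) 0 [] t"
    and root: "lookup t [] [] \<noteq> E"
    and f: "inj_on f (letters S \<union> letters T)" "f ` (letters S \<union> letters T) \<subseteq> A"
  shows "afford (Suc n) (search t (S, T) + R * Suc n) (ren f S) (ren f T)"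
  using f
proof (induction "length S + length T" arbitrary: S T rule: less_induct)
  case less
  define w where "w = lookup t S T"
  show ?case
  proof (cases "w = E")
    case True
    then have ne: "\<not> (length S \<le> 0 \<and> length T \<le> 0)" using root by (auto simp: w_def)
    obtain S' T' where s: "shorten (S, T) = (S', T')" by fastforce
    obtain U V where u: "tidy (S', T') = (U, V)" by fastforce
    have le: "length U + length V < length S + length T" using shorten_less[OF ne] by (simp only: s u fst_conv snd_conv)
    have sub1: "letters S' \<subseteq> letters S" "letters T' \<subseteq> letters T"
      using s by (auto split: if_splits dest: in_set_butlastD)
    have sub: "letters U \<union> letters V \<subseteq> letters S \<union> letters T"
      using order_trans[OF letters_tidy[OF u] Un_mono[OF sub1]] .
    have "afford (Suc n) (search t (U, V) + R * Suc n) (ren f U) (ren f V)"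
      by (rule less.hyps[OF le inj_on_subset[OF less.prems(1) sub] order_trans[OF image_mono[OF sub] less.prems(2)]])
    then have "afford (Suc n) (search t (U, V) + R * Suc n) (ren f S) (ren f T)"
      by (rule affordable_shorten[OF s affordable_tidy[OF u]])
    moreover have "search t (S, T) = search t (U, V)"
      by (subst search.simps) (simp only: w_def[symmetric] True ne s u trie.case if_False)
    ultimately show ?thesis by (simp only:)
  next
    case False
    obtain seen S1 T1 where 1: "distinct seen" "set seen \<subseteq> letters S \<union> letters T"
      "S = ren ((!) seen) S1" "T = ren ((!) seen) T1" "letters S1 \<union> letters T1 \<subseteq> {..<length seen}"
      "leaf_ok (pays P Q (card A) (card A * (R + Q))) S1 (length seen) T1 w"
      using lookup_ok[OF ok w_def[symmetric] False] by blast
    define g where "g i = f (seen ! i)" for i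
    have nth: "inj_on ((!) seen) {..<length seen}" "(!) seen ` {..<length seen} = set seen"
      using 1(1) by (auto simp: inj_on_def nth_eq_iff_index_eq set_conv_nth)
    have g: "inj_on g {..<length seen}" "g ` {..<length seen} \<subseteq> A"
    proof -
      have "inj_on (f \<circ> (!) seen) {..<length seen}"
        by (rule comp_inj_on[OF nth(1)]) (use nth(2) 1(2) less.prems(1) in \<open>auto intro: inj_on_subset\<close>)
      then show "inj_on g {..<length seen}" by (simp add: g_def[abs_def] comp_def)
      have "g ` {..<length seen} = f ` set seen" unfolding nth(2)[symmetric] g_def by auto
      then show "g ` {..<length seen} \<subseteq> A" using 1(2) less.prems(2) by blast
    qed
    have ren: "ren f S = ren g S1" "ren f T = ren g T1" by (simp_all add: 1(3,4) ren_ren g_def[abs_def])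
    show ?thesis
    proof (cases w)
      case (X v)
      have "afford (Suc n) (v + R * Suc n) (ren g S1) (ren g T1)"
        by (rule affordable_leaf[OF P _ g 1(5)]) (use 1(6) X in simp)
      then show ?thesis using X by (simp add: w_def ren)
    next
      case (Y v)
      have "afford (Suc n) (v + R * Suc n) (ren g T1) (ren g S1)"
        by (rule affordable_leaf[OF P _ g]) (use 1(5,6) Y in auto)
      from afford_swap[OF this] show ?thesis using Y by (simp add: w_def ren)
    qed (use False 1(6) in auto)
  qed
qed

lemma sound_search:
  assumes ok: "below (right_ok (pays (\<lambda>S T. search t (tidy (S, T))) Q (card A) (card A * (R + Q)))) 0 [] t"
    and root: "lookup t [] [] \<noteq> E"
  shows "sound (\<lambda>S T. search t (tidy (S, T))) n"
proof (induction n)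
  case (Suc n)
  show ?case unfolding sound_def
  proof (intro allI impI)
    fix f S T
    assume f: "inj_on f (letters S \<union> letters T)" "f ` (letters S \<union> letters T) \<subseteq> A"
    obtain U V where u: "tidy (S, T) = (U, V)" by fastforce
    note sub = letters_tidy[OF u]
    have "afford (Suc n) (search t (U, V) + R * Suc n) (ren f U) (ren f V)"
      by (rule affordable_search[OF Suc ok root]) (rule inj_on_subset[OF f(1) sub] order_trans[OF image_mono[OF sub] f(2)])+
    then show "afford (Suc n) (search t (tidy (S, T)) + R * Suc n) (ren f S) (ren f T)"
      unfolding u by (rule affordable_tidy[OF u])
  qed
qed (simp add: sound_def afford_0)

end

text \<open>
  The errors in \<open>mean_cheapest_ge\<close> and the initial potential are negligible against \<open>g ^ 4\<close> letters.
\<close>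

theorem edit_constant_le:
  fixes k Q R D :: nat and b :: real
  assumes P: "\<And>S T. P S T = search t (tidy (S, T))" and C: "C = pays P Q k D" and D: "D = k * (R + Q)"
    and check: "below (right_ok C) 0 [] t" and root: "lookup t [] [] \<noteq> E"
    and "k > 0" "Q > 0" "2 * R \<le> b * Q"
  shows "\<alpha> k \<le> b"
proof -
  have "P = (\<lambda>S T. search t (tidy (S, T)))" using P by blast
  then have ok: "below (right_ok (pays (\<lambda>S T. search t (tidy (S, T))) Q k (k * (R + Q)))) 0 [] t"
    using check unfolding C D by simp
  define A where "A = {1..k}"
  have A_fin: "finite A" "A \<noteq> {}" and card: "card A = k" using \<open>k > 0\<close> by (auto simp: A_def)
  interpret alphabet A by standard (use A_fin in auto)
  define M where "M n = mean A n (\<lambda>x. mean A n (\<lambda>y. cheapest n (\<lambda>i j. real (edit_distance (take i x) (take j y)))))" for n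
  have lim: "\<alpha> k = lim (\<lambda>n. mean_edit n n / n)"
    unfolding edit_constant_def mean_edit_def unfolding A_def
    by (simp add: expected_edit_distance_mean[OF \<open>k > 0\<close>])
  define p where "p = real (search t (tidy ([], [])))"
  have up: "Q * M n \<le> p + R * n" for n
  proof -
    have "sound A Q R (\<lambda>S T. search t (tidy (S, T))) n"
      by (rule sound_search[OF A_fin ok[folded card] root])
    then have "affordable A Q n (p + R * n) [] []"
      unfolding sound_def[OF A_fin] p_def by (elim allE[of _ id] allE[of _ "[]"]) simp
    then show ?thesis unfolding affordable_def[OF A_fin] M_def by (simp add: price_def edit_distance_commute)
  qed
  have "\<alpha> k * (Q / 2) - R \<le> (p + 5 * Q) / g" if "g > 0" for g :: nat
  proof -
    have "\<alpha> k * real (g ^ 4) / 2 - 5 * real g ^ 3 \<le> M (g ^ 4)"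
      using mean_cheapest_ge[OF that refl] unfolding lim M_def by simp
    then have "Q * (\<alpha> k * real (g ^ 4) / 2 - 5 * real g ^ 3) \<le> Q * M (g ^ 4)"
      by (rule mult_left_mono) simp
    also have "\<dots> \<le> p + R * real g ^ 4" using up[of "g ^ 4"] by simp
    finally have "(\<alpha> k * (Q / 2) - R) * real g ^ 4 \<le> p + 5 * Q * real g ^ 3" by (simp add: algebra_simps)
    also have "\<dots> \<le> p * real g ^ 3 + 5 * Q * real g ^ 3"
      using that by (simp add: p_def mult_le_cancel_left1 one_le_power)
    finally have "((\<alpha> k * (Q / 2) - R) * g) * real g ^ 3 \<le> (p + 5 * Q) * real g ^ 3"
      by (simp add: algebra_simps power_numeral_reduce)
    then have "(\<alpha> k * (Q / 2) - R) * g \<le> p + 5 * Q" using that by simp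
    then show ?thesis using that by (simp add: field_simps)
  qed
  moreover have "(\<lambda>g. (p + 5 * Q) / real g) \<longlonglongrightarrow> 0" by real_asymp
  ultimately have "\<alpha> k * (Q / 2) - R \<le> 0"
    by (intro LIMSEQ_le_const) (auto intro: exI[of _ 1])
  then have "\<alpha> k * Q \<le> b * Q" using \<open>2 * R \<le> b * Q\<close> by simp
  then show ?thesis using \<open>Q > 0\<close> by simp
qed

section \<open>Checking certificates by rewriting\<close>

text \<open>
  The certificates are checked with these rules only, so that rewriting amounts to evaluating the functions
  above with innermost reduction; the congruence rules keep the branches of case distinctions
  unevaluated until the branch is known. The subtrees of a certificate are constants that are unfolded only
  under \<open>descend\<close>: otherwise every rewrite step would traverse the whole trie.
\<close>

named_theorems compute

lemmas [compute] = below.simps below_list.simps leaf_ok.simps right_ok_def total.simps after_def search.simps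
  lookup_def descend.simps enlist.simps pick.simps shorten.simps tidy.simps net.simps trim.simps cross.simps
  cell_simps rise.simps prod.case list.case slope.case trie.case fst_conv snd_conv if_True if_False
  simp_thms append_Cons append_Nil list.distinct slope.distinct nat.inject nat.distinct
  list.size(3) length_Cons zero_le Suc_le_mono not_less_eq_eq le_0_eq butlast.simps
  arith_simps rel_simps arith_special less_irrefl Num.inc.simps mult_1 mult_0

lemmas lazy_cong = if_weak_cong list.case_cong_weak slope.case_cong_weak trie.case_cong_weak

section \<open>Shape of the certificates\<close>

text \<open>
  For an alphabet of size \<open>k\<close>, \<open>tk\<close> is the trie (\<open>tk_i\<close> are its subtrees), \<open>pk\<close> the potential of arbitrary states, and
  \<open>ck\<close> the inequality at a leaf. The states and the potentials come from value iteration for the decision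
  process in which every step chooses the string to read. Its states were the frontiers
  with at most four to nine cells; of these, the states whose removal costs least were
  removed repeatedly, as long as the rate stayed below the bound to be shown.
\<close>

text \<open>
  Nodes with a single child are frequent. Their abbreviations consist of the slope and the number of the letter
  that lead to the child.
\<close>

abbreviation (input) "D0 t \<equiv> N E [t] [] []"
abbreviation (input) "D1 t \<equiv> N E [E, t] [] []"
abbreviation (input) "L0 t \<equiv> N E [] [t] []"
abbreviation (input) "L1 t \<equiv> N E [] [E, t] []"
abbreviation (input) "L2 t \<equiv> N E [] [E, E, t] []"
abbreviation (input) "L3 t \<equiv> N E [] [E, E, E, t] []"
abbreviation (input) "L4 t \<equiv> N E [] [E, E, E, E, t] []"
abbreviation (input) "U0 t \<equiv> N E [] [] [t]"
abbreviation (input) "U1 t \<equiv> N E [] [] [E, t]"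
abbreviation (input) "U2 t \<equiv> N E [] [] [E, E, t]"
abbreviation (input) "U3 t \<equiv> N E [] [] [E, E, E, t]"

section \<open>Certificate for 2 letters\<close>

definition "t2_0 = N (X 84701)[N E[N E[][E,X 84626][E,L1 (X 83951)]][U0 (X 81989),N (X 84101)[][E,N E[][E,
L1 (L1 (X 83017))][E,X 81270]][E,N E[][L1 (X 79044),X 79805][]]][N (X 80996)[][][X 74372],
U1 (X 70379)]][N (X 81657)[][N (X 79990)[][X 79117,X 77772][X 73252,N (X 70347)[][E,
L0 (L0 (L1 (X 65420)))][]],N (X 78372)[][L1 (X 75667),N (X 76398)[][E,
L1 (X 74742)][]][]][N (X 71528)[][X 70100][L0 (X 57696)],X 68527],N (X 80393)[L1 (X 80232)][L1 (X 76334),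
N (X 77762)[][E,X 76285][]][]][N (X 69956)[][N (X 67432)[][L1 (X 63445),
X 63054][]][N (X 53814)[][L0 (X 50882)][],X 48534],N (X 67511)[][L1 (X 59142),N (X 63130)[][E,
X 60746][]][N (X 45989)[][X 41836][X 26571],N E[][X 42097,X 45187][]]]"

definition "t2_1 = N (X 68314)[N E[U1 (L1 (X 65940))][E,N (X 67105)[][E,X 65822][E,U0 (X 49563)]][E,
N (X 61368)[][][E,N E[][E,X 44315][X 28463]]],N E[][U1 (X 59781)][X 62189]][N (X 64302)[L1 (N (X 63632)[][E,
X 62809][])][N (X 62148)[][X 61028][E,X 48212],N (X 58902)[][E,N (X 56456)[][E,
L1 (L1 (X 52391))][]][]][N (X 50989)[][][E,X 29007],N (X 45892)[][E,X 40945][X 25367]],N (X 60861)[][X 57647,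
N (X 56927)[][U0 (L1 (D1 (L0 (X 41528))))][L0 (L1 (L1 (L0 (X 36662))))]][N (X 44892)[][][X 26238]]][N (X 48440)[N E[L1 (L1 (X 48020))][E,
L1 (X 45743)][]][N (X 45458)[][X 43855,X 39686][X 32546],N (X 40259)[][E,
X 35657][X 24046]][N (X 29507)[L1 (X 28746)][][E,X 4192],N (X 23266)[][E,X 17953][]],
N (X 43949)[][L1 (X 34446),X 38907][X 20393,N (X 23135)[][E,X 19422][E,X 3756]]]"

definition "t2_2 = N (N E[N E[][N (X 87756)[][N (X 87067)[][][E,X 83912]][E,
L1 (U1 (L1 (X 73065)))]][L0 (L1 (X 79554))]][N E[N E[][X 83039,
Y 82989][X 80276]][N (Y 80595)[L1 (X 80349)][N (X 79029)[][E,X 77301][]][],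
N (X 79623)[][N (X 77529)[L1 (X 77344)][][]][]][N (Y 69426)[][N (X 67157)[][X 66442][]][],
N (X 67210)[L1 (X 67086)][X 61726][]]][N E[L0 (D0 (L1 (X 67141)))][N (Y 63941)[L1 (X 63311)][Y 61790][]][],
N E[N E[L1 (X 68013)][X 66252][]][N E[L1 (X 60215)][X 56886][X 44946]][N E[D0 (L1 (L1 (X 43711)))][L0 (X 36201)][]]])[L1 (N (D0 (D0 (D0 (L1 (Y 88949)))))[][][])][N (L0 (D0 (L1 (Y 82346))))[][E,
N (D0 (L0 (N E[L1 (Y 86624)][L1 (X 86604)][])))[][][]][],N (N E[N E[N E[][E,N E[][E,Y 87969][E,X 87732]][E,
N E[][X 86827][E,X 84586]]][N E[][E,X 86194][E,N (X 82361)[][N (X 80259)[][E,X 79584][],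
X 80952][]]][U1 (L0 (X 65032))]][N E[N E[][E,N (Y 82468)[][E,X 82155][E,X 79964]][E,
L1 (X 77858)]][N E[][L0 (Y 78294),X 77428][]][]][N E[N E[N E[][E,Y 67578][E,
X 66699]][L1 (Y 65887)][]][D0 (L0 (L1 (Y 63843)))][],D0 (D0 (U1 (L1 (X 66645))))])[][E,
N (N E[N E[U1 (L1 (Y 86823))][U1 (U0 (X 71381))][]][D0 (L0 (L1 (Y 82246)))][])[][][]][]][N (N E[][N E[L1 (X 79748)][L1 (X 75678)][]][E,
N E[L0 (N E[L1 (X 65365)][L1 (X 65326)][])][L0 (Y 56665)][]])[][][],N (N E[N E[N E[][E,Y 83392][E,
Y 83028]][N E[][E,Y 82361][E,N (X 79895)[][X 79238,X 79012][]]][U1 (Y 69030)]][N E[N E[][E,N (X 79107)[][E,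
X 79022][E,N (X 78249)[][E,X 77542][]]][E,L1 (X 76522)]][N E[][X 76350,N (X 75469)[][E,X 74586][]][Y 70034,
Y 67879]][]][N E[L0 (L1 (Y 65274))][L0 (Y 61141)][],
D0 (L0 (L1 (Y 65066)))])[][][N (L0 (D0 (U1 (L1 (Y 70307)))))[][][]]]"

definition "t2_3 = N E[E,N E[][][X 88515,N (X 88383)[][L0 (X 87475)][]]][E,N (X 88705)[U0 (X 87666),
U1 (X 87713)][N (X 87794)[][N (X 87121)[][X 86771][N (X 84747)[][][X 82578]],
X 87298][N (X 83403)[][][L0 (X 75828)]],N (X 87780)[][L0 (X 86871),N (X 87215)[][E,X 86930][]][X 83301,
X 83901]][N (X 82514)[U1 (X 80876)][L1 (X 79150)][E,X 71403],N (X 83123)[][L0 (X 79120),X 81555][Y 70761]]][E,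
N (Y 83045)[N E[][E,N (X 82879)[][E,X 82693][]][E,
N (X 80756)[U1 (X 80563)][L1 (X 78723)][]]][N (X 79695)[][N (X 77872)[][N (X 76976)[][X 76571][]][],
X 78121][E,N E[L1 (X 69304)][E,X 66328][]],N (X 80408)[][E,X 78916][E,
X 71950]][N (X 68217)[L1 (L1 (X 69341))][N (X 64901)[][E,X 61435][]][],N (X 69976)[L1 (X 69506)][E,
N (Y 67268)[][E,X 65872][]][Y 49715]]]"

definition "t2_4 = N E[t2_3][N E[N E[][X 83559,N (X 83580)[][E,X 83118][]][X 80560,
X 79831]][N E[N E[][X 80993,X 80933][]][N (X 79633)[][N (X 78793)[][X 78495][]][],N E[][E,L1 (X 75516)][E,
X 68913]][N (X 71391)[][L0 (X 69514)][],Y 68381],N (X 79949)[][E,N (X 77435)[][E,N (X 76014)[][E,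
L1 (Y 74929)][]][X 67998,L1 (X 67819)]][E,N (X 68104)[][X 63120,L1 (X 64102)][]]][N (Y 69785)[N E[][E,
N (X 69057)[][E,X 68191][]][E,X 64295]][X 67295][N (X 53753)[][][X 37074]],N (Y 67335)[N E[][E,X 67039][E,
X 63103]][N (X 61643)[L1 (U1 (X 58923))][][],N (X 63043)[][E,X 60689][]][E,X 48530]]][N E[N E[E,
L1 (X 67950)][E,N (X 66956)[][E,X 65712][]][E,
N (X 60803)[][X 58285][]]][N (X 64183)[][N (X 62069)[][L0 (X 60375)][],
D1 (U1 (L0 (X 54019)))][X 50728]][U0 (D0 (D1 (L1 (X 29275))))],D0 (L1 (X 67569))]"

definition "t2_5 = N E[N E[E,U1 (N (X 87488)[][][L0 (X 82569)])][E,
N E[][N (X 87138)[][N (X 86761)[][X 86410][]][],X 86956][E,N (X 82668)[][X 80491][]]][E,N E[N E[][E,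
X 82441][E,X 80598]][E,X 80065][]]][N E[N E[][E,N (Y 83112)[][X 82881,Y 82761][L0 (X 79788)]][E,
N E[][N (X 77971)[][X 77082][]][X 70077]]][N E[N E[][E,X 80676][E,
X 78528]][N (X 79451)[][Y 78663][]][N E[][X 69950][X 58799]],N E[E,U1 (N (X 76969)[][Y 76010][])][E,
X 77213][]][L0 (N E[L1 (X 66998)][X 66036][]),D0 (N E[E,U1 (X 66683)][E,L1 (X 66473)][])]][N E[N E[E,N E[][E,
Y 67807][E,N (X 66316)[][X 65988][]]][E,N (X 66859)[][X 66317,N (X 65573)[][X 65245][]][]][]][N E[N E[E,
U1 (X 63221)][E,N (X 63512)[][][E,X 59178]][E,X 59379]][E,D1 (L1 (X 58203))][]][D0 (N E[E,L1 (Y 48178)][E,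
X 47353][])]]"

definition "t2_6 = N t2_4[L1 (N (L0 (D0 (L0 (L1 (X 82987)))))[][][])][N (N E[N E[E,U0 (Y 87714)][E,
N E[][X 87071,N (Y 87138)[][E,N (Y 86757)[][E,X 86494][]][]][D0 (L1 (X 82113)),X 82971]][E,D0 (N E[][X 82319,
X 82494][X 79765])]][N E[][L0 (X 79229),N E[E,N E[][X 79393][X 77600]][E,N (X 77251)[][E,X 75925][]][]][E,
L1 (D1 (L0 (X 62545)))]][E,D0 (D1 (U0 (X 66804)))])[][E,N (L0 (L0 (D0 (L1 (X 80377)))))[][][]][],
N t2_5[][N (D0 (L1 (L1 (L1 (X 86267)))))[][][],N (D0 (L1 (L0 (L0 (X 86442)))))[][][]][E,
N (N E[L1 (N E[][][L0 (X 80087),L0 (X 80491)])][L0 (L0 (L0 (X 77805)))][])[][][]]][N (N E[N E[E,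
U0 (X 82525)][E,N E[][X 82172][N (X 79072)[][X 77953][],X 79840]][E,
N E[U0 (X 78045)][N (Y 76774)[][X 75688][],L1 (Y 76819)][]]][N E[][E,N E[E,U0 (X 75543)][E,
N (Y 74838)[][X 74085][]][]][E,N E[][Y 61006,Y 62508][]]][])[][][],N (N E[N E[E,U1 (Y 83083)][E,N E[][E,
Y 82668][N (X 79840)[][X 78635][],N (X 79878)[][X 78727,X 78821][]]][E,
N E[U1 (Y 78626)][N (Y 77370)[][X 76207][],N (X 77625)[][E,X 76589][]][X 67745,
N (X 68982)[][X 64553][]]]][N E[N E[][E,N (Y 79776)[][][X 78893]][E,
N (X 77545)[][X 76688][]]][N E[][L0 (Y 76950)][X 71061,N (X 68027)[][X 64160][]],N E[E,U1 (X 75140)][E,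
N (Y 75069)[][E,X 73952][E,N (X 69119)[][X 65824][]]][E,U1 (X 53213)]][E,L1 (Y 62307)]][N E[N E[E,
U1 (X 65545)][E,N (Y 65789)[][E,Y 64889][]][E,N (X 60533)[][E,X 57799][]]][N E[L1 (U1 (X 59523))][E,
X 58689][]][]])[][N (D0 (U1 (L1 (L1 (X 76030)))))[][][]][]]"

definition "t2_7 = N (N E[][N E[L1 (X 78605)][N (X 76356)[][E,N (X 74307)[][E,X 73272][]][E,X 66972],
N (X 76002)[][L0 (L1 (X 72847))][]][E,N (X 65269)[L0 (X 64800)][N (X 60354)[][X 58150][],X 61697][E,
X 48530]]][N E[][L1 (X 58001)][E,N (Y 43582)[][X 37508][]],N E[N E[N E[][E,X 66186][E,
X 65494]][L1 (X 64142)][]][N (X 59621)[L1 (X 59173)][N (X 56037)[][N (X 54121)[][X 53252][]][],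
X 56779][X 44767]][N (Y 43652)[N E[L1 (Y 43477)][L1 (X 41387)][]][N E[L0 (L1 (X 37989))][X 36201][]][],
Y 47940]])[E,L0 (N (U1 (D0 (D0 (L1 (Y 66157)))))[][][])][N (N E[][L0 (L1 (Y 73630))][L0 (D0 (L1 (Y 61415))),
L0 (L1 (L0 (X 54799)))])[][][],N (U1 (N E[N E[U1 (X 64667)][L1 (X 63534)][]][N E[N E[][N E[][E,X 58444][E,
Y 57948],Y 58700][]][E,Y 56494][]][]))[][][]][N (N E[][N E[L1 (X 70016)][L1 (X 67541)][E,L1 (X 58970)]][E,
L0 (L1 (Y 54963))])[][][],N (N E[][N E[N E[][E,X 67943][E,L1 (X 67523)]][N E[][E,X 66047][E,
X 63328]][]][L0 (N E[L1 (Y 57407)][E,X 55309][]),L0 (L1 (X 54057))])[][][]]"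

definition "t2_8 = N E[E,N E[][][N (X 83200)[][][X 80894],N (X 83097)[][][X 81191]]][E,
N (X 83045)[][N (X 82630)[][][X 80323,X 80553],N (Y 82589)[][E,X 82378][X 80471,N (X 80566)[][E,
X 80037][]]][N (X 79056)[][X 77824][],N (X 79441)[][E,X 78515][X 69833,X 72415]]][E,N (X 79014)[N E[][E,
N (X 78905)[][][E,X 77828]][E,X 78245]][N (X 76601)[][N (X 75369)[][X 74756][X 71681],X 75941][X 70009],
N (X 77102)[][E,N (X 76147)[][][E,L1 (X 71722)]][E,X 70695]][N (X 67116)[L1 (X 66588)][L0 (X 62791)][X 54465],
N E[][E,N (X 66317)[][E,L1 (X 64742)][]][E,X 54367]]]"


definition "t2_9 = N E[t2_8][N E[N E[][Y 79371][D0 (L1 (X 77205))]][N (X 77403)[][N (X 76217)[][X 75784][X 71681]][N (X 69767)[][X 69182][]],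
N (X 76454)[][E,N (X 74599)[][X 73514,N (X 73643)[][E,X 73104][E,L1 (X 69903)]][X 67189]][E,
N (X 66883)[][X 62573,N (X 64525)[][E,L1 (X 62812)][]][]]][N (X 67782)[L1 (N (X 67350)[][E,
X 66992][])][N (X 65764)[][Y 65103][]][X 53423],N (X 65619)[N E[][E,X 65452][E,
X 62393]][N (X 60768)[][N (X 58458)[][X 57226][],X 58558][],N (X 61969)[][E,N (X 59901)[][E,N (X 58818)[][E,
X 58600][]][]][E,X 50254]][E,X 48336]]][N E[N E[E,U0 (X 65695)][E,N (X 65222)[][X 64829,N (X 64372)[][E,
X 63947][]][X 61030]][E,
N (X 59972)[U1 (X 58070)][X 57731][]]][N (Y 62671)[][N (X 61238)[][N (X 60117)[][X 59681][]][],
X 58086][N (Y 50513)[L1 (X 49974)][X 48712][],L1 (D1 (U1 (X 37548)))]][N (X 48076)[U1 (X 40950)][X 45247][],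
Y 43660],N E[N E[E,U1 (X 65491)][E,N (X 65669)[][E,N (X 65164)[][][E,X 62833]][]][E,
X 61153]][L1 (X 56825)][Y 43620,Y 47874]]"

definition "t2_10 = N (N E[N E[][E,N E[][N E[][E,X 79417][E,Y 78927],N (X 79491)[][][X 78454,
X 78714]][N (X 76774)[][][E,X 70923],N (X 77370)[][E,X 76719][]]][E,N E[U1 (Y 76133)][N E[][E,Y 74234][E,
X 68872],N (X 75370)[][E,N (X 74650)[][][E,Y 72499]][]][Y 66249,N (X 67859)[][E,N (X 66028)[][E,
X 64945][]][]]]][N E[][N E[][Y 73822][D0 (L1 (X 68511))],N E[E,U0 (X 73510)][E,N (X 72920)[][X 72279,
N (X 72201)[][E,X 71815][]][E,X 67805]][E,N (X 66253)[][][E,X 53213]]][E,N E[L1 (Y 64582)][E,N (Y 61458)[E,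
U0 (X 59393)][][]][]]][N E[N E[][E,N (Y 63876)[][E,N (Y 63617)[][E,X 63317][]][]][E,
X 59591]][D0 (U0 (X 61817))][D0 (L1 (X 46973))]])[][N (N E[U1 (N E[][L1 (Y 73895),
L1 (X 73817)][])][L1 (L1 (L1 (X 71447)))][])[][][],N (L0 (U0 (L0 (L1 (Y 62637)))))[][][]][]"

definition "t2_11 = N t2_9[N E[][E,N (N E[L1 (L1 (L1 (Y 82278)))][L0 (L0 (L1 (X 75175)))][])[][][]][E,
N (N E[U1 (L0 (L0 (X 75176)))][L1 (L1 (N E[][Y 73360,Y 73161][]))][])[][][]]][t2_10,N (N E[N E[][E,
N E[][U1 (Y 79005),U1 (X 79199)][U1 (Y 68981)]][E,N E[U1 (Y 76679)][N E[][X 74793][E,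
Y 68128]][]]][N E[U1 (N (X 75452)[][X 74783][L0 (X 70846)])][N E[][L0 (Y 74765),X 74081][X 69329,
N (X 66624)[][N (X 63392)[][Y 64521][]][]],L1 (N (Y 73329)[][][E,X 68561])][L0 (X 65296)]][N E[N E[E,
U1 (X 64423)][E,N (Y 64508)[][X 64203,X 63768][E,X 59941]][E,
N (Y 59700)[][X 57648][]]][N E[L1 (Y 61837)][N (Y 60468)[][X 59647][],N (X 57810)[][E,
X 55359][]][]][D0 (L1 (N (Y 47165)[][][E,X 39741]))]])[][E,
N (N E[U1 (L0 (L0 (Y 73817)))][L0 (L0 (L0 (Y 73985)))][])[][][]][]][N (N E[N E[][E,N E[][][X 67176,
Y 67745]][E,N E[][N E[][E,X 66249][X 64297,Y 64492],L1 (X 66608)][X 62777,N (X 62644)[][E,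
X 61881][]]]][N E[][E,N E[][E,N (X 64823)[][][X 63641]][E,N (Y 61430)[][X 60574][]]][E,
N E[U1 (Y 58664)][N (Y 56934)[][E,X 56059][],N (X 57446)[][E,X 56482][]][]]][N E[N E[][E,Y 57866][E,
Y 55360]][L1 (N (X 53683)[][E,X 52501][])][]])[][N (L0 (U1 (L1 (L1 (X 55626)))))[][][]][],N (N E[N E[][E,
N E[][][Y 69399,U0 (Y 67084)]][E,N E[L1 (X 68640)][Y 67859,X 67870][Y 62644,
X 63755]]][N E[U1 (X 67713)][N E[][Y 67087][L0 (X 63882),N (X 62683)[][X 60927][X 51900]],N E[][E,X 66301][E,
L1 (X 62530)]][N E[][Y 60753][N (X 52314)[][X 51053][]],N E[][Y 57490,Y 58201][Y 45279]]][N E[N E[][E,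
N (X 59415)[][][E,X 57639]][E,N (X 56989)[][X 56210,X 55590][]]][N E[U1 (X 57049)][X 56674,N (X 55261)[][E,
X 53861][]][]][N E[L1 (X 45672)][L0 (X 43110)][]],L0 (L1 (X 53821))])[][E,
N (L0 (U0 (N E[L1 (X 60806)][L0 (X 59802)][])))[][][]][E,
N (L0 (U0 (N E[][U1 (X 50773)][L0 (X 48371)])))[][][]]]"

definition "t2_12 = N E[N E[][E,N (N E[N E[N E[][E,N (X 90186)[][E,X 90086][E,X 89361]][E,N E[][X 88236][E,
X 84732]]][N E[][E,N (X 87969)[][E,X 87381][]][E,N (X 83392)[][E,
X 81321][]]][]][D0 (N E[U1 (X 83951)][U1 (X 80591)][U1 (X 71261)])][D0 (D0 (L1 (N (X 68121)[][E,
Y 67985][])))])[][E,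
N (N E[D0 (L1 (L1 (X 90017)))][D0 (N E[L1 (X 84566)][L1 (X 83447)][])][])[][][]][]][N (N E[][D0 (L1 (X 83787))][E,
D0 (L0 (D0 (L1 (X 66467))))])[][][],N (N E[N E[N E[][E,Y 89001][E,N (X 88216)[][E,X 87802][]]][N E[][E,
Y 87134][E,N (X 83028)[][E,X 81306][]]][]][N E[L1 (N (Y 83361)[][E,N (X 82988)[][E,X 82751][]][])][E,
D0 (U1 (X 78234))][]][D0 (L0 (L1 (X 66160)))])[][E,N (D0 (D0 (L1 (L1 (X 88412)))))[][][]][E,
N (D0 (D0 (U1 (L1 (Y 84972)))))[][][]]],N E[][E,N (N E[N E[E,N E[][E,X 90216][E,L0 (X 88321)]][E,
L1 (N (X 88449)[][][E,X 84541])][E,L1 (N (X 80839)[E,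
U1 (X 79068)][][])]][L1 (D1 (L1 (N (X 79917)[][X 79917][])))][D0 (D1 (L1 (X 68120)))])[][][E,
N (D0 (D1 (L1 (L1 (Y 89252)))))[][][]]][N (D0 (N E[E,U0 (X 88369)][E,L0 (N (X 87714)[][][X 83938])][]))[][][],
N (N E[N E[E,N E[][E,Y 88971][E,N (X 88023)[][X 87638][]]][E,N E[][E,N (X 87488)[][X 87103,
X 86950][X 83664]][E,L0 (X 80743)]][E,L1 (X 80481)]][L1 (N E[E,U1 (X 77117)][E,
D1 (U1 (X 75926))][])][])[][N (D0 (L1 (D1 (U1 (X 87440)))))[][][]][]]][t2_2,t2_6][t2_7,t2_11]"

definition "t2_13 = N (X 79752)[N E[][N (X 79221)[][][X 77243],N (X 79349)[][L1 (X 79048),N (X 79065)[][E,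
X 78902][]][E,L1 (X 76984)]][N (X 76498)[][][X 70789],N (X 76397)[][E,
L1 (X 74539)][]]][N (X 77063)[L1 (X 76852)][N (X 75598)[][E,N (X 74086)[][][E,L0 (X 68318)]][E,X 68101],
N (X 74687)[][E,X 73339][]][N (X 68463)[][][L0 (X 56443)],N (X 66318)[][E,
N (X 63150)[][L0 (L1 (Y 60030))][]][]],N (X 76584)[][N (X 74580)[][][E,X 66198],N (X 74674)[][E,
N (X 73618)[][E,Y 73075][]][]][X 66383,
X 66493]][N (X 67055)[][N (X 64774)[][X 63602][]][N (X 52344)[L0 (L1 (X 52673))][X 50523][X 36695],X 47839],
N (X 65522)[][N (X 60257)[][E,X 58014][N (X 47970)[][X 45500][]],N (X 61744)[][E,
X 59753][]][L0 (L0 (X 40148)),X 48530]]"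

definition "t2_14 = N (X 66724)[N E[E,U0 (X 65494)][X 65062,N (X 66215)[][X 65074][E,
N (X 61559)[][L1 (X 57487)][X 47721]]][E,N (X 61048)[][X 56865,X 58954][X 44520,N (X 48274)[][E,
X 45983][X 26729]]]][N (X 59871)[U1 (U1 (X 47386))][N (X 56159)[][X 54102][E,X 44312],N (X 56819)[][E,
N (X 54973)[][E,N (X 53967)[][E,N (X 53431)[][E,X 53229][]][]][]][E,
N (X 46312)[][D0 (L1 (X 41534))][]]][X 44604,N (X 44539)[][X 38437,N (X 41034)[][L0 (L1 (X 32955))][]][]],
N (X 63114)[L0 (X 61993),N E[][E,N (X 62820)[][X 62273][]][E,X 60573]][X 58163,N (Y 61161)[][X 57719,
N (X 60110)[][E,L1 (X 59456)][]][X 48089,L1 (X 51627)]][E,N (X 50287)[][N (X 43731)[L1 (X 43298)][][],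
X 48650][]]][N (X 43600)[][][X 23091],N (X 47960)[N E[L1 (X 47871)][E,X 47240][X 38528,
X 41064]][N (X 40040)[U0 (X 34902)][X 35551,X 36748][],N (X 45121)[][E,X 43600][]][]]"

definition "t2_15 = N E[N E[N E[][X 84520,X 84641][E,U1 (X 81129)]][N (X 83513)[][N (X 82821)[][E,X 82490][],
L1 (X 82640)][X 80596,N (X 79422)[][E,X 78049][]],N (X 84146)[][X 83391,N (X 83589)[][E,X 83249][]][E,
N (X 79912)[][][E,X 71727]]][N (X 79076)[][X 77352][N (X 70703)[][X 68730][]],N (X 79592)[][X 76578,
X 77558][E,X 68315]]][t2_13,N (X 80742)[E,U1 (L0 (X 76244))][N (X 77047)[][E,X 75300][E,X 66195],
N (X 78450)[][N (X 75885)[][][X 67509,U1 (X 56026)],N (X 77186)[][N (X 75540)[][X 74592][],X 76613][E,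
X 71669]][L0 (N (X 63518)[][E,X 60964][]),N (X 69859)[][L1 (X 63941)][]]][E,
N (X 68250)[N E[][X 66910][D0 (L1 (X 61315)),
N (X 63554)[U1 (X 62977)][L1 (X 59689)][]]][N (X 63358)[][N (X 59085)[][L0 (X 56312)][]][E,
N E[L1 (X 48828)][E,X 46089][]],N (X 66569)[E,U1 (X 64818)][][]][N (X 48106)[][N (X 43007)[][E,X 38359][]][],
N (X 53199)[][E,N (X 51455)[][E,
X 50541][]][]]]][N (X 65767)[L0 (X 65022)][N (X 62046)[L1 (X 61524)][N (X 60066)[][L0 (X 59097)][],
X 57393][X 49667]][N (X 47441)[][N (X 44736)[][X 43139][]][],N (X 43444)[][N (X 36985)[][X 34615][]][]],
t2_14]"

definition "t2_16 = N E[N E[N E[][E,X 84043][U1 (X 80972),N E[][E,X 83125][X 80173]]][N E[][E,X 82468][E,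
N E[][X 77243][X 69472,X 70787]],N E[][E,N (X 83112)[][E,N (X 82847)[][E,X 82695][E,X 81812]][E,Y 80776]][E,
N E[][L1 (Y 77254),N (X 78777)[][E,X 78278][]][]]][U1 (L0 (N (X 63412)[][X 61747][])),L1 (N (X 77343)[][E,
N (X 76291)[][E,X 75792][]][])]][N E[N E[][N (X 78867)[][E,X 78569][E,X 76867]][U1 (X 69028),
L1 (X 75117)]][N E[][N (X 75327)[][X 74731][X 70127],L0 (L1 (X 72796))][L0 (X 67297),L0 (X 62411)],
N E[N E[][E,X 76235][E,X 74930]][L1 (X 73443),N (X 74501)[][E,X 73504][]][]][E,
N E[L0 (L1 (X 64418))][L0 (X 57613)][]],D0 (N E[E,L1 (Y 80354)][E,Y 80140][])][N E[N E[N E[][E,X 65514][E,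
L1 (Y 64739)]][L1 (X 64008)][]][N E[L0 (N E[][E,X 61809][E,
X 59291])][L0 (X 59054)][]][D0 (L0 (L1 (X 46148)))]]"

definition "t2_17 = N E[L1 (N (D0 (U0 (L0 (L1 (X 75914)))))[][][]),
U1 (N (D0 (L1 (L1 (L1 (X 82791)))))[][][])][N (N E[][E,N E[D0 (L1 (X 80357))][D0 (L1 (Y 76626))][]][E,
N E[D0 (L1 (Y 66529))][D0 (L1 (X 59409)),L0 (D0 (L1 (X 57932)))][]])[][E,N (N E[N E[N E[][E,L1 (Y 83447)][E,
L1 (X 83263)]][L1 (L1 (X 82246))][]][E,D0 (L0 (L1 (Y 79517)))][])[][][]][E,
N (D0 (N E[U1 (L1 (Y 80591))][L1 (L1 (X 80739))][]))[][][]],N t2_16[][N (D0 (L1 (L1 (L1 (Y 82669)))))[][][],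
N (N E[L1 (L1 (L1 (X 82495)))][N E[L0 (L1 (X 78569))][E,D0 (L1 (Y 76158))][]][])[][][]][E,N (D0 (N E[][E,
N E[][E,L1 (X 79815)][E,L1 (Y 78317)]][E,
U1 (L1 (X 66044))]))[][][]]][N (N E[U1 (L0 (N E[L1 (X 75229)][L1 (X 73651)][]))][N E[L1 (Y 76302)][L1 (X 73727),
N E[][X 73232,Y 72876][]][],N E[N E[N E[][E,Y 77948][E,X 77833]][L1 (Y 77512)][]][N E[L1 (X 74808)][N E[][E,
Y 72267][E,X 66573]][]][]][E,N E[L1 (X 65008)][N E[L1 (Y 58813)][Y 55839][],D0 (L0 (L1 (Y 61435)))][]])[][E,
N (L1 (L0 (D0 (L1 (X 73978)))))[][][]][E,N (D0 (L0 (L1 (L1 (Y 71980)))))[][][]],N (N E[N E[][E,N E[][E,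
X 79636][E,N (Y 77545)[][X 76639][]]][D0 (D0 (L1 (Y 76294))),N E[][E,N (X 75452)[][L1 (X 74935),
N (X 74714)[][E,X 74439][]][]][E,N (X 67713)[][X 63371][]]]][N E[][N E[][Y 73452][Y 67672],
N E[U1 (X 73512)][L1 (Y 72355),N (X 72832)[][E,N (X 72094)[][E,X 71819][]][E,X 67679]][E,L1 (X 64190)]][E,
N E[][N (X 60065)[][X 57602][],X 61357][]],N E[N E[][E,N (Y 77370)[][E,X 77161][E,X 76276]][E,
L1 (X 74981)]][L1 (N (Y 73654)[][E,X 72698][])][]][L0 (L0 (L1 (Y 56954))),
D0 (L1 (Y 64998))])[][N (D0 (N E[][E,U1 (L1 (Y 76033))][E,
U1 (L1 (X 66044))]))[][][]][N (L0 (U1 (D0 (L1 (Y 61864)))))[][][]]]"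

definition "t2_18 = N E[][N (N E[][E,N E[E,L0 (X 80140)][E,N E[U0 (X 75537),N E[][][X 76423,
X 76851]][L0 (X 74092),N (Y 77050)[][E,N (X 76410)[][E,Y 76181][]][X 68953]][N E[L1 (X 66505)][][E,X 50316],
L1 (Y 68712)]][E,N E[L1 (X 67726)][E,N (X 66046)[][E,X 64877][]][]]][E,N E[L1 (N (Y 66128)[][E,
N (X 65666)[][E,X 65329][X 60609]][X 59075])][E,D1 (U0 (X 58746))][E,L1 (D1 (L0 (X 44657)))]])[][][],
N (L1 (N E[E,L1 (L1 (X 79796))][E,L1 (Y 76649)][]))[][][]][N (N E[][E,N E[E,L0 (L1 (X 77722))][E,
N E[][N (X 74289)[][N (X 73439)[][X 72643][],X 73580][],L1 (Y 74792)][]][E,N E[L1 (X 66982)][E,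
L1 (X 64539)][]]][E,N E[N E[][E,Y 65136][E,Y 60717]][L0 (N (Y 55993)[][L0 (X 53667)][]),
L1 (Y 60739)][]])[][N (L1 (N E[][E,L1 (L1 (Y 74148))][E,D0 (L1 (X 66815))]))[][][],
N (L1 (L1 (L0 (L0 (Y 72945)))))[][][]][],N (U1 (D0 (L1 (X 64328))))[][][]]"

definition "t2_19 = N E[N E[][E,X 81636][E,N (X 81033)[][][E,N (X 79250)[][E,
U1 (X 77113)][]]]][N (X 80595)[][N (X 79968)[][][E,X 78755],N (X 80171)[][][E,X 78713]][Y 77375,
N (X 77503)[][E,U1 (L1 (X 71895))][E,N (X 70238)[][E,L1 (X 67983)][]]],N (X 81234)[][N (X 80818)[][][E,
N (X 78236)[][E,U1 (X 75249)][]],N (Y 80920)[][E,Y 80744][E,X 79088]][E,N (X 78084)[][E,X 77146][E,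
X 71008]]][N (Y 76356)[][X 75067][Y 68224],N (X 77403)[N E[][E,N (X 77334)[][][E,U1 (X 74869)]][E,
N (X 76275)[][][E,L1 (X 69868)]]][N (X 74810)[][X 73233,N (X 73887)[][][E,L1 (X 68059)]][E,X 67345],
N (X 75809)[][E,X 74987][E,X 69509]][E,X 67470]]"

definition "t2_20 = N E[N E[][E,N (X 78272)[][E,X 78180][E,U1 (X 72425)]][E,N (X 75990)[][E,X 75151][E,
N (X 68645)[][E,U1 (X 65576)][]]]][N (X 75126)[][E,N (X 73599)[][E,N (X 72760)[][][E,
N (X 69238)[][X 68276][]]][]][E,N (X 65398)[][E,N (X 62878)[][E,N (X 61612)[][E,X 61066][]][E,
L1 (X 52566)]][E,N (X 50838)[][E,L1 (X 47504)][]]],N (X 76629)[E,U1 (X 75535)][N (X 74386)[][L0 (X 72061)][E,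
L1 (U1 (X 62791))],N (X 75636)[][E,N (Y 75133)[][E,X 74964][E,X 72911]][]][E,N (X 69053)[][E,
L1 (X 67702)][]]][N E[][X 60797][E,X 45467],N (Y 67293)[N E[][E,U1 (U1 (X 62642))][E,
U1 (L1 (X 52572))]][N (X 61856)[][E,U1 (L1 (X 51120))][],N (X 65337)[L1 (X 65173)][E,N (X 64552)[][E,
X 63863][]][]][E,X 52953]]"

definition "t2_21 = N E[N E[U0 (X 64897)][N E[][][X 59531,N (X 59646)[][E,X 58558][]],N (X 65141)[][E,
N (X 64798)[][E,N (X 64610)[][E,X 64434][]][E,X 62306]][]][N (X 58237)[][][X 47683,X 46648],
X 60433]][N (X 59086)[][N (X 55536)[][E,X 53196][],N (X 56290)[][E,L1 (X 53739)][]][X 44387,X 44382],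
N (X 62339)[N E[][E,N (X 62072)[][E,X 61957][]][E,X 59233]][N (X 57695)[][E,X 55872][],N (X 60607)[][E,
N (X 59678)[][E,X 59214][]][]][E,X 50116]][N (X 43348)[D0 (U1 (L1 (X 41546)))][X 38572][],
N (X 47671)[D0 (L1 (X 47589))][N (X 39938)[L1 (X 39295)][][],
N (X 44957)[L0 (L1 (X 43196))][L0 (L1 (X 33965))][]][D0 (D0 (L1 (X 22917))),X 29387]]"

definition "t2_22 = N E[t2_19][N E[N E[][N (X 76583)[][][E,X 75077],N (X 76751)[][E,X 76615][]][E,
X 74319]][N (X 74555)[N E[][E,X 74406][E,U1 (X 70745)]][N (X 73213)[][E,X 72169][],N (X 72629)[][E,
X 71697][]][N (X 66901)[][][X 57742],N (Y 65195)[][X 61840,L1 (L1 (X 60395))][E,X 51762]],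
N (X 74477)[][N (X 72699)[][L1 (X 70956)][],N (X 72971)[][E,X 72238][]][E,
X 65558]][N (Y 65414)[][X 63424][L0 (X 50022)],N (X 64338)[N E[][X 63564,
X 64168][]][N (X 59412)[L1 (X 59271)][X 56946][],L0 (L0 (L1 (Y 55481)))][X 45271,X 47765]],
t2_20][N E[L0 (X 63643)][N (Y 60661)[L1 (X 60238)][N (X 58812)[][][X 51716],
X 56523][L0 (X 48104)]][N (Y 46706)[L0 (X 47161)][Y 43961][Y 29214]],t2_21]"

definition "t2_23 = N E[N E[U1 (L1 (X 79694))][N E[][E,X 78707][E,L1 (Y 75806)],N E[][E,N (Y 79451)[][E,
Y 79372][]][E,L1 (L1 (X 76062))]][E,N E[][N (X 73822)[][E,X 73217][],N (X 74868)[][E,N (X 74251)[][E,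
X 73921][]][]][]]][N E[L1 (Y 75327)][L1 (L1 (N (X 70989)[][E,X 70647][])),N E[L1 (X 73288)][X 71783,
L1 (N (X 71461)[][E,X 71131][])][]][E,N E[][X 59127,N (X 60635)[][E,X 58961][]][]],N E[N E[][E,
N (X 77050)[][E,X 77006][E,L1 (X 75756)]][X 75809]][N E[][N E[][E,X 71172][E,N (X 66033)[][E,X 64139][]],
N (X 72825)[][E,X 72104][E,X 67600]][X 66121],N E[L1 (X 75579)][N E[][E,X 73183][E,X 67571],N (X 74841)[][E,
N (X 74453)[][E,X 74313][]][E,X 70926]][E,N E[][E,N (X 67694)[][E,X 67349][]][E,
X 58067]]][N E[][L1 (X 57866)][X 48358],N E[N E[][E,X 66460][E,X 63072]][N E[][L1 (X 57095),X 59552][E,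
X 48953],N (X 64993)[][E,X 64101][E,X 56045]][]]][E,N E[L1 (N (X 64539)[][X 63730,N (X 64310)[][E,
X 64152][]][])][N E[L1 (Y 58271)][E,N (X 56056)[][E,X 54504][]][],N E[L0 (L1 (X 61046))][L0 (L1 (Y 53711)),
N (X 60325)[][E,N (X 59467)[][E,X 59113][]][]][]][E,N E[N E[][X 45458,X 46934][]][E,N (X 44903)[][E,
X 43495][]][]]]"

definition "t2_24 = N (N E[N E[][N E[][E,Y 77428][E,N E[][][X 68904,L0 (X 67555)]],
U1 (L1 (Y 75754))][U1 (L0 (X 62623)),N E[][E,Y 74081][E,L1 (X 66186)]]][N E[N E[][E,N E[][E,X 74472][E,
X 74051]][U1 (X 69550),N E[][E,X 72279][E,X 67788]]][U1 (U0 (X 50072))][E,N E[L0 (U1 (X 62528))][E,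
Y 60607][]],N E[N E[][E,Y 75676][E,L1 (X 73672)]][N E[][E,L1 (X 71574)][E,N (Y 64971)[][X 61149][]],N E[][E,
N (Y 73888)[][E,Y 73390][]][E,L1 (X 67621)]][E,L1 (X 64774)]][N E[N E[U1 (X 62619)][N E[][E,X 62172][E,
X 59457]][U1 (X 48732)]][L0 (Y 58241)][D0 (L0 (L1 (Y 46462))),D0 (L0 (L1 (X 42517)))],
N E[N E[U1 (X 64048)][N E[][E,Y 62885][E,X 59477]][]][N E[][L0 (X 53478),
Y 55967][]][]])[][N (U1 (N E[L1 (L1 (Y 63798))][E,D0 (L1 (Y 61277))][]))[][][],
N (L0 (L1 (L0 (L1 (Y 70835)))))[][][]][N (N E[][E,L1 (U1 (L0 (X 65112)))][E,L1 (N E[L1 (Y 58806)][E,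
L1 (Y 58037)][])])[][][]]"

definition "t2_25 = N E[N E[][L1 (Y 71245)][E,L0 (X 68208)]][N E[][N E[][E,X 66109][E,L1 (Y 60508)],N E[][E,
X 66683][E,L0 (X 60170)]][E,N E[][N (X 56714)[][E,X 55922][],N (X 58085)[][E,X 56948][]][]],N E[U1 (N E[][E,
X 69007][E,X 67516])][N E[][L1 (X 66857),L1 (X 67314)][X 63737,L1 (X 60942)],N E[][L1 (X 68346)][E,
L1 (X 65557)]][N E[][L1 (Y 55744)][X 48358],N E[N E[][E,X 62997][E,X 61641]][L1 (X 58054),
L1 (X 61851)][]]][L0 (L1 (Y 54996)),N E[N E[][U1 (L1 (X 58017)),N (X 60511)[][][E,L1 (X 58604)]][X 56709,
N E[L1 (X 58054)][E,L1 (X 57128)][]]][N E[][N (Y 53147)[][E,Y 52180][],N (X 54007)[][E,X 53081][]][X 43955,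
Y 44015],N E[][N E[L1 (X 55754)][L1 (Y 52734)][],N (X 57733)[][E,L1 (X 57092)][]][]][E,N E[N E[][Y 45215,
X 45900][]][X 39529,X 44255][]]]"

definition "t2_26 = N t2_22[N E[][E,N (D0 (N E[][E,N E[][L1 (Y 80377),
L1 (Y 80515)][]][L0 (L1 (X 74022))]))[][][]][E,N (D0 (N E[][E,N E[][L1 (Y 78528)][E,L1 (Y 76782)]][E,
L1 (L1 (Y 74822))]))[][][]],
L0 (N (L1 (D0 (L1 (L1 (Y 78084)))))[][][])][N t2_23[][N (N E[][L1 (L1 (L1 (Y 71181))),
L1 (L1 (L1 (X 74110)))][E,N E[L1 (L1 (X 64064))][E,D0 (L1 (X 61556))][]])[][][],
N (N E[L0 (U1 (L1 (Y 75535)))][E,L0 (L0 (L1 (Y 70833)))][])[][][]][N (U1 (L1 (D0 (L1 (X 60088)))))[][][],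
N (L1 (L0 (D0 (L1 (Y 68260)))))[][][]],t2_24][N t2_25[][N (L1 (L0 (D0 (L1 (Y 67300)))))[][][],
N (L1 (N E[][L0 (L1 (X 64477))][E,D0 (L1 (X 61225))]))[][][]][N (N E[][U1 (L1 (L1 (X 52938)))][E,
U1 (L1 (L1 (Y 42336)))])[][][]],N (N E[U1 (N E[][E,Y 66624][E,N (Y 62683)[][X 60337][]])][N E[U1 (N E[][E,
X 65815][E,X 64275])][N E[][E,N (X 64692)[][][E,L1 (X 63152)]][X 61615,L1 (X 61352)],N E[L1 (X 65674)][E,
X 64810][E,L1 (X 61634)]][L0 (X 58909),N E[][X 56362,N (X 57511)[][E,L1 (Y 56310)][]][E,Y 47053]],N E[N E[][E,
X 67032][E,N (X 66627)[][][E,X 64853]]][N E[][E,X 65379][E,N (X 61198)[][E,X 59956][]]][E,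
L1 (X 61763)]][N E[L0 (L1 (X 57969))][N E[][X 55121][X 48928]][L0 (Y 43074)],N E[N E[][N E[][E,X 58688][E,
Y 57931],X 58853][]][N E[][N E[][X 51995,X 52354][],N (X 53410)[][E,X 52401][]][]][]])[][N (L0 (L1 (N E[][E,
L1 (Y 61712)][E,L1 (Y 59747)])))[][][]][]]"

definition "t2_27 = N E[N E[][Y 79623,N (Y 79949)[][E,Y 79614][X 76276,
N (X 76865)[][L0 (X 74862)][]]][N E[L1 (X 75885)][][X 68370],N (Y 76454)[][][X 65360,
X 67070]]][N E[N E[][Y 76242][X 74170,N (X 74054)[][E,X 73151][]]][N (X 74477)[][X 73331,N E[][E,
N (X 71673)[][E,X 71235][]][E,N (X 66565)[][X 64320][]]][X 67232,U0 (X 50072)],N E[][E,L1 (Y 71756)][E,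
X 65354]][N (Y 65656)[N E[][E,X 65239][E,X 62282]][N (X 63655)[][X 62664][]][],
N (Y 64123)[][N (X 59482)[][][D0 (L1 (X 47218))]][X 45338,X 47804]],N E[E,L1 (N (X 76834)[][][E,X 76026])][E,
N (X 75126)[][E,N (X 74083)[][E,X 73625][E,X 70090]][E,N (X 68086)[][X 64791][]]][E,N (Y 66343)[][E,
N (X 64456)[][E,Y 63599][]][]]][N E[N E[][E,N E[][U1 (X 60128),N (X 62806)[][E,X 62480][]][]][E,
N (X 58690)[U1 (X 57536)][N (X 56609)[][X 55558][]][X 47384]]][N (Y 60988)[U0 (X 59088)][X 59224,
N (X 56827)[][E,N (X 54361)[][X 53266,X 53346][]][E,X 45708]][N (X 49382)[][L0 (X 47715)][],
N (X 45112)[L1 (X 44862)][X 40411][]]][N (Y 47068)[N E[][E,X 46218][E,X 40673]][N (X 44399)[][Y 42982][]][]],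
N E[N E[E,U1 (X 64422)][E,N (X 64462)[][E,N (X 64100)[][][E,X 62266]][X 58747]][E,N (Y 60145)[][X 56459,
L1 (X 57449)][]]][N (X 58802)[N E[][E,X 58473][E,X 55654]][N (X 55554)[][L0 (X 52713)][],
D1 (U1 (L0 (X 53762)))][E,X 44377],N (X 61615)[][E,N (X 60079)[][E,X 59036][E,X 52233]][E,X 50006]][N E[N E[E,
L1 (X 43197)][E,X 42126][]][][D0 (D1 (L1 (X 22842)))],Y 47440]]"

definition "t2_28 = N E[N E[][E,N E[][N (Y 77251)[][][X 75856]][N E[][X 73890][X 68683],
U0 (N (X 68062)[][X 65811][])]][E,N E[N E[][E,X 74549][E,
N (X 73907)[][][X 69049]]][N (X 72920)[][N (X 71972)[][X 71597][]][X 67094,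
N (X 66650)[][X 64016][]]][N (Y 64823)[][N (X 62398)[][X 61284][X 62785]][X 50891],
N E[U1 (X 64990)][N (X 62513)[][X 60262][]][]]]][N E[N E[][E,Y 74501][N (X 72876)[][][X 69299],
U0 (N (X 67074)[][X 65362][])]][N E[U1 (X 72198)][N E[][X 71735][N (X 68583)[][][X 63276],
X 67260]][N E[][X 65729][X 57215],L0 (U0 (X 58244))],
L1 (X 71216)][N E[L1 (X 64626)][][L0 (N (Y 50291)[][Y 49902][])],N E[N E[][E,X 63310][E,
X 61170]][N (X 59154)[][N (X 57038)[][X 55947][]][]][]],N E[E,L1 (Y 74767)][E,N E[][E,Y 72203][E,
L1 (Y 66451)]][]][N E[N E[E,U1 (X 62766)][E,N (X 62797)[][E,X 62204][N E[][][X 57603,X 47676],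
N (X 58827)[][X 57709][]]][E,N E[][U1 (X 46995)][L0 (X 44354),X 47255]]][N E[N E[][E,X 60098][E,
X 57506]][L0 (N (X 57981)[][X 57775][])][D0 (U1 (X 45727))]][L0 (D0 (L1 (X 44215)))],N E[N E[E,
U1 (Y 63345)][E,N (X 63333)[][E,Y 63050][]][]][N E[L1 (N (X 57943)[][][E,X 56213])][E,Y 55723][],
D1 (L1 (Y 60556))][]]"

definition "t2_29 = N t2_27[L1 (N (L0 (L0 (L0 (L1 (X 72306)))))[][][]),
L0 (N (U1 (L1 (D1 (U1 (X 59701)))))[][][])][N (N E[L0 (U0 (X 75913))][L0 (N E[][Y 71783][Y 66488]),N E[][E,
N E[][N (Y 72191)[][X 71539][E,X 67976],N (Y 72825)[][E,Y 72447][E,L1 (Y 69936)]][L0 (X 62905),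
L1 (X 67300)]][E,N E[N E[][E,X 65405][E,X 63425]][N (X 61115)[][E,N (X 59264)[][E,X 58223][]][],
N (Y 63975)[][E,L1 (Y 63536)][E,X 56045]][]]][D0 (L1 (L0 (Y 62472))),N E[L1 (N (Y 63668)[][][E,
X 60602])][L1 (N (Y 55857)[][E,X 54334][]),L1 (N (Y 59405)[][X 57088,L1 (Y 58504)][])][E,
D0 (L1 (X 46843))]])[][N (L1 (N E[][E,N E[][E,L1 (Y 71802)][U1 (X 50316)]][E,L0 (U1 (X 48953))]))[][][],
N (L0 (L0 (L1 (L1 (X 70835)))))[][][]][],N t2_28[][E,
N (N E[L1 (U0 (L0 (Y 73426)))][N E[][L0 (L0 (X 71181))][L0 (L0 (Y 62289))]][])[][][]][]][N (N E[][E,N E[][E,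
N E[][N (X 64971)[][][X 64032]][N (Y 61198)[][N (X 59828)[][X 58898][]][],L1 (Y 62233)]][E,
N E[U1 (X 59248)][N (X 57731)[][N (X 56085)[][X 55155][X 50839],X 56702][],N (Y 59435)[][][E,
X 56145]][Y 46924]]][E,N E[N E[][E,Y 58583][E,Y 56896]][N E[][Y 52461,N (X 53207)[][E,X 52394][]][],N E[][E,
N (X 55630)[][L0 (X 54400)][]][E,X 48945]][D0 (L1 (Y 41643)),N E[L1 (X 45343)][Y 39447,
L1 (X 42779)][]]])[][N (N E[][E,U1 (L1 (L1 (X 58289)))][E,L0 (L1 (L1 (X 52394)))])[][][]][],N (N E[N E[][E,
U0 (N (X 67500)[][][X 64855])][E,N E[][N (X 66253)[][][X 63627,X 63396],X 66315][N (X 61430)[][X 60008][],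
Y 62966]]][N E[][U0 (Y 62467)][N E[][X 59265][X 50902],N E[U1 (X 58103)][N (Y 56386)[][X 55284,X 55296][],
X 57364][X 44713]]][N E[][L0 (X 55883)][D0 (L1 (X 44887))],
N E[U1 (N (Y 56360)[][X 54904][])][L1 (X 52850)][D0 (L1 (X 40927))]])[][][]]"

definition "t2_30 = N E[N E[U1 (X 59197)][N (X 58532)[][E,X 58311][X 56136,X 56094],N (X 59217)[][][E,
N (X 57150)[][E,X 56547][]]][N (X 54336)[][][X 46316,X 45089],N E[][E,X 55068][E,
X 47070]]][N (X 54646)[U0 (X 52415)][N (X 51955)[][X 50634][X 44114,N (X 43307)[][E,X 41093][]],
N (X 52703)[][L1 (X 51067),L1 (X 51085)][]][N (X 42668)[][X 40307][],N (X 42866)[][X 37870,X 40088][]],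
N (X 57209)[N E[][E,X 57141][E,X 55672]][N E[][E,X 52997][E,X 45767],N (X 56295)[][E,L1 (X 55728)][E,
X 51035]][E,L1 (L1 (X 47368))]][N (X 41333)[L0 (L1 (X 39848))][N (X 37169)[][N (X 34904)[][E,X 32487][],
X 33687][]][N (X 22723)[L0 (L1 (Y 22275))][L0 (X 18069)][]],N (X 45293)[N E[][L1 (X 43376),
X 44934][]][N (X 38800)[N E[][U1 (X 38245),X 38350][]][X 34935,X 35943][],N (X 43219)[][L0 (L1 (X 34354)),
N (X 42628)[][E,X 41786][]][]][X 23160,N (X 28996)[][D0 (L1 (X 20291)),L1 (X 26581)][]]]"

definition "t2_31 = N E[N E[][N (X 69426)[][E,X 69337][E,N (X 68121)[][][E,L1 (X 64652)]],
N (X 69785)[][U1 (X 69327)][N (X 67674)[][][E,X 63441]]][U1 (X 65216),N (X 67782)[][N E[][E,X 66172][E,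
X 62440]][X 61071,L1 (L1 (Y 60506))]]][N E[N E[][E,X 66946][E,X 65945]][N E[][N (X 64632)[][][E,X 61946],
X 64554][E,X 59645],N (X 65656)[][X 64844,X 64984][N (X 59344)[][L1 (X 56360)][]]][N E[][X 58329][E,X 46020],
N (X 58642)[][N E[][X 53383,X 54094][E,X 46007],N (X 56393)[][L0 (L1 (X 53137))][]][X 43380,X 45742]],
N E[N E[][E,N (X 68184)[][][E,X 67882]][N (X 66763)[][][E,X 64194],N (X 67358)[][X 66902,X 67043][X 61740,
X 63940]]][N (X 66343)[][X 65248,X 65733][X 60375,N (X 60352)[][X 57524,N (X 59001)[][E,X 58450][E,
L1 (X 53558)]][X 46544,N (X 49578)[][E,X 48140][]]],N (X 67293)[][E,N (X 66825)[][E,Y 66682][E,X 65280]][E,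
N E[][E,X 62475][E,X 56342]]][N (X 58892)[][][X 45668,N (X 43941)[][N (X 38945)[][X 36156][]][]],N E[][E,
N (X 59977)[][E,X 59682][E,L1 (X 57786)]][E,L0 (X 45174)]]][N E[][N (Y 56092)[][E,X 52788][E,X 43230]][E,
N (Y 41040)[][N (X 35661)[][X 33434][]][]],t2_30]"

definition "t2_32 = N E[N E[][U1 (N E[][E,X 66185][E,X 64850]),U1 (Y 66686)][E,N E[][X 64823,Y 65296][E,
L1 (L1 (X 59517))]]][N E[U1 (N E[][E,X 64052][E,X 62717])][N E[][E,N (X 62790)[][E,X 62650][]][E,N E[][E,
X 60236][E,X 50994]],N E[][X 63271,N (X 63188)[][E,X 62979][E,X 62103]][E,L1 (Y 58790)]][E,
L1 (N (X 55399)[][X 53768,X 54623][])],N E[][N E[][N E[][E,Y 63794][E,X 62978],X 63975][],N E[][N E[][E,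
X 64581][E,X 63110],L1 (L1 (Y 64927))][U1 (X 49607),L1 (X 61808)]][E,N E[][N E[][E,X 55654][E,X 48073],
L1 (X 58715)][E,L1 (N (X 49186)[][E,X 48962][])]]][E,N E[N E[][L1 (X 57458),U1 (Y 57199)][E,
L1 (X 54736)]][L1 (Y 51933),N E[][X 53352,X 55146][L0 (L1 (X 37152))]][E,N E[N E[][X 43838,
X 44482][]][N (X 38596)[][L1 (Y 33001)][],Y 42883][E,D0 (L0 (X 26712))]]]"

definition "t2_33 = N t2_31[N E[][E,N (D0 (N E[][E,U1 (L1 (X 67982))][E,N E[][L1 (Y 66038)][E,
L1 (Y 60806)]]))[][][]][E,N (N E[U1 (N E[][L1 (X 63548),L1 (X 63982)][E,
L1 (Y 61012)])][U1 (L1 (L1 (Y 55445)))][])[][][]],N E[][N (N E[][E,L1 (L1 (L1 (Y 66390)))][E,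
N E[L1 (L1 (Y 58944))][E,U1 (L1 (X 46995))][]])[][][]][N (U1 (D0 (U1 (L1 (Y 55143)))))[][][],
N (L1 (D0 (U1 (L1 (Y 61478)))))[][][]]][N t2_32[][N (N E[U1 (L1 (L1 (X 64520)))][L1 (N E[][E,L1 (X 62289)][E,
L1 (Y 58277)]),L0 (L1 (L1 (Y 63200)))][E,N E[U1 (L1 (Y 54468))][N E[][L1 (X 49825),L1 (Y 50831)][],N E[][E,
L1 (X 54432)][E,L1 (Y 46850)]][E,L1 (L1 (Y 41997))]])[][][]][E,N (D0 (U1 (N E[][E,L1 (Y 51652)][E,
L1 (Y 51652)])))[][][]],N (N E[][E,N E[N E[][E,X 62414][E,N (X 62141)[][][Y 59377,X 61141]]][N E[][E,
X 61115][E,N (Y 57731)[][X 55719,Y 56791][]],N E[][E,Y 61556][E,L1 (Y 59577)]][U1 (Y 43500),N E[][E,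
Y 57034][E,L1 (X 48572)]]][E,N E[N E[][N E[][E,X 55493][E,X 54328]][E,
L1 (Y 53663)]][N E[][N (Y 50090)[][X 49271,X 49281][E,L0 (X 39871)],Y 50897][N (Y 42101)[][X 40027][]],
N E[][L1 (X 51658),Y 53145][]][L0 (Y 36795),N E[L1 (X 43612)][E,
L1 (Y 41701)][]]])[][N (U1 (N E[N E[][L1 (Y 54234)][E,L1 (Y 53351)]][E,N E[L1 (X 53324)][][E,
L1 (Y 46609)]][]))[][][],N (N E[][E,L0 (U1 (L0 (X 54851)))][E,
L0 (L0 (L0 (X 48586)))])[][][]][N (L1 (U1 (U1 (L0 (X 43836)))))[][][],
N (U1 (D0 (U1 (L1 (Y 46308)))))[][][]]][N (N E[][N E[][N E[][E,Y 51792][E,L1 (Y 50914)],L1 (X 51939)][E,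
N E[][X 47762,X 48021][X 40510,N (Y 41803)[][E,X 40113][]]],N E[][N E[][L1 (X 52457),L1 (X 52672)][E,N E[][E,
X 51107][E,Y 47019]],U0 (U1 (X 47512))][E,N E[L1 (X 50556)][N E[][E,X 49413][E,X 44962],L1 (X 50543)][E,
N E[][E,X 45517][E,X 35915]]]][E,N E[][N E[][E,X 45555][E,N (Y 39802)[][E,X 38003][]],N E[][D0 (L1 (X 46761)),
X 47264][X 40145,L1 (L1 (X 44241))]][E,N E[L1 (X 40037)][N (X 35784)[][X 33839,X 34179][],N (X 39089)[][E,
X 38722][]][Y 22511,N (Y 27880)[][E,X 26623][]]]])[][N (N E[][U1 (L1 (L1 (X 47088))),
U1 (D0 (L1 (Y 49433)))][E,N E[U1 (L1 (Y 47278))][D0 (L1 (Y 45163))][]])[][][]][],N (N E[][U1 (N E[][E,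
Y 46035][E,N (X 41809)[][Y 38325][]]),N E[][U1 (N (X 46924)[][][X 42560])][U1 (X 39213),
L1 (X 46393)]][L0 (D0 (L1 (Y 43645))),N E[][N E[][N (X 42064)[][][E,X 40226],X 42454][Y 37356,
X 38111]][L0 (X 32548),L0 (X 34113)]])[][][]]"

definition "t2_34 = N E[N E[][E,X 65443][X 64665,N (X 64685)[][E,
X 64464][]]][N (X 64338)[][N (X 63777)[][][X 61987,X 61487],N (X 63580)[][E,X 63360][E,
X 60951]][N (X 60113)[][X 59745][X 55061],N (X 59227)[][E,X 57889][]],N (X 64123)[][E,N (X 63446)[][][X 60377,
L1 (X 60899)]][E,N (X 59088)[][N (X 57034)[][X 55861][],X 57928][X 47329]]][N (X 58642)[N E[][E,
N (X 58497)[][][E,X 57500]][E,X 56964]][N (X 57340)[][X 56986,N (X 55894)[][E,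
X 55116][]][X 52444]][N (X 48839)[][N (X 47904)[][X 47937][]][],X 46619],N E[N E[][E,X 57986][E,
X 57464]][N (X 54762)[][X 53330][],N (X 55604)[][E,X 54493][]][X 43516,N (X 45585)[][X 40205][]]]"

definition "t2_35 = N E[N E[][N (Y 67210)[][][X 66180],N (X 67335)[][E,X 67254][N (X 65962)[][][X 62845],
N (X 66272)[][E,X 66104][X 62854]]][N (X 65269)[][X 64778][N (X 60968)[][][X 56774]],
N (X 65619)[][N (X 64717)[][][X 61600,U0 (X 54024)],N (X 64942)[][][E,X 62225]][X 59245,
N (X 60561)[][L0 (X 57262),X 59401][]]]][t2_34,N E[][E,N (X 65126)[][E,Y 64065][E,X 60552]][E,
N (X 58892)[][][E,X 49050]]][N E[N E[][E,N (X 57122)[][E,X 56908][X 55159,X 54839]][E,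
N (X 54083)[U1 (X 53531)][N (X 52850)[][E,X 52298][],L1 (N (X 51949)[][][E,
X 49326])][N (X 45592)[][X 46104][]]]][N (X 55136)[][N (X 54177)[][X 53600][N (X 48860)[][X 48893][]],
N (X 52456)[][E,X 51103][E,X 44449]][N (X 46504)[U1 (X 44860)][N (X 46022)[][E,X 44377][]][],
N (X 43308)[L1 (X 43132)][X 39337,X 39743][]]][N (X 44146)[N E[][E,X 43565][E,X 39836]][N (X 41883)[][X 41112,
X 38541][]][L0 (X 26845)]],N E[N E[E,U1 (X 57505)][E,N (X 57499)[][E,X 57328][X 54411,X 55576]][E,
N (X 54944)[][X 52853][]]][N (X 53475)[U1 (X 51991)][N (X 51462)[][L0 (X 49981)][],N (X 51681)[][E,
X 50540][]][E,N (X 42412)[][E,X 39430][]],U1 (X 47445)][N (X 40892)[L1 (N (X 40173)[][E,X 39797][E,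
X 36754])][N (X 37020)[][X 35457][]][X 22824],X 44076]]"

definition "t2_36 = N t2_35[N E[][E,N (L0 (L1 (L1 (L1 (Y 63091)))))[][][]][E,
N (L0 (L1 (U1 (L0 (Y 56980)))))[][][]],L0 (N (U1 (D0 (N E[][E,L1 (X 57035)][E,
L1 (X 53803)])))[][][])][N (N E[N E[][E,U1 (N (Y 61373)[][][E,Y 60594])][E,N E[][L1 (X 60231),
N (Y 60440)[][][E,X 59193]][X 56934,N (X 57490)[][E,X 56757][]]]][N E[][N E[][E,N E[][E,X 59129][E,
Y 58461]][E,L1 (N (Y 56362)[][E,X 55538][])],N E[][E,N (Y 59154)[][][X 57894,X 57937]][E,
U1 (X 50514)]][N E[N E[][E,Y 55005][E,Y 54403]][N (Y 54182)[][E,Y 53503][]][],N E[][E,N (Y 53175)[][E,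
X 52357][E,X 47682]][E,L1 (X 43705)]]][N E[N E[][E,N (Y 53670)[][][X 52920,Y 52430]][E,
X 51618]][N E[U0 (Y 51979)][E,N (X 50110)[][E,
X 49207][]][]][N E[L1 (Y 42162)][L0 (Y 40104)][]]])[][N (N E[][U1 (L1 (L1 (Y 51641)))][L0 (L1 (L1 (Y 48457)))])[][][]][],
N (N E[N E[][E,U0 (U0 (X 61173))][E,U0 (U0 (X 49424))]][N E[][N E[][U0 (X 59759),X 60607][U1 (X 53293),
L0 (X 56789)]][N E[][X 55400][Y 48021],N E[][L0 (X 52412)][L0 (X 40547)]],L1 (U1 (X 59133))][N E[N E[][E,
N (X 54826)[][][X 53671,X 53357]][E,N E[][X 51733][E,X 45694]]][N E[U1 (X 52222)][L0 (X 52068),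
X 51251][L0 (X 44963)]][],N E[N E[][E,U1 (X 53462)][E,
N (X 53091)[][X 51552][]]][N E[][Y 49842][D0 (L1 (Y 41752))]][N E[L1 (X 39357)][X 36546][]]])[][N (U1 (L0 (L1 (L1 (X 48977)))))[][][],
N (N E[U1 (U0 (L0 (Y 55626)))][][U0 (N E[L1 (X 42629)][L0 (Y 40373)][]),
D0 (U1 (L0 (X 51087)))])[][][]][]][N (N E[][U1 (U1 (Y 39839)),U1 (U0 (X 39213))][N E[U1 (Y 41689)][N E[][E,
N (X 40734)[][][E,X 39160]][E,X 37073]][],N E[L1 (X 43586)][U0 (X 37443),U1 (X 39251)][E,
L0 (L0 (Y 31915))]])[][][],N (N E[U1 (U0 (U0 (X 45138)))][N E[][U0 (Y 47328)][N E[][][X 41803,X 41809],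
U0 (X 39839)]][N E[U1 (X 43870)][N E[][U1 (X 41355),X 42909][N E[][X 39940][X 33143],N (X 39393)[][E,
X 37865][]]][N E[U1 (X 36455)][N (X 36369)[][E,X 35393][]][X 27774]],N E[][U1 (X 38254)][N E[N E[][E,
X 34876][E,X 32962]][N (X 32771)[][E,X 30857][]][X 22156]]])[][][]]"

definition "t2_37 = N (X 66724)[N E[][X 66464][X 64653,N (X 65470)[][][E,L1 (L1 (X 61458))]],N E[][E,
X 66574][E,N (X 65405)[][L0 (X 64523)][X 61471]]][N (X 64852)[][N (X 63631)[][E,
U1 (X 61431)][]][N (X 58337)[U1 (X 56978)][][X 48749]],
N (X 65585)[U0 (X 64488)][N (X 64356)[][N (X 63672)[][X 63416][]][X 59923],N (X 64940)[][L0 (X 64057),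
X 64659][E,X 62224]][N (X 58983)[][N (X 56932)[][E,X 55728][]][X 48211],N (X 60715)[][E,
X 60065][X 49622]]][N (X 57628)[L1 (U1 (X 55645))][N (X 54903)[][E,
L1 (X 51697)][]][N (X 44326)[L1 (X 43770)][L0 (X 40556)][]],N (X 59418)[N E[][E,N (X 59229)[][][E,X 58248]][E,
X 56960]][N (X 55754)[][N (X 53706)[][X 52605][],N E[][E,X 53618][E,L1 (X 49362)]][L0 (X 43291),X 46262],
N (X 58025)[][E,N (X 57450)[][][E,L1 (X 54007)]][E,X 51428]][N (X 44732)[L1 (X 44055)][][],
N (X 48632)[][D0 (L1 (U1 (X 44546))),N E[][E,X 46892][E,X 39863]][X 29626]]]"

definition "t2_38 = N (X 58664)[N E[][X 57711,N (X 58341)[][X 57928,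
X 58133][N (X 54217)[][][X 46275]]][X 53467,N (X 55100)[][X 52355,L1 (U1 (X 51433))][X 42667,N E[][E,
L1 (X 43347)][E,X 34029]]]][N (X 53958)[N E[][X 53515][X 51083]][X 51344,N E[][E,L1 (X 50019)][E,
L1 (L1 (X 41656))]][N (X 41944)[U1 (X 37998)][N E[][X 38252,X 36659][]][L0 (L0 (X 24132))],
N (X 41887)[][X 36885,L1 (L1 (X 36882))][]],N (X 56169)[E,U1 (L0 (X 53969))][E,N (X 54841)[][E,
U1 (L1 (X 51992))][E,X 48847]][E,N (X 46606)[][E,N (X 45449)[][E,N (X 45119)[][E,
X 46283][]][]][]]][N (X 40936)[][N (X 36705)[][L0 (X 33208)][X 24241]][N (X 22406)[][L0 (X 17105)][],X 19815],
N (X 44391)[N E[][E,N (X 43908)[][X 43173][]][E,N (X 39211)[][E,L1 (X 39909)][]]][N (X 37984)[][L0 (X 32167),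
X 35179][],N (X 42210)[][E,L1 (N (X 40649)[][E,X 40431][])][E,
L1 (X 30766)]][N (X 22608)[][][D0 (L0 (L1 (X 2)))],X 28374]]"

definition "t2_39 = N E[N E[U1 (N (X 68165)[][][E,X 67272])][N (X 67814)[][L0 (X 67427),U1 (X 66857)][E,
N (X 66047)[][E,L1 (X 65316)][E,X 62055]],N (X 68129)[][E,X 67972][X 65836,X 66507]][U1 (X 59281),
N (X 66121)[][X 64636,N (X 65183)[][U1 (X 63194)][]][X 58168,N (X 59743)[][L0 (X 55270)][E,X 49959]]],
N E[][N (X 68074)[][][X 65952],N (X 68061)[][N (X 67811)[][][X 66808],
X 67892][N (X 66318)[][X 65634][X 61877],
N (X 66609)[][L0 (X 65691)][]]][N (X 65896)[][L1 (U1 (X 62533))][X 59332],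
N (X 66227)[U1 (X 65816)][N (X 65009)[][N (X 64325)[][X 64069][]][X 60683,X 60976]][N (X 59658)[][X 57717][],
X 61249]]][N (X 65767)[N E[][E,U1 (U1 (X 63262))][E,N (X 64323)[][L1 (X 63583)][E,
L1 (X 59689)]]][N (X 64190)[][E,N (X 63128)[][E,N (X 62649)[][E,X 62398][]][E,L1 (L1 (X 58601))]][E,
N (X 58143)[][E,X 56446][]],N (X 64349)[][E,N (X 63481)[][E,L1 (X 62814)][E,
L1 (X 60033)]][X 57634]][N E[][X 57502][E,X 44289],N (X 57499)[][X 53928,X 55087][N (X 42218)[][][E,X 23277],
N (X 44500)[][N (X 38815)[][L1 (X 35283)][],L1 (X 41783)][]]],t2_37][N E[][N (X 54827)[][E,X 51475][E,
N (X 41918)[][E,X 39382][]]][U1 (X 22533),N (X 40544)[][N (X 35064)[L0 (U1 (X 33412))][][]][X 19799,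
N (X 22254)[][X 15835][]]],t2_38]"

definition "t2_40 = N E[N E[][E,N E[][U1 (X 66427),N (X 66859)[][][E,X 66260]][X 64965,N E[][X 65042,
X 65381][X 60502,X 62286]]][E,N E[][N (X 63876)[][X 63174,X 63630][N (X 59667)[][][X 54193],X 59904],
N (X 64508)[][L1 (X 63843),N (X 64100)[][E,X 63943][E,X 62867]][E,
L1 (X 60715)]][N (X 57866)[][][N (X 47478)[][X 45960][]],N (Y 59415)[][X 56875][]]]][N E[][E,N E[N E[][E,
X 63491][E,N (X 63245)[][][X 60438]]][N E[][E,X 62392][E,N (X 58712)[][E,X 57710][]],N (X 62797)[][E,
N (X 62389)[][E,X 62231][]][E,N (X 59722)[][Y 58911][]]][U1 (X 44940),N E[][E,X 57717][E,X 49105]]][E,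
N E[N E[][E,L1 (X 57040)][X 54047,L1 (X 54706)]][N (X 53670)[][N (X 51877)[][X 51066][],N (X 52578)[][E,
X 51533][]][X 44449,X 44110],N (X 54826)[][E,N (Y 53618)[][E,
Y 53070][]][]][L0 (X 38958)]]][U1 (L0 (N E[L1 (X 34812)][X 32354,X 32807][]))]"

definition "t2_41 = N E[N E[][E,N (X 66128)[][][E,N (X 65589)[][][E,X 64031]]][Y 64328,N (X 65136)[][E,
X 64701][]],N E[][E,X 66151][U0 (X 61296)]][N E[U1 (X 64078)][N (X 63333)[][X 62762,X 62949][X 59726,
N (X 59523)[][E,X 59523][]],N (X 63668)[][E,X 63233][E,X 60392]][N (Y 58182)[][N (X 56905)[][E,X 55546][]][],
L1 (N (X 56746)[][E,X 56030][])],N E[][N (X 64216)[][][E,N (X 60408)[][E,X 60408][]],N (X 64539)[][E,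
Y 64282][X 60895,N (X 61995)[][E,X 61811][]]][E,U1 (X 53242)]][N E[N E[][E,X 57127][E,
X 54667]][N (X 54771)[][X 53343][]][L0 (X 41688)],N E[N E[][E,X 59061][E,X 56844]][L1 (X 54234),
N (Y 57860)[][E,N (X 57149)[][][E,X 53990]][]][E,N E[][E,X 47278][E,X 35832]]]"

definition "t2_42 = N (N E[][E,t2_41][E,N E[N E[][E,N (X 58029)[][N (X 57657)[][][E,X 56494],X 57836][E,
X 55745]][E,N (X 54881)[U1 (Y 54496)][L1 (Y 51932),X 53729][E,
X 45785]]][N E[L1 (X 53561)][N (X 51205)[][X 49806,X 49705][X 43318,X 43024],N (X 51709)[][E,X 50499][E,
X 43819]][L0 (X 39384),N E[L1 (Y 41792)][E,Y 38935][]],N E[E,U0 (X 53910)][E,N (X 54623)[][X 52892,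
N (X 54030)[][E,X 53813][]][X 45592]][E,L0 (X 41679)]][N E[L1 (N (X 39948)[][X 39617,
X 39431][])][L0 (X 34436)][],N E[][E,N (Y 42088)[E,U0 (X 39580)][E,Y 40933][E,X 31480]][E,
L1 (X 26664)]]])[][N (N E[E,U0 (L0 (L1 (X 64024)))][E,U1 (D0 (L1 (X 58944)))][])[][][],N (N E[][E,
L0 (N E[][L0 (Y 62433),L1 (X 62866)][])][E,D0 (L0 (L1 (X 57447)))])[][][]][]"

definition "t2_43 = N E[E,U0 (N (L1 (L1 (L0 (L0 (Y 63574)))))[][][])][t2_42,N (N E[E,U1 (U1 (X 60761))][E,
N E[E,U1 (L0 (X 63996))][E,N E[][E,X 63499][E,Y 60042]][]][E,N E[L1 (L1 (X 57341))][E,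
L1 (Y 54292)][]])[][][N (L1 (L1 (U0 (L0 (X 56516)))))[][][]]][N (N E[][E,
N E[U1 (U0 (X 58540))][N E[][N (X 59715)[][][X 58142],N (X 59790)[][][E,X 57926]][N (X 56360)[][X 55302][],
X 56896],N E[][E,Y 60139][E,L1 (Y 57713)]][N E[U1 (X 53389)][N (X 53091)[][X 52012,N (X 51557)[][E,
X 50996][]][X 46243]][],L1 (X 55613)]][E,N E[N E[][E,N (X 54881)[][][X 52728]][E,X 53561]][N E[N E[][E,
X 51505][E,X 50519]][N (X 49674)[][X 48595,X 48688][L0 (X 42193)],N (X 50271)[][E,N (X 49215)[][E,
X 48736][]][E,X 43856]][],L1 (N (X 52400)[][X 51684][])][N E[L1 (N (X 39457)[][E,
X 39183][])][N (X 36359)[][X 34194][]][],L1 (Y 41612)]])[][E,N (N E[][E,U1 (L1 (L1 (Y 53100)))][E,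
L0 (L0 (L0 (Y 47682)))])[][][]][],N (N E[][E,U1 (L0 (X 52265))][E,D0 (L1 (U1 (X 52488)))])[][][]]"

definition "t2_44 = N E[N E[][N (X 63941)[][][E,N (X 62684)[][][E,X 59930]],N (Y 64183)[][E,N (Y 64137)[][][E,
X 63795]][E,N (X 63253)[][][E,X 60491]]][E,N (X 62671)[][X 61413,N (X 62110)[][E,X 61791][]][E,
N (X 57566)[][X 55141,X 56582][E,X 49144]]]][N E[N E[][E,X 61990][E,N (X 61152)[][E,
X 60964][]]][N (X 60661)[][N (X 59987)[][][E,X 58268],N (X 59960)[][E,X 59773][E,X 57288]][X 56737,
N (X 55829)[][E,X 54461][E,N (X 48808)[][X 44187][]]],N (X 60988)[][X 60223,N (X 60426)[][E,X 60108][]][E,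
N (X 56474)[][][X 45802]]][N (X 56092)[][][X 46039],N (X 55136)[U1 (X 54038)][L1 (X 51073),N (X 53190)[][E,
X 52268][]][E,N (X 43539)[][X 38407,X 41442][]]],N E[U1 (X 62533)][N E[][L0 (Y 60452)][E,N (X 56793)[][E,
U1 (L1 (X 50391))][]],N (X 62339)[][E,Y 61917][X 56863,N (X 58627)[][X 56729,X 58130][E,
X 52336]]][N E[][X 53497][E,X 42159],N (X 57209)[][N (X 53972)[][L1 (X 51515),L1 (X 52425)][E,L1 (X 44004)],
N (X 56085)[][L1 (X 53960),N E[][E,X 55524][E,X 53920]][E,L1 (X 50080)]][X 43889,
X 47623]]][N E[][N (X 51801)[][N (X 50658)[][E,X 49826][]][E,
N (X 40935)[][X 37606][]]][N (X 43632)[][Y 39685][]],N E[U1 (X 53265)][N E[][E,X 50290][E,X 41164],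
N (X 54174)[U1 (N (X 52743)[][E,X 52408][E,L1 (X 49704)])][N (X 51494)[][E,X 50441][E,N (X 43865)[][E,
N (X 42250)[][E,X 42814][]][]],N E[][E,L1 (X 52572)][E,N (X 48295)[][X 45562][]]][X 42173,N E[][E,X 44732][E,
X 34031]]][E,N E[N E[][E,N E[][E,X 42870][E,X 41284]][E,L1 (X 38226)]][N (X 37387)[][X 33908,N (X 34817)[][E,
X 33791][]][X 24990],N (X 41354)[][E,N (X 40533)[][E,X 40123][]][]][X 22470,
N (X 28109)[][L0 (L1 (X 12742))][]]]]"

definition "t2_45 = N E[N E[][U1 (L1 (X 61141)),U1 (N E[][E,Y 61423][E,Y 59757])][E,N E[][N E[][E,X 59772][E,
L1 (X 56982)],N (X 60468)[][E,X 60211][]][E,L1 (N (X 55778)[][E,X 55500][E,Y 54071])]]][N E[U1 (U1 (N E[][E,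
X 57681][E,X 55196]))][N E[][E,U1 (L1 (X 56261))][E,L1 (Y 54174)],N E[][N E[][E,X 58637][E,L1 (X 56351)],
N (X 58864)[][E,X 58607][E,Y 57431]][E,N E[][E,X 54721][E,X 49078]]][E,N E[N E[][E,X 53861][E,
L1 (X 52733)]][N (X 51022)[][E,N (X 50356)[][E,X 49894][]][],N (X 52429)[][E,X 51500][E,N (X 46033)[][E,
Y 44957][]]][E,L1 (L1 (Y 40470))]],N E[N E[][E,X 61133][E,N E[][X 60328][E,N (X 58619)[][E,
X 58191][]]]][N E[][E,N (X 59405)[][][E,X 57464]][E,N E[][E,N (X 54489)[][][E,Y 51747]][E,X 47356]],N E[][E,
N (Y 60325)[][E,X 60216][E,X 59262]][E,U1 (X 52234)]][E,N E[][L0 (X 51645),N (X 55146)[][E,X 54762][]][E,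
N E[][X 42798,N (X 46218)[][E,X 45884][]][E,X 35384]]]][E,N E[N E[][E,N (X 54623)[][][E,N (X 53405)[][][E,
Y 51482]]][E,N E[][L1 (X 50517),X 51652][E,L1 (Y 43946)]]][N E[][U1 (X 41574),N (X 49374)[][E,N (X 48626)[][E,
X 48209][]][E,N (X 43264)[][E,Y 42316][]]][E,L1 (X 38362)],N E[L1 (Y 53127)][L0 (L1 (X 49389)),
N (X 52270)[][X 51145,N (X 51902)[][E,X 51769][]][X 45123]][]][E,N E[][E,N (X 41003)[][E,X 40048][E,
X 31408]][E,N E[][X 20807,N (X 26348)[][E,X 25547][]][]]]]"

definition "t2_46 = N t2_44[N E[][E,
N (L0 (L1 (L1 (L1 (X 59828)))))[][][]][N (U1 (N E[D0 (L1 (X 54670))][L0 (L1 (Y 48099))][]))[][][],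
N (L1 (N E[U1 (L1 (Y 59032))][L1 (L1 (X 58475))][]))[][][]],N E[][N (N E[][E,L1 (L1 (L1 (Y 61556)))][E,
L1 (N E[L1 (X 53984)][E,L1 (Y 52554)][])])[][][]][N (N E[][E,U1 (L0 (L0 (X 52380)))][E,
L1 (L1 (L1 (Y 51877)))])[][][]]][N t2_45[][N (N E[][E,N E[][E,U1 (L1 (X 57193))][E,N E[][L1 (X 52354),
L1 (Y 54432)][]]][E,N E[][L0 (L1 (X 47789)),N E[L1 (X 52554)][L1 (X 49787),L1 (X 51618)][]][]])[][][],
N (L1 (U1 (L1 (L1 (Y 54078)))))[][][]][N (U1 (N E[][N E[L1 (Y 46619)][E,L1 (X 45971)][]][E,
D0 (L1 (X 41120))]))[][][]],N (N E[U1 (N E[][E,Y 57810][N E[][][X 46082,X 45896],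
N E[][X 53805][X 46106]])][N E[][U1 (L1 (X 54662)),U0 (U1 (X 44644))][E,N E[][N E[][][X 43326,X 43647],
Y 51251][L0 (X 38176)]],N E[][E,N E[][E,Y 57491][E,L1 (X 55716)]][E,N E[][E,Y 53352][E,
Y 46761]]][U1 (L0 (L0 (Y 31678))),L1 (L1 (Y 50713))])[][N (U1 (L1 (L0 (L1 (X 50182)))))[][][],
N (N E[][U1 (L0 (N E[][X 48457,X 48913][]))][U1 (L0 (U0 (X 23684)))])[][][]][N (U1 (N E[][E,
U1 (L1 (Y 44931))][E,L0 (L0 (X 33621))]))[][][]]][N (N E[][N E[][L1 (Y 49336)][E,N E[][L1 (X 45201)][E,
L1 (Y 39122)]],N E[][N E[][E,X 49856][E,N (Y 48945)[][E,X 48473][E,Y 45403]]][U1 (X 39251),N E[][E,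
L1 (X 47709)][E,L1 (X 43806)]]][E,N E[U1 (U1 (L1 (X 44357)))][N E[][E,Y 43639][E,N (X 37983)[][E,X 36467][]],
L1 (X 45504)][E,N E[][E,L1 (Y 37461)][E,N (X 27484)[][E,X 26166][]]]])[][N (N E[][E,
U1 (N E[L1 (Y 46995)][L1 (X 46609),L1 (X 46850)][])][E,U1 (N E[L1 (X 38124)][L1 (X 33398),
L1 (Y 36966)][])])[][][],N (U1 (U1 (L1 (L1 (Y 35738)))))[][][]][N (U1 (N E[L1 (L1 (Y 34154))][][E,
N E[][L1 (X 29208)][E,L1 (X 24347)]]))[][][]],N (N E[U1 (U1 (U0 (X 42121)))][N E[][E,U1 (N E[][E,X 44772][E,
X 42740])][E,N E[][][Y 37073,N (Y 39393)[][Y 36878][]]],U1 (L1 (Y 43782))][E,U1 (L1 (Y 35654))])[][][]]"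

definition "t2_47 = N E[N E[][][N (Y 58803)[][][X 56926],N (X 59392)[][][X 56102]],
U1 (N (X 59134)[][][L0 (X 56580)])][N (X 58802)[][N (X 58123)[][Y 57820][X 55873,X 56047],
U1 (X 56448)][N (X 54389)[][X 53355][X 47111],X 54683],
N (X 59086)[][N (X 58517)[][N (Y 58191)[][][N (X 56995)[][][X 53740]]][N (X 56173)[][][L0 (X 50753)]],
N (X 58664)[][][X 56587]][X 54958,N (Y 55789)[][N (X 54383)[][X 53906][],X 55377][X 47915,
L1 (X 50833)]]][N (X 53475)[L1 (X 53311)][N (X 51478)[][X 50479][]][N (X 42633)[][X 40433][X 29072],X 41786],
N (X 54646)[N E[][E,X 54517][E,X 53297]][N (X 52087)[][X 50931][D0 (L1 (X 44572)),L1 (X 43400)],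
Y 53536][X 42875,N (X 46056)[][N (X 42244)[][X 39821][],L1 (X 44888)][]]]"

definition "t2_48 = N E[N E[][E,N (X 53781)[][X 53644,Y 53688][N (X 51301)[][][E,X 46047],X 52184]][E,
N (X 51584)[][N (X 49893)[][][E,X 45022]][X 41593,X 44247]]][N (X 50451)[N E[][E,X 50349][E,
X 49158]][N (X 48515)[][X 47517][X 42136,N (X 41296)[][L0 (X 36591)][]],N E[][E,Y 48058][E,
X 42682]][N (X 40599)[][X 38449][N (X 27102)[][X 24910][]],X 40533],N (X 51943)[][E,N (X 50909)[][E,
X 50415][E,N E[][X 45153,X 47106][]]][E,N (Y 44415)[][][E,X 33724]]][N (Y 39201)[N E[][E,X 38560][E,
X 34489]][N (X 35581)[L1 (X 35221)][X 33714][]][N (X 22124)[L1 (X 21345)][][],X 19672],N (X 42031)[N E[][E,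
X 41650][E,X 38351]][N (X 36627)[][E,X 34328][],N (X 40005)[E,U1 (X 40207)][E,
Y 39108][]][N (Y 22397)[L1 (X 21793)][][],N E[][X 20711,X 26200][]]]"

definition "t2_49 = N E[E,U1 (N E[][L0 (X 55764)][N (X 53121)[][N (Y 52301)[][][X 48847]][],X 54460])][E,
N E[U1 (U0 (X 54175))][N E[][N E[][Y 55027][N (Y 53598)[][][Y 50885]]][N (Y 52514)[][X 51801][L0 (Y 46017)],
N (X 52461)[][N (X 51287)[][][X 46487]][]],N E[][X 55263,X 55237][E,
N (X 53147)[][X 52599][]]][N E[][N (X 49842)[][X 48996][]][N (X 41999)[][N (X 40075)[][X 39130][]][]],
N E[N E[][E,X 51881][E,X 51139]][N (X 50090)[][N (Y 49239)[][X 48815][]][X 44463],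
Y 51192][N (Y 42064)[][L0 (X 37554)][],L1 (X 45163)]]][E,N E[N E[][E,N (X 51205)[][][L0 (X 49088),X 50113]][E,
N (Y 49674)[][N (X 48453)[][X 47836][]][L0 (X 39146)]]][N E[U1 (X 47683)][N (X 47128)[][N (X 46282)[][X 45956][]][]][N (X 40059)[][N (X 38032)[][X 37087][]][],
X 40095],L1 (X 48885)][N E[L1 (X 37744)][N E[L1 (X 34681)][X 33201][]][],N E[L1 (Y 40508)][E,
L1 (Y 38106)][]]]"

definition "t2_50 = N (N E[E,N E[][E,N (X 60741)[][][N (X 60012)[][][X 57668],N (X 60079)[][][X 57842]]][E,
N E[U1 (X 59621)][N (X 59051)[][Y 58725][E,X 56670]][N (X 55335)[][X 54180][X 47371],
N (X 56289)[][X 54884][]]]][E,t2_47][E,t2_48])[E,N E[][N (L1 (N E[][L0 (L0 (Y 57640))][E,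
N E[L1 (Y 54418)][L1 (X 51061),L1 (X 53193)][]]))[][][]][N (U1 (L0 (L0 (L0 (Y 47132)))))[][][]]][N (N E[E,
U0 (L0 (L1 (X 56506)))][E,N E[][N E[][E,N (X 55857)[][][E,X 54608]][E,U1 (X 47301)],N E[][E,
Y 56056][L0 (X 52739),N E[][E,Y 53650][E,X 49959]]][D0 (U1 (X 50623)),N E[][N (X 50897)[][X 50021,X 50125][],
N (X 51933)[][][E,X 48288]][E,L1 (X 44662)]]][E,N E[L1 (U1 (Y 50764))][N E[][E,N (X 47814)[][][E,X 42526]][E,
D0 (U1 (X 38985))],N E[][E,N (Y 49374)[][E,X 49111][X 44041,L1 (Y 45591)]][E,N E[][E,
X 42965][X 28543]]][D0 (L1 (Y 38048)),N E[L1 (X 41203)][L0 (X 33615),U1 (X 31287)][]]])[][N (N E[][E,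
N E[][][L0 (L1 (Y 48977)),N E[][L1 (X 50125),L1 (X 50831)][]]][E,N E[][N E[][E,L1 (X 46652)][E,
L1 (X 37904)]][D0 (L1 (Y 37879))]])[][][]][],N t2_49[][N (U1 (U1 (D0 (L1 (X 40071)))))[][][],N (N E[][E,
N E[][][L0 (L0 (X 48238)),L0 (L0 (Y 48586))]][E,L0 (L0 (L0 (X 45622)))])[][][]][]][N (N E[][E,
N E[][][L0 (Y 42077),N E[][N (X 42424)[][][X 40421],Y 42603][X 38111,N (X 39802)[][][E,X 35917]]]][E,
N E[][N E[][L1 (Y 40095),N (Y 40147)[][][E,X 38103]][X 35440],N E[][E,N (X 40875)[][][X 38880]][E,
N (X 37983)[][N (X 36427)[][X 35864][]][]]][N E[N E[][E,X 33408][E,X 31781]][N (X 31255)[][E,X 29628][]][],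
N E[][N (X 33108)[][Y 31268][],Y 34758][]]])[][N (U1 (L0 (U1 (L1 (X 34810)))))[][][],
N (U1 (U1 (L0 (L0 (Y 31259)))))[][][]][],N (N E[][E,N E[][U1 (Y 43903)][N E[][L0 (X 42074)][E,Y 37443],
N E[][][L0 (X 35398),X 39014]]][E,N E[U1 (Y 41600)][N E[][E,U1 (X 38029)][L0 (X 36128),
N (Y 35440)[][X 33737][]]][D0 (N E[][E,X 33484][E,X 31751])]])[][E,N (U1 (U0 (L0 (L0 (Y 29833)))))[][][]][]]"

definition "t2_51 = N E[N E[][E,U1 (X 44025)][N (X 42239)[][][E,X 39129],N E[][E,X 42992][E,
X 39602]]][N (X 42031)[][E,U1 (L1 (X 38365))][X 35204,N (X 35784)[][E,X 34249][X 21668,X 24367]],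
N (X 43360)[U1 (U0 (X 40339))][N E[][E,X 41861][E,N (X 38774)[][E,X 37896][E,X 31157]],N (X 42938)[][E,
X 42746][E,L1 (X 41144)]][U1 (X 24083),N E[][E,X 38374][E,
X 31642]]][N (X 33755)[][X 30891][N (X 20120)[][X 18149][],X 18405],N (X 36409)[N E[][U1 (X 35357)][X 32506,
L1 (X 34643)]][N (X 32527)[][X 30326,X 31239][X 21777,X 22762],N (X 35141)[][E,X 34695][E,
L1 (X 29203)]][N (X 20557)[][X 16655][X 1701],N (X 25372)[][X 19502,L1 (X 23642)][E,X 10791]]]"

definition "t2_52 = N E[N E[][U1 (X 48088),N (X 48419)[][][E,X 48285]][E,N E[][E,X 47883][N (X 45832)[][][E,
X 42003],N (X 46203)[][][X 41328,X 42907]]],N E[][][U1 (X 47159),N (X 47940)[][][N (X 45932)[][][X 41995],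
N (X 46662)[][X 46104][X 42576]]]][N E[U1 (X 47257)][N E[][Y 46666,X 46522][E,N (X 44944)[][][E,X 41262]],
N (X 47068)[][U1 (U1 (X 44903)),X 46927][X 44470,L0 (U1 (X 43625))]][N E[][X 43211][E,X 37473],
N (Y 44146)[][N (X 42440)[][][X 38275,X 38866],X 43143][X 35638,N (X 37407)[][X 34197,X 36253][X 22853,
X 26992]]],N E[][N (X 47440)[][E,X 47343][X 45329,N (X 45694)[][][X 39790,N (X 43095)[][X 40747][]]],
N (Y 47671)[][E,N (X 47565)[][][E,X 47346]][N (X 45557)[][][E,X 42068],N (X 46358)[][X 45800][X 42271,
X 43830]]][N (X 44076)[][X 42788][X 37193,N (X 36709)[][X 33833][]],N (X 45293)[][N (X 43925)[][X 43413,
X 43609][X 39672,X 40860],N (X 44812)[][][E,N E[][E,X 43013][E,X 37994]]][N (X 37405)[][X 35204][X 26045,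
X 24580],N (X 40187)[][X 38104,X 39668][E,X 33287]]]][N E[][N E[][E,X 40568][E,X 35093]][E,
N (X 33446)[][X 29745][N (X 18297)[][X 15260][],X 20089]],t2_51]"

definition "t2_53 = N t2_52[L1 (N (D0 (N E[][E,U1 (L1 (Y 47353))][E,U1 (L1 (Y 45458))]))[][][]),
L0 (N (U1 (N E[U1 (L1 (X 43563))][L1 (L1 (Y 40754)),N E[L1 (Y 43023)][L1 (Y 41628),L1 (Y 42460)][]][E,
U1 (L1 (X 24181))]))[][][])][N (N E[U1 (U1 (N (Y 44187)[][E,X 43973][]))][N E[][U1 (L1 (X 43074)),
U1 (N (Y 43429)[][][E,X 41416])][E,N E[][X 40654,N (X 41219)[][E,X 41041][E,Y 39942]][E,N (Y 36369)[][E,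
X 35322][]]],N E[][U1 (U1 (N (X 42008)[][][E,X 35374]))][E,N E[][L1 (X 42124),N (X 42883)[][][E,X 41632]][E,
N (Y 39089)[][E,X 38674][]]]][E,N E[U1 (U1 (X 39394))][N E[][N E[][E,X 38942][E,X 37185],U1 (X 37306)][],
N E[][E,Y 41003][E,N E[L1 (X 37722)][E,L1 (X 37220)][]]][E,N E[][N (Y 31696)[][E,X 30693][],X 34126][E,
L1 (X 24050)]]])[][N (N E[][U1 (L1 (L1 (X 40373))),U1 (U1 (L1 (X 38470)))][E,N E[U1 (L1 (X 40469))][N E[][E,
L1 (X 38645)][E,L1 (Y 33219)]][E,L1 (L1 (X 33418))]])[][][]][N (U1 (U1 (L1 (L1 (X 29693)))))[][][]],N (N E[E,
U1 (U0 (U0 (X 37397)))][E,N E[][][N E[][][X 34503,X 33997],N E[][N E[][E,X 38147][N (X 35756)[][][X 29246]],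
X 38595][N (X 34113)[][][L0 (X 23273)],N (Y 35784)[][X 34830][]]]][E,N E[][U0 (Y 32396),L0 (N E[][E,
X 36999][E,X 35482])][N E[][X 28294][Y 19488],N E[][N (X 30216)[][E,X 29487][],X 31696][X 19550,
Y 24350]]])[][N (U1 (L1 (U1 (L1 (Y 33398)))))[][][],
N (U1 (U1 (L0 (L0 (X 27776)))))[][][]][]][N (N E[][N E[][E,L1 (X 29403)][E,N E[][E,X 28741][E,N E[][E,
X 27774][E,Y 24457]]],U1 (U1 (N (X 27880)[][][X 22660,X 26613]))][U1 (U1 (X 18991)),N E[][N E[][E,X 27826][E,
U1 (X 23679)],U1 (N E[][U1 (X 26071)][E,L1 (X 24869)])][U1 (Y 16018),N E[][X 24350,X 24990][X 17498,
N (X 20823)[][X 17486][]]]])[][N (U1 (U1 (D0 (L1 (Y 24181)))))[][][]][],N (U1 (U1 (N E[][N E[][E,Y 19550][E,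
X 18600]][X 13936,L0 (X 14720)])))[][][]]"

definition "t2_54 = N E[N E[][][X 43582,N E[][X 43660,X 43589][X 42370,X 42657]],N E[][][U0 (X 42017),
N (X 43652)[][X 43599][N (X 42218)[][][X 38987],X 42848]]][N E[][N (X 43104)[][][X 42195,N (X 42111)[][][E,
X 40663]],N (X 43163)[][][E,N (X 42160)[][][X 38797]]][N (X 41040)[][][X 36928,X 36357],N E[][X 40960,
N (X 40670)[][][E,X 38499]][X 34929,N (X 36149)[][N (X 34036)[][X 32294][]][]]],
N E[][N (X 43287)[][X 43181][N (X 41684)[][][E,X 38609],X 41945],N (Y 43348)[][E,X 43257][N E[][][X 38592,
X 40453],X 42258]][N (X 40892)[][X 39964][X 35079,X 34549],N (X 41333)[U1 (X 41068)][N (X 40376)[][Y 39872][E,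
X 37300]][N (X 34927)[][X 33281][],X 37086]]][N E[N E[][E,X 40486][E,X 39723]][N E[][E,N (X 38668)[][][E,
X 36094]][X 37305,N (X 34104)[][X 32745][]]][N (X 33446)[U1 (X 31992)][][X 25301,X 20830]],N E[N E[][E,
N (X 40888)[][][E,X 40367]][E,N (X 40337)[][X 39747][X 35458,
X 37577]]][N (X 39201)[U1 (X 38965)][N (X 38272)[][X 37867][X 35277,X 35081],X 38650][N E[][X 32304][X 25028],
N (X 33576)[][X 31404,X 32420][X 20953]],U1 (X 36458)][N (X 32105)[U1 (X 30139)][N (X 29675)[][E,
X 27978][]][X 19427,X 17809],N (X 33755)[U1 (X 32351)][X 30362][X 19403,X 24345]]]"


definition "t2_55 = N t2_39[N E[L1 (N (D0 (L0 (U1 (L1 (X 65568)))))[][][])][N (L0 (L0 (L0 (L1 (X 62824)))))[][][],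
N t2_40[][N (L0 (L1 (D0 (L1 (Y 63093)))))[][][],
N (N E[U1 (L0 (L0 (X 62916)))][L1 (L0 (L1 (X 62076)))][])[][][]][]][E,N (N E[N E[][E,U1 (N E[][E,Y 60533][E,
X 59075])][E,N E[][E,N (X 59700)[][][E,N E[][E,X 58331][E,X 54970]]][X 55360,N (Y 56989)[][X 55417,
X 56266][]]]][N E[][E,N E[][U1 (X 56653),N (X 58381)[][][E,X 57011]][E,N E[][E,X 55208][E,X 49208]]][E,
N E[][N (Y 51618)[][X 50392,X 51034][X 44242,X 44265],N E[][E,Y 52037][E,L1 (Y 46038)]][E,N (Y 43870)[][E,
X 42090][]]]][U1 (L0 (L0 (X 32607)))])[][N (L0 (U1 (L1 (L1 (Y 51457)))))[][][]][E,
N (L0 (L1 (D0 (L1 (Y 47255)))))[][][]]],t2_43][t2_46,t2_50][t2_53,N t2_54[E,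
L0 (N (U1 (L0 (L0 (L0 (Y 37429)))))[][][])][N (U0 (L0 (N E[][E,N (X 33905)[][][E,Y 33251]][E,
X 30954])))[][][],N (N E[][E,N E[][U0 (N (Y 37894)[][][X 35574])][U0 (N (X 32771)[][X 31842][X 27138]),
N E[][X 36795][N (X 32548)[][Y 31422][X 25974],X 35135]]][E,
N E[U1 (N E[][Y 36359][Y 33930])][N E[][Y 34944][E,L0 (Y 29939)]][N E[U1 (X 28458)][N (X 27884)[][X 26945][E,
X 19914]][N (Y 18727)[][X 16862][]],N E[U1 (Y 30235)][N (Y 28294)[][Y 27168][]][]]])[][E,N (N E[][E,
U1 (U0 (L0 (Y 30944)))][E,
N E[][U1 (L0 (Y 29622))][L0 (L0 (X 26388))]])[][][]][]][N (N E[][][L0 (L1 (Y 19640)),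
U1 (U0 (X 15510))])[][][],N (U1 (N E[][U1 (U0 (Y 18407))][N E[][U1 (X 15850)][X 13801,X 14466],
U0 (N (X 13634)[][X 11335][])]))[][][]]]"

definition "t2 = N (N (X 90433)[N E[N E[][L1 (L1 (X 90183)),X 90307][]][N (X 89033)[][L1 (X 87519),
L1 (U1 (L0 (X 84092)))][E,N E[][E,L1 (N (X 80171)[][E,X 79621][])][E,X 72708]],N (X 89546)[][L1 (X 87915),
X 88531][E,N (X 83525)[][E,X 82162][D0 (L1 (L1 (X 70218)))]]][U1 (N (X 70052)[][][E,X 53114]),
N (X 83626)[][L1 (L1 (X 77046)),L1 (X 79532)][E,
L0 (D0 (L1 (U1 (X 66344))))]]][t2_0][t2_1])[t2_12][N t2_15[t2_17,t2_18][t2_26,t2_29][t2_33,t2_36]][t2_55]"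

lemmas [compute] =
  arg_cong[OF t2_0_def, of descend] arg_cong[OF t2_1_def, of descend] arg_cong[OF t2_2_def, of descend]
  arg_cong[OF t2_3_def, of descend] arg_cong[OF t2_4_def, of descend] arg_cong[OF t2_5_def, of descend]
  arg_cong[OF t2_6_def, of descend] arg_cong[OF t2_7_def, of descend] arg_cong[OF t2_8_def, of descend]
  arg_cong[OF t2_9_def, of descend] arg_cong[OF t2_10_def, of descend] arg_cong[OF t2_11_def, of descend]
  arg_cong[OF t2_12_def, of descend] arg_cong[OF t2_13_def, of descend] arg_cong[OF t2_14_def, of descend]
  arg_cong[OF t2_15_def, of descend] arg_cong[OF t2_16_def, of descend] arg_cong[OF t2_17_def, of descend]
  arg_cong[OF t2_18_def, of descend] arg_cong[OF t2_19_def, of descend] arg_cong[OF t2_20_def, of descend]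
  arg_cong[OF t2_21_def, of descend] arg_cong[OF t2_22_def, of descend] arg_cong[OF t2_23_def, of descend]
  arg_cong[OF t2_24_def, of descend] arg_cong[OF t2_25_def, of descend] arg_cong[OF t2_26_def, of descend]
  arg_cong[OF t2_27_def, of descend] arg_cong[OF t2_28_def, of descend] arg_cong[OF t2_29_def, of descend]
  arg_cong[OF t2_30_def, of descend] arg_cong[OF t2_31_def, of descend] arg_cong[OF t2_32_def, of descend]
  arg_cong[OF t2_33_def, of descend] arg_cong[OF t2_34_def, of descend] arg_cong[OF t2_35_def, of descend]
  arg_cong[OF t2_36_def, of descend] arg_cong[OF t2_37_def, of descend] arg_cong[OF t2_38_def, of descend]
  arg_cong[OF t2_39_def, of descend] arg_cong[OF t2_40_def, of descend] arg_cong[OF t2_41_def, of descend]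
  arg_cong[OF t2_42_def, of descend] arg_cong[OF t2_43_def, of descend] arg_cong[OF t2_44_def, of descend]
  arg_cong[OF t2_45_def, of descend] arg_cong[OF t2_46_def, of descend] arg_cong[OF t2_47_def, of descend]
  arg_cong[OF t2_48_def, of descend] arg_cong[OF t2_49_def, of descend] arg_cong[OF t2_50_def, of descend]
  arg_cong[OF t2_51_def, of descend] arg_cong[OF t2_52_def, of descend] arg_cong[OF t2_53_def, of descend]
  arg_cong[OF t2_54_def, of descend] arg_cong[OF t2_55_def, of descend] arg_cong[OF t2_def, of descend]

definition "p2 S T = search t2 (tidy (S, T))"

definition "c2 = pays p2 26262 2 60810"

lemma [compute]:
  "p2 S T = search t2 (tidy (S, T))"
  "c2 v m S T =
    (total p2 26262 S T m + (2 - m) * after p2 26262 S T m \<le> 2 * v + 60810)"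
  "2 - 0 = (2::nat)" "2 - Suc 0 = (1::nat)" "2 - Suc (Suc 0) = (0::nat)"
  by (simp_all add: c2_def p2_def pays_def)

lemma t2_0[compute]: "below (leaf_ok c2 []) (Suc 0) [(0, Level)] t2_0"
  unfolding t2_0_def by (simp only: compute cong: lazy_cong)

lemma t2_1[compute]: "below (leaf_ok c2 []) (Suc 0) [(0, Up)] t2_1"
  unfolding t2_1_def by (simp only: compute cong: lazy_cong)

lemma t2_2[compute]: "below (right_ok c2) (Suc 0) [(0, Down), (0, Level)] t2_2"
  unfolding t2_2_def by (simp only: compute cong: lazy_cong)

lemma t2_3[compute]: "below (leaf_ok c2 [(0, Down), (Suc 0, Level)]) (Suc (Suc 0)) [(0, Down)] t2_3"
  unfolding t2_3_def by (simp only: compute cong: lazy_cong)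

lemma t2_4[compute]: "below (leaf_ok c2 [(0, Down), (Suc 0, Level)]) (Suc (Suc 0)) [] t2_4"
  unfolding t2_4_def by (simp only: compute cong: lazy_cong)

lemma t2_5[compute]: "below (leaf_ok c2 [(0, Down), (Suc 0, Level), (Suc 0, Level)]) (Suc (Suc 0))
    [] t2_5"
  unfolding t2_5_def by (simp only: compute cong: lazy_cong)

lemma t2_6[compute]: "below (right_ok c2) (Suc (Suc 0)) [(0, Down), (Suc 0, Level)] t2_6"
  unfolding t2_6_def by (simp only: compute cong: lazy_cong)

lemma t2_7[compute]: "below (right_ok c2) (Suc 0) [(0, Down), (0, Up)] t2_7"
  unfolding t2_7_def by (simp only: compute cong: lazy_cong)

lemma t2_8[compute]: "below (leaf_ok c2 [(0, Down), (Suc 0, Up)]) (Suc (Suc 0)) [(0, Down)] t2_8"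
  unfolding t2_8_def by (simp only: compute cong: lazy_cong)

lemma t2_9[compute]: "below (leaf_ok c2 [(0, Down), (Suc 0, Up)]) (Suc (Suc 0)) [] t2_9"
  unfolding t2_9_def by (simp only: compute cong: lazy_cong)

lemma t2_10[compute]: "below (right_ok c2) (Suc (Suc 0)) [(0, Down), (Suc 0, Up), (0, Level)] t2_10"
  unfolding t2_10_def by (simp only: compute cong: lazy_cong)

lemma t2_11[compute]: "below (right_ok c2) (Suc (Suc 0)) [(0, Down), (Suc 0, Up)] t2_11"
  unfolding t2_11_def by (simp only: compute cong: lazy_cong)

lemma t2_12[compute]: "below (right_ok c2) (Suc 0) [(0, Down)] t2_12"
  unfolding t2_12_def by (simp only: compute cong: lazy_cong)

lemma t2_13[compute]: "below (leaf_ok c2 [(0, Level)]) (Suc 0) [(0, Level)] t2_13"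
  unfolding t2_13_def by (simp only: compute cong: lazy_cong)

lemma t2_14[compute]: "below (leaf_ok c2 [(0, Level)]) (Suc (Suc 0)) [(Suc 0, Up)] t2_14"
  unfolding t2_14_def by (simp only: compute cong: lazy_cong)

lemma t2_15[compute]: "below (leaf_ok c2 [(0, Level)]) (Suc 0) [] t2_15"
  unfolding t2_15_def by (simp only: compute cong: lazy_cong)

lemma t2_16[compute]: "below (leaf_ok c2 [(0, Level), (0, Down), (Suc 0, Level)]) (Suc (Suc 0))
    [] t2_16"
  unfolding t2_16_def by (simp only: compute cong: lazy_cong)

lemma t2_17[compute]: "below (right_ok c2) (Suc 0) [(0, Level), (0, Down)] t2_17"
  unfolding t2_17_def by (simp only: compute cong: lazy_cong)

lemma t2_18[compute]: "below (right_ok c2) (Suc (Suc 0)) [(0, Level), (Suc 0, Down)] t2_18"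
  unfolding t2_18_def by (simp only: compute cong: lazy_cong)

lemma t2_19[compute]: "below (leaf_ok c2 [(0, Level), (0, Level)]) (Suc 0) [(0, Down)] t2_19"
  unfolding t2_19_def by (simp only: compute cong: lazy_cong)

lemma t2_20[compute]: "below (leaf_ok c2 [(0, Level), (0, Level)]) (Suc (Suc 0))
    [(Suc 0, Level)] t2_20"
  unfolding t2_20_def by (simp only: compute cong: lazy_cong)

lemma t2_21[compute]: "below (leaf_ok c2 [(0, Level), (0, Level)]) (Suc (Suc 0)) [(Suc 0, Up)] t2_21"
  unfolding t2_21_def by (simp only: compute cong: lazy_cong)

lemma t2_22[compute]: "below (leaf_ok c2 [(0, Level), (0, Level)]) (Suc 0) [] t2_22"
  unfolding t2_22_def by (simp only: compute cong: lazy_cong)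

lemma t2_23[compute]: "below (leaf_ok c2 [(0, Level), (0, Level), (0, Level)]) (Suc 0) [] t2_23"
  unfolding t2_23_def by (simp only: compute cong: lazy_cong)

lemma t2_24[compute]: "below (right_ok c2) (Suc (Suc 0))
    [(0, Level), (0, Level), (Suc 0, Level)] t2_24"
  unfolding t2_24_def by (simp only: compute cong: lazy_cong)

lemma t2_25[compute]: "below (leaf_ok c2 [(0, Level), (0, Level), (0, Up)]) (Suc 0) [] t2_25"
  unfolding t2_25_def by (simp only: compute cong: lazy_cong)

lemma t2_26[compute]: "below (right_ok c2) (Suc 0) [(0, Level), (0, Level)] t2_26"
  unfolding t2_26_def by (simp only: compute cong: lazy_cong)

lemma t2_27[compute]: "below (leaf_ok c2 [(0, Level), (Suc 0, Level)]) (Suc (Suc 0)) [] t2_27"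
  unfolding t2_27_def by (simp only: compute cong: lazy_cong)

lemma t2_28[compute]: "below (leaf_ok c2 [(0, Level), (Suc 0, Level), (Suc 0, Level)]) (Suc (Suc 0))
    [] t2_28"
  unfolding t2_28_def by (simp only: compute cong: lazy_cong)

lemma t2_29[compute]: "below (right_ok c2) (Suc (Suc 0)) [(0, Level), (Suc 0, Level)] t2_29"
  unfolding t2_29_def by (simp only: compute cong: lazy_cong)

lemma t2_30[compute]: "below (leaf_ok c2 [(0, Level), (0, Up)]) (Suc (Suc 0)) [(Suc 0, Up)] t2_30"
  unfolding t2_30_def by (simp only: compute cong: lazy_cong)

lemma t2_31[compute]: "below (leaf_ok c2 [(0, Level), (0, Up)]) (Suc 0) [] t2_31"
  unfolding t2_31_def by (simp only: compute cong: lazy_cong)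

lemma t2_32[compute]: "below (leaf_ok c2 [(0, Level), (0, Up), (0, Level)]) (Suc 0) [] t2_32"
  unfolding t2_32_def by (simp only: compute cong: lazy_cong)

lemma t2_33[compute]: "below (right_ok c2) (Suc 0) [(0, Level), (0, Up)] t2_33"
  unfolding t2_33_def by (simp only: compute cong: lazy_cong)

lemma t2_34[compute]: "below (leaf_ok c2 [(0, Level), (Suc 0, Up)]) (Suc (Suc 0)) [(0, Level)] t2_34"
  unfolding t2_34_def by (simp only: compute cong: lazy_cong)

lemma t2_35[compute]: "below (leaf_ok c2 [(0, Level), (Suc 0, Up)]) (Suc (Suc 0)) [] t2_35"
  unfolding t2_35_def by (simp only: compute cong: lazy_cong)

lemma t2_36[compute]: "below (right_ok c2) (Suc (Suc 0)) [(0, Level), (Suc 0, Up)] t2_36"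
  unfolding t2_36_def by (simp only: compute cong: lazy_cong)

lemma t2_37[compute]: "below (leaf_ok c2 [(0, Up)]) (Suc (Suc 0)) [(Suc 0, Level)] t2_37"
  unfolding t2_37_def by (simp only: compute cong: lazy_cong)

lemma t2_38[compute]: "below (leaf_ok c2 [(0, Up)]) (Suc (Suc 0)) [(Suc 0, Up)] t2_38"
  unfolding t2_38_def by (simp only: compute cong: lazy_cong)

lemma t2_39[compute]: "below (leaf_ok c2 [(0, Up)]) (Suc 0) [] t2_39"
  unfolding t2_39_def by (simp only: compute cong: lazy_cong)

lemma t2_40[compute]: "below (leaf_ok c2 [(0, Up), (0, Down), (Suc 0, Level)]) (Suc (Suc 0)) [] t2_40"
  unfolding t2_40_def by (simp only: compute cong: lazy_cong)

lemma t2_41[compute]: "below (leaf_ok c2 [(0, Up), (Suc 0, Down), (0, Level)]) (Suc (Suc 0))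
    [(Suc 0, Level)] t2_41"
  unfolding t2_41_def by (simp only: compute cong: lazy_cong)

lemma t2_42[compute]: "below (right_ok c2) (Suc (Suc 0)) [(0, Up), (Suc 0, Down), (0, Level)] t2_42"
  unfolding t2_42_def by (simp only: compute cong: lazy_cong)

lemma t2_43[compute]: "below (right_ok c2) (Suc (Suc 0)) [(0, Up), (Suc 0, Down)] t2_43"
  unfolding t2_43_def by (simp only: compute cong: lazy_cong)

lemma t2_44[compute]: "below (leaf_ok c2 [(0, Up), (0, Level)]) (Suc 0) [] t2_44"
  unfolding t2_44_def by (simp only: compute cong: lazy_cong)

lemma t2_45[compute]: "below (leaf_ok c2 [(0, Up), (0, Level), (0, Level)]) (Suc 0) [] t2_45"
  unfolding t2_45_def by (simp only: compute cong: lazy_cong)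

lemma t2_46[compute]: "below (right_ok c2) (Suc 0) [(0, Up), (0, Level)] t2_46"
  unfolding t2_46_def by (simp only: compute cong: lazy_cong)

lemma t2_47[compute]: "below (leaf_ok c2 [(0, Up), (Suc 0, Level)]) (Suc (Suc 0))
    [(Suc 0, Level)] t2_47"
  unfolding t2_47_def by (simp only: compute cong: lazy_cong)

lemma t2_48[compute]: "below (leaf_ok c2 [(0, Up), (Suc 0, Level)]) (Suc (Suc 0)) [(Suc 0, Up)] t2_48"
  unfolding t2_48_def by (simp only: compute cong: lazy_cong)

lemma t2_49[compute]: "below (leaf_ok c2 [(0, Up), (Suc 0, Level), (Suc 0, Level)]) (Suc (Suc 0))
    [] t2_49"
  unfolding t2_49_def by (simp only: compute cong: lazy_cong)

lemma t2_50[compute]: "below (right_ok c2) (Suc (Suc 0)) [(0, Up), (Suc 0, Level)] t2_50"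
  unfolding t2_50_def by (simp only: compute cong: lazy_cong)

lemma t2_51[compute]: "below (leaf_ok c2 [(0, Up), (0, Up)]) (Suc (Suc 0)) [(Suc 0, Up)] t2_51"
  unfolding t2_51_def by (simp only: compute cong: lazy_cong)

lemma t2_52[compute]: "below (leaf_ok c2 [(0, Up), (0, Up)]) (Suc 0) [] t2_52"
  unfolding t2_52_def by (simp only: compute cong: lazy_cong)

lemma t2_53[compute]: "below (right_ok c2) (Suc 0) [(0, Up), (0, Up)] t2_53"
  unfolding t2_53_def by (simp only: compute cong: lazy_cong)

lemma t2_54[compute]: "below (leaf_ok c2 [(0, Up), (Suc 0, Up)]) (Suc (Suc 0)) [] t2_54"
  unfolding t2_54_def by (simp only: compute cong: lazy_cong)

lemma t2_55[compute]: "below (right_ok c2) (Suc 0) [(0, Up)] t2_55"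
  unfolding t2_55_def by (simp only: compute cong: lazy_cong)

lemma t2[compute]: "below (right_ok c2) 0 [] t2"
  unfolding t2_def by (simp only: compute cong: lazy_cong)

lemma bound2: "\<alpha> 2 \<le> 0.315514"
  by (rule edit_constant_le[OF p2_def c2_def _ t2, where R = 4143])
    (simp_all only: compute trie.distinct, simp_all)

section \<open>Certificate for 3 letters\<close>

definition "t3_0 = N (X 15463)[N E[E,U2 (X 15368)][N E[][E,X 15222][E,X 14695],N (X 15347)[][E,X 15261,
X 15273][E,N (X 14581)[][E,X 14489][],N (X 14522)[][E,E,X 14334][]]][U1 (X 12361),N (X 14374)[][X 13913,
N (X 14056)[][][E,X 12919],L2 (X 13733)][X 11763,N (X 12122)[][E,X 11914,X 11383][],N (X 11646)[][E,
X 10923][]]]][N (X 14406)[N E[][E,N (X 14365)[][E,X 14326][]][E,L1 (X 13736)]][N (X 14012)[][N E[][E,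
X 13704][X 13280],X 13611][X 12386,N (X 11785)[][X 11287,L2 (X 11037)][]],N (X 13719)[][E,N (X 13414)[][E,
X 13322,X 13193][],L1 (X 13092)][E,N (X 11665)[][X 11042,L2 (X 11123),X 10987][],
X 11223]][N (X 11568)[][N (X 11338)[][E,L2 (X 10576)][]][X 8476,U1 (X 3435)],N (X 10986)[][X 10129,
N (X 10435)[][E,X 10223,X 9783][],X 9882][X 6731,N (X 7282)[][E,X 6976][],
L2 (X 5685)]]][N (X 10656)[U1 (X 9582),N E[][E,X 10472][X 9808,E,X 9442]][N (X 10096)[][N (X 9903)[][E,
X 9493][],N (X 9297)[][E,X 8960][]][X 7627,X 6623],N (X 9351)[][N (X 8955)[][X 8801][],N (X 8856)[][E,E,
X 8415][E,X 7241],N (X 8482)[][E,E,X 8117][]][X 6383,N (X 6327)[][E,X 6064][]]][N (X 6534)[E,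
L2 (X 6295)][N (X 6227)[][X 6138][],X 5183][E,X 1320],N (X 5506)[L2 (X 5386)][X 4475,N (X 4819)[][E,X 4574][],
L1 (X 3630)][X 628,X 1236,X 174]]]"

definition "t3_1 = N E[][N (L0 (L1 (Y 13627)))[][E,N (D0 (L0 (N E[][E,X 15160,X 15160][])))[][][]][],
N (N E[N E[][E,N (X 15245)[][E,X 15171,X 15187][],N (X 15273)[][E,E,X 15208][]][E,N E[][X 13890,E,
N (X 13914)[][E,X 13727][E,E,X 12376]][E,L0 (X 11372)],L2 (L1 (X 13844))]][N E[N E[][E,E,X 14294][X 13997,
X 13852,X 13868]][N (Y 13947)[][X 13835,E,L1 (X 13374)][],L1 (Y 13377),N (X 13677)[][E,
X 13253][]][L0 (N E[][E,X 10846,X 10846][])]][D0 (N E[][E,X 10533,N (X 10544)[][E,E,X 10447][]][]),E,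
D0 (L1 (Y 10475))])[][E,E,N (D0 (L2 (L2 (Y 15132))))[][][]][E,N (L0 (L2 (L2 (Y 13272))))[][][],
N (N E[U2 (L2 (Y 13918))][L0 (L2 (Y 13414))][])[][][]]][N (N E[][L1 (X 13125)][E,L0 (Y 9236)])[][][],
N (N E[N E[][E,N (Y 14306)[][][E,X 14049,X 13994],Y 14326][E,N (X 13653)[][X 13459,X 13451,N (X 13433)[][][E,
E,X 12552]][],N (X 13733)[][E,E,X 13544][]]][N E[][Y 13316,N (Y 13076)[][E,N (X 12878)[][][E,E,X 12024]][E,
X 11583],N (Y 13147)[][E,Y 12853,X 12966][]][Y 11312,Y 10765,Y 10823]][L0 (L0 (Y 9779)),E,
N E[L1 (X 10301)][Y 9267][]])[][E,E,N (L0 (L0 (L2 (Y 13030))))[][][]][E,N (L0 (L2 (U2 (Y 11177))))[][][],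
N (U0 (L0 (L1 (Y 9223))))[][][]]]"

definition "t3_2 = N (X 10343)[N E[][E,X 10305,N (X 10197)[][E,E,X 10108][]][E,E,
L2 (X 8875)]][N (X 9138)[L2 (X 9078)][X 8661,N (X 8793)[][E,X 8631][E,X 7275],X 8358][E,N (X 6286)[][X 5403,
N (X 5897)[][E,E,X 5329][]][],N (X 5659)[][X 4679][]],N (X 9852)[L2 (X 9788)][E,N (X 9672)[][E,X 9635][],
Y 9199][E,N E[][X 6635,L2 (X 7178)][]],N (X 9197)[][E,X 8837,N (X 8746)[][E,E,X 8598][]][E,E,N E[][X 5233,
X 5768][]]][N (Y 5443)[L2 (X 5332)][N (X 4783)[][E,N (X 4151)[][E,E,X 3683][],X 3939][]][],
N (X 6452)[][N (X 5112)[][X 4657,X 4775][],L2 (X 5413),L2 (X 4564)][X 1298,X 2712],N (X 5464)[N E[][E,X 5323,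
X 5409][]][X 4046,L1 (X 4132),L1 (X 4273)][]]"

definition "t3_3 = N E[N E[][N (X 14267)[][][E,X 13847],N (X 14332)[][E,Y 14289][]][X 13589,N E[][E,
N (X 13386)[][E,X 13309][],X 13269][E,X 11745,X 11352]]][N (X 13472)[][N (X 13102)[][E,X 12837][E,
N (X 11420)[][E,X 11120][]],N (X 12952)[][E,N (X 12761)[][E,X 12684,X 12633][],N (X 12654)[][E,E,
X 12525][]][E,L1 (X 11193)]][N (Y 11056)[][N (Y 10880)[][E,X 10645][]][E,X 7260],N (Y 10619)[][N (Y 9832)[][E,
X 9683][],N (X 10138)[][E,X 10028][E,X 8331],N (X 9672)[][E,E,X 9356][]][N (X 6663)[][X 6282][],N E[][X 6207,
E,X 6051][],X 6344]],N (X 13632)[E,U2 (X 13317)][N (X 13078)[][E,X 12864][],N (X 13320)[][X 13003,Y 13227,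
N (X 13061)[][E,E,X 12966][]][E,X 11997,X 11665],N (X 13120)[][E,X 12943,X 12928][]][E,N (X 11222)[][Y 10346,
N (X 11036)[][][E,X 9615],X 10563][X 7301,L1 (X 8283),X 7331],N (X 10733)[][X 9728,E,N (X 10241)[][E,E,
X 10110][E,E,X 8331]][E,L2 (X 5862),L1 (X 6207)]]][N (Y 10194)[][N (Y 9677)[][E,X 9021][E,X 6529]][Y 6358,
X 5429],t3_2]"

definition "t3_4 = N (N E[N E[][E,X 13947][E,N (X 13316)[][E,L1 (X 13141)][]]][N E[][L1 (Y 12703),N E[][E,
X 12516,X 12441][]][],N E[N E[][E,X 13307,X 13295][]][N E[][E,X 12594,X 12513][E,X 11246],N (X 13079)[][E,
X 12997][],N (X 12902)[][E,X 12752,N (X 12736)[][E,E,X 12683][]][]][E,L1 (N (X 10947)[][E,X 10910][])]][E,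
N E[N E[][E,X 10189,X 10086][]][N (Y 9039)[][L1 (X 8464),Y 8738][],N (X 9755)[][E,N (Y 9622)[][E,E,X 9354][],
N (X 9122)[][E,E,X 8891][]][],N (X 9127)[][E,N (X 8802)[][E,X 8665][],Y 8726][]][E,
L1 (X 6180)]])[][N (L1 (N E[][E,L2 (X 12843),L1 (X 12740)][]))[][][],N (N E[U2 (L1 (X 13030))][E,
L0 (L1 (X 12508)),N E[][N E[][E,X 12427,X 12508][],L1 (Y 12592),
L1 (X 12746)][]][])[][][]][N (N E[][L1 (L2 (X 11729))][E,N E[][E,L1 (Y 9280),L2 (Y 8627)][]])[][][],
N (N E[][U2 (L2 (Y 9882)),E,N E[][][E,L1 (Y 10207),L1 (X 10211)]][E,E,L0 (L2 (Y 8597))])[][][]]"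

definition "t3_5 = N E[N E[][E,E,N (X 13677)[][][E,X 13354,X 13436]][E,N (X 13076)[][X 12839][X 11393],
N (X 13147)[][X 12884,E,X 13001][N (X 11324)[][][X 8800]]]][N E[][X 12687,E,N (X 12597)[][E,Y 12337,
X 12451][E,X 10923]][N (Y 10840)[][X 10694][X 8296],N E[U2 (X 10086)][N (Y 9729)[][E,E,X 9356][]][],
L2 (L1 (Y 9683))],N E[][E,L2 (Y 12613)][E,N (Y 10940)[][E,Y 10856,Y 10348][]],N E[E,U2 (X 12975)][E,
N (X 12707)[][X 12440,X 12529,X 12573][E,X 11244,N (X 11212)[][E,X 10774,X 11011][]],N (X 12902)[][X 12686,
X 12712,X 12831][E,X 11387,N (X 11877)[][E,E,X 11828][]]][E,N (X 10558)[][X 9682,E,N (X 9891)[][E,X 9694,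
X 9690][E,E,X 7814]][E,L0 (X 6018)],N E[][Y 10298,E,N (X 10882)[][E,Y 10620,X 10854][]][E,E,
X 8379]]][N E[N E[][E,Y 9944,X 9947][E,X 9276,X 9306]][N (Y 9526)[][Y 9414,Y 8937,N (Y 8967)[][E,
Y 8626][]][X 7507]][L0 (X 6092)],N E[N E[][E,E,Y 10002][E,X 9499]][N (Y 8990)[][E,X 8697][],E,X 9083][E,
Y 6387],N E[N E[][E,X 10050,X 10144][X 9329,X 9138,N (X 9528)[][E,E,X 9389][]]][N (X 9053)[][E,E,
N (X 8744)[][E,X 8306][]][],L1 (N (X 8673)[][E,E,X 8489][E,E,X 7087]),N (Y 9725)[][E,N (Y 9108)[][E,E,
X 8968][],Y 9591][E,E,X 7546]][E,E,N E[][E,X 5117,X 6180][]]]"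

definition "t3_6 = N (N E[U1 (X 11312)][N E[][E,N (X 10840)[][][E,E,X 10182]][E,N (Y 9494)[][E,Y 9296,
X 9057][]],N E[][N E[][E,X 10913,X 10921][E,E,X 10195],Y 11097,N (X 11048)[][E,E,X 10992][]][X 9656,N E[][E,
Y 9926][E,Y 8138],N E[][E,X 9322,X 9437][]]][E,N E[L2 (X 9021)][N (X 8244)[][E,X 8066,X 7828][],
N (Y 8804)[][E,E,Y 8474][],N (X 8378)[][E,Y 8232,N (X 8123)[][E,E,X 8082][]][]][Y 5257,N (Y 6096)[][E,
N (X 5904)[][E,X 5843][],Y 5076][],N (X 5276)[][E,E,X 4732][]]])[][N (U1 (L1 (L1 (Y 8658))))[][][],N (N E[][E,
N E[][N E[][E,X 10169,X 10169][]][E,E,L1 (X 9123)],U2 (N E[][E,X 9347,Y 9597][])][])[][][]][]"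

definition "t3_7 = N E[N E[][][E,N (X 10765)[][][E,E,X 10289],N (X 10823)[][][X 10220,E,
X 10344]]][N E[][N (X 10497)[][][E,E,X 10112],X 10419,N (X 10476)[][E,X 10436][E,X 9812,X 9997]][X 9494,
N (X 9305)[][E,E,X 8972][],N (X 9402)[][X 8966,X 8937,N (X 9159)[][E,X 8977][]][E,E,X 7150]],E,N E[][E,
N (Y 10558)[][][E,X 9996,X 10010],N (Y 10660)[][][E,E,X 10438]][E,N (X 9356)[][X 8826,X 9091,N (X 8985)[][][E,
E,X 7936]][],N E[][E,E,Y 9627][E,E,X 8008]]][N E[U2 (X 8459)][N (Y 8427)[][E,Y 8226,N (X 8177)[][][E,E,
X 7212]][]][Y 5986,E,Y 5188],N E[U2 (Y 8426)][N (Y 8003)[][E,E,Y 7634][],E,Y 8120][Y 5062],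
N E[U1 (X 8480)][N (X 8160)[][X 7912,X 7759,X 7984][E,E,X 6166],N (X 8194)[][E,X 7929][E,X 6270],
N (Y 8621)[][E,Y 8307][E,N (X 6437)[][E,E,X 5894][],Y 7269]][N (Y 5198)[][Y 4697][],N (X 5191)[][E,Y 4648][],
N (Y 6069)[][Y 5026,Y 5009,N (Y 5867)[][E,E,X 5839][]][]]]"

definition "t3_8 = N (X 10343)[][N (X 10084)[][E,E,X 9993][X 9257,X 9433,N (X 9267)[][E,E,X 9050][]],
N (Y 10219)[][X 10102,E,X 10158][E,X 9664,N (X 9503)[][E,E,X 9355][]],N (X 10173)[][X 10049,X 10119,
X 10099][E,X 9431,N (X 9434)[][E,E,X 9355][]]][N (X 8702)[][X 8424][X 6652,E,X 5843],
N (X 9077)[][N (X 8656)[][E,E,X 8464][E,E,X 7288],N (X 8987)[][][E,X 8720],N (X 8717)[][E,X 8638][E,E,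
X 7480]][X 6518,N (X 7393)[][X 6710,X 7473,X 6792][],N (X 6615)[][E,X 6065,X 6267][]],
N (X 8874)[][N (X 8310)[][][E,X 6621],X 8516,N (X 8611)[][E,X 8451,X 8528][E,E,
X 7603]][N (X 5836)[][X 5426][],N (X 6113)[][E,X 5875][],N (X 6577)[][X 5738,X 5845,X 6410][]]]"

definition "t3_9 = N (X 8524)[N E[][E,X 8501,X 8465][X 7921,X 8122,X 7942]][N (X 7728)[][N (X 7450)[][E,E,
X 7263][X 6538],X 7510,N (X 7308)[][E,X 7204][]][X 5680,N (X 5686)[][X 5093,X 5474][],N (X 5231)[][E,E,
N (X 4850)[][E,X 4556][]][]],N (Y 8192)[][E,N (X 8105)[][E,E,X 8031][E,E,X 7221]][E,N (X 6702)[][X 6106,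
X 6711,X 6163][E,X 4761]],N (X 7830)[][E,X 7632,N (X 7573)[][E,E,X 7491][]][E,N E[][E,X 5559,X 5184][],
N (X 5807)[][X 5089,E,N (X 5640)[][E,X 5432][]][E,E,X 3123]]][N (X 4870)[L1 (X 4804)][N (X 4330)[][X 4203,
X 3898,N (X 3777)[][E,X 3492][]][]][X 1179],N (X 5675)[L2 (X 5570)][X 4668,N (Y 5472)[][E,X 5482][E,X 4041],
L1 (X 4456)][N (X 1262)[][X 551][],N (X 2516)[][X 1300,X 2384,X 1300][],L2 (X 551)],
N (X 4964)[U1 (X 4283)][N (X 3792)[][E,X 3249][],N (X 4140)[][E,X 3909][],N (X 4434)[][E,X 4001,X 4284][]][E,
E,N (X 1207)[][E,X 3][]]]"

definition "t3_10 = N E[N E[][E,X 10635][E,N (X 10358)[][E,X 10275,X 10276][X 9466,N (X 9622)[][E,E,X 9419][],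
N (X 9450)[][E,E,X 9239][]]],N E[][X 10629,E,N (X 10642)[][][E,X 10536,X 10534]][X 10330,
N (X 10393)[][X 10274][X 9606],N (X 10419)[][X 10295,E,X 10345][N (X 9379)[][][X 8005],X 9770,
X 9654]]][N (X 10194)[][U1 (X 9438),N (X 10003)[][E,X 9920][E,N E[][E,X 9299,X 9096][E,X 8402],
L2 (X 8929)]][E,N (X 8696)[][X 8247,N (X 8463)[][E,E,X 8280][],N (X 8245)[][E,X 8153][]][X 6208,
N (X 6439)[][E,E,X 5799][],X 5897]],t3_8][N E[][X 8268][E,N (X 4841)[][X 4128][]],t3_9]"

definition "t3_11 = N E[E,N E[][][E,U2 (X 8956),N E[][][X 8678,E,X 8883]]][E,N E[][U2 (X 8538),
N (X 9039)[][][E,E,X 8759],N (X 9053)[][][E,X 8637,X 8669]][L0 (X 7772),N (Y 8244)[][X 7962,E,X 8083][],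
N (Y 8160)[][X 7773,E,Y 7981][E,E,N (X 6349)[][E,E,X 6182][]]],N E[][E,E,N (Y 9127)[][][E,X 8736,X 8912]][E,
L0 (X 7807),N (Y 8378)[][X 8093,E,Y 8305][X 6429,E,X 7058]]][E,N E[N E[][][E,X 7517,
X 7376]][N (X 7157)[][X 6925,E,X 6871][],U1 (Y 6404),N E[][E,Y 7100,X 7075][E,X 5654,Y 5637]][X 4622,
N (Y 5346)[][Y 4447,Y 5202,Y 4541][],N (X 4740)[][E,Y 4031][]],N E[][Y 7254,E,N (Y 7597)[][E,Y 7386][E,X 5881,
L2 (X 6500)]][E,E,N E[][E,X 4683,N (Y 5283)[][E,X 4955,X 5274][]][]]]"

definition "t3_12 = N E[][U2 (N (X 5188)[][][E,E,X 4678]),N E[][][U2 (X 4313),E,N (X 5198)[][][X 4188,E,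
X 4589]],N E[][][X 5140,N (Y 5191)[][][X 4220],N (Y 5276)[][][X 4528,X 4666]]][U2 (X 4123),
N E[][N (Y 4622)[][][E,E,X 3914],E,N (X 4714)[][][E,X 4200,X 4165]][X 3261,X 3687,N (X 3360)[][X 2726,E,
X 3126][]],N E[][N (Y 4740)[][][X 4354,X 4231,X 4292],N (X 4777)[][][E,X 4472],N (Y 4866)[][][E,
X 4291]][N (Y 3360)[][X 3123][Y 1062],N (X 3561)[][X 2912][],N (X 3788)[][X 3344,X 3400][X 1085,E,X 1984]]]"

definition "t3_13 = N t3_10[][N (N E[N E[][E,X 10084][E,N E[][E,X 9876,X 9847][E,X 9536]]][N E[][L1 (X 9524),
N E[][E,X 9526,X 9497][]][E,N E[][E,X 8209,X 8024][]],N E[][E,N (Y 9755)[][E,E,X 9726][E,E,X 9237],X 9725][E,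
N (X 8804)[][E,X 8719,X 8506][E,E,X 6560],N E[][E,X 8295,X 8386][]]][E,N E[][N E[][E,X 7307,X 7125][],
N (X 7939)[][E,Y 7857][],N (X 7597)[][E,E,X 7387][]][E,N E[][E,N (X 5387)[][E,X 5355,X 5015][],X 4743][],
L1 (L2 (X 3961))]])[][N (U1 (N E[][L1 (X 7263),L1 (X 7801)][]))[][][],N (N E[][E,E,N E[][][E,N E[][E,X 8150,
X 8072][],L1 (X 8259)]][E,E,N E[][E,L2 (X 7286),L2 (Y 7633)][]])[][][]][N (U1 (L2 (L2 (X 6460))))[][][],
N (U2 (U2 (L2 (Y 4875))))[][][]],N t3_11[][N (N E[][E,U2 (L1 (Y 7838)),U2 (L2 (X 8189))][E,E,
N E[][L2 (X 7002),E,L2 (Y 7389)][]])[][][],N (U2 (L0 (L0 (X 6916))))[][][]][N (N E[][][E,L2 (U2 (Y 5141)),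
U2 (L2 (Y 4684))])[][][]]][N (N E[][N E[][E,X 6339][E,N E[][E,X 5986,X 5947][E,X 5604]],N E[][E,E,X 6443][E,
N (X 6096)[][][E,X 5722,X 5228],N (X 6069)[][E,X 6025,X 5993][E,X 4948,X 5185]]][U1 (Y 4157),N E[][N E[][E,E,
X 5346][E,E,Y 4503],N (Y 5541)[][][E,E,L2 (X 4770)],N (X 5440)[][E,E,X 5364][E,L1 (X 4648),N E[][E,X 4654,
X 4654][]]][Y 3687,N (X 4278)[][X 3721,E,Y 3766][E,X 2228],N (Y 3788)[][X 3207,X 3334,N (Y 3541)[][E,
X 3355][]][]]])[][N (U1 (N E[][E,E,L2 (X 5207)][E,L2 (Y 3805)]))[][][],N (U1 (U2 (L2 (Y 3195))))[][][]][],
N t3_12[][][]]"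

definition "t3 = N t3_0[t3_1][N t3_3[U1 (N (D0 (U1 (L1 (Y 13272))))[][][]),
L2 (N (L1 (D1 (L2 (X 13587))))[][][])][t3_4,N t3_5[][N (N E[][E,E,L1 (L2 (X 12527))][E,
L1 (L1 (Y 9469))])[][][],E,N (N E[U2 (L2 (X 12742))][N E[][L2 (Y 12335),E,L1 (X 12230)][]][E,
L1 (L1 (Y 9469))])[][][]][N (N E[][E,E,U1 (L2 (Y 9672))][E,E,L2 (L2 (Y 9136))])[][][],
N (N E[][L2 (L2 (Y 11349))][E,E,N E[][L0 (Y 8546),E,L2 (Y 9105)][]])[][][]]][t3_6,
N t3_7[][N (L0 (U2 (L2 (Y 8823))))[][][],
N (U0 (L0 (L2 (Y 8049))))[][][]][N (U2 (U2 (L1 (Y 4552))))[][][]]]][t3_13]"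

lemmas [compute] =
  arg_cong[OF t3_0_def, of descend] arg_cong[OF t3_1_def, of descend] arg_cong[OF t3_2_def, of descend]
  arg_cong[OF t3_3_def, of descend] arg_cong[OF t3_4_def, of descend] arg_cong[OF t3_5_def, of descend]
  arg_cong[OF t3_6_def, of descend] arg_cong[OF t3_7_def, of descend] arg_cong[OF t3_8_def, of descend]
  arg_cong[OF t3_9_def, of descend] arg_cong[OF t3_10_def, of descend] arg_cong[OF t3_11_def, of descend]
  arg_cong[OF t3_12_def, of descend] arg_cong[OF t3_13_def, of descend] arg_cong[OF t3_def, of descend]

definition "p3 S T = search t3 (tidy (S, T))"

definition "c3 = pays p3 6295 3 23349"

lemma [compute]:
  "p3 S T = search t3 (tidy (S, T))"
  "c3 v m S T =
    (total p3 6295 S T m + (3 - m) * after p3 6295 S T m \<le> 3 * v + 23349)"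
  "3 - 0 = (3::nat)" "3 - Suc 0 = (2::nat)" "3 - Suc (Suc 0) = (1::nat)" "3 - Suc (Suc (Suc 0)) = (0::nat)"
  by (simp_all add: c3_def p3_def pays_def)

lemma t3_0[compute]: "below (leaf_ok c3 []) 0 [] t3_0"
  unfolding t3_0_def by (simp only: compute cong: lazy_cong)

lemma t3_1[compute]: "below (right_ok c3) (Suc 0) [(0, Down)] t3_1"
  unfolding t3_1_def by (simp only: compute cong: lazy_cong)

lemma t3_2[compute]: "below (leaf_ok c3 [(0, Level)]) (Suc (Suc 0)) [(Suc 0, Up)] t3_2"
  unfolding t3_2_def by (simp only: compute cong: lazy_cong)

lemma t3_3[compute]: "below (leaf_ok c3 [(0, Level)]) (Suc 0) [] t3_3"
  unfolding t3_3_def by (simp only: compute cong: lazy_cong)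

lemma t3_4[compute]: "below (right_ok c3) (Suc 0) [(0, Level), (0, Level)] t3_4"
  unfolding t3_4_def by (simp only: compute cong: lazy_cong)

lemma t3_5[compute]: "below (leaf_ok c3 [(0, Level), (Suc 0, Level)]) (Suc (Suc 0)) [] t3_5"
  unfolding t3_5_def by (simp only: compute cong: lazy_cong)

lemma t3_6[compute]: "below (right_ok c3) (Suc 0) [(0, Level), (0, Up)] t3_6"
  unfolding t3_6_def by (simp only: compute cong: lazy_cong)

lemma t3_7[compute]: "below (leaf_ok c3 [(0, Level), (Suc 0, Up)]) (Suc (Suc 0)) [] t3_7"
  unfolding t3_7_def by (simp only: compute cong: lazy_cong)

lemma t3_8[compute]: "below (leaf_ok c3 [(0, Up)]) (Suc (Suc 0)) [(Suc 0, Level)] t3_8"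
  unfolding t3_8_def by (simp only: compute cong: lazy_cong)

lemma t3_9[compute]: "below (leaf_ok c3 [(0, Up)]) (Suc (Suc 0)) [(Suc 0, Up)] t3_9"
  unfolding t3_9_def by (simp only: compute cong: lazy_cong)

lemma t3_10[compute]: "below (leaf_ok c3 [(0, Up)]) (Suc 0) [] t3_10"
  unfolding t3_10_def by (simp only: compute cong: lazy_cong)

lemma t3_11[compute]: "below (leaf_ok c3 [(0, Up), (Suc 0, Level)]) (Suc (Suc 0)) [] t3_11"
  unfolding t3_11_def by (simp only: compute cong: lazy_cong)

lemma t3_12[compute]: "below (leaf_ok c3 [(0, Up), (Suc 0, Up)]) (Suc (Suc 0)) [] t3_12"
  unfolding t3_12_def by (simp only: compute cong: lazy_cong)

lemma t3_13[compute]: "below (right_ok c3) (Suc 0) [(0, Up)] t3_13"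
  unfolding t3_13_def by (simp only: compute cong: lazy_cong)

lemma t3[compute]: "below (right_ok c3) 0 [] t3"
  unfolding t3_def by (simp only: compute cong: lazy_cong)

lemma bound3: "\<alpha> 3 \<le> 0.47276"
  by (rule edit_constant_le[OF p3_def c3_def _ t3, where R = 1488])
    (simp_all only: compute trie.distinct, simp_all)

section \<open>Certificate for 4 letters\<close>

definition "t4_0 = N (X 6616)[U1 (N E[][E,X 6407,X 6384][E,X 6059])][N (X 6490)[][U1 (X 6070),
N (X 6359)[][][E,X 6004,X 5895]][X 5864,N (X 5613)[][E,X 5521][X 4368,X 4522]],N (X 6361)[][E,N E[][E,X 6252,
X 6212][E,E,X 5780],N E[][E,X 6161,X 6167][X 5750,X 5720,X 5733,X 5634]][E,N (X 5553)[][E,E,X 5336][],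
N E[][X 5190,X 5160,X 5256,X 5113][]]][N (X 5408)[U1 (X 5270)][N E[][E,X 5231][E,X 4364]][X 4115,L0 (X 3291)],
N (X 5147)[][N (X 4853)[][E,X 4787][X 3954,X 3909],N (X 4980)[][E,X 4947,X 4780][],N (X 4751)[][E,X 4653,
X 4643,X 4529][]][N (X 3330)[][X 3207][],N (X 3568)[][X 3178,X 3501,X 3124][],N (X 3163)[][E,X 2830,
X 2961][]]]"

definition "t4_1 = N (X 4861)[N E[][E,L2 (X 4809)][E,X 4489],N E[][E,E,X 4808][X 4558,E,
X 4374]][N (X 4679)[][L1 (X 4515),N (X 4401)[][E,X 4325,X 4244][]][X 3656,N E[][X 2977,X 3036][]],
N (X 4361)[][N (X 4237)[][E,E,X 4080][],X 4209,N (X 4054)[][X 3989,E,X 3964,X 3880][]][N (X 3133)[][X 2987,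
X 2831][],E,N (X 2823)[][E,X 2507,X 2642][]]][N (X 3026)[][E,N E[][X 2395,X 2349][]][L0 (X 1343)],
N (X 2573)[E,N E[][][X 2276,E,X 2170]][N E[][X 2128,X 2120][],N (X 2411)[][X 2151,X 2302,X 2045][],N E[][E,
X 1892,X 1865][]][X 430,N (X 693)[][E,X 616][]]]"

definition "t4_2 = N E[][E,N (N E[N E[][E,N (X 6966)[][E,E,X 6948][],N (X 6969)[][E,E,X 6950,X 6952][]][E,
N (Y 6598)[][][X 5621,X 5747,X 5559],N E[][][X 5621,E,X 5747,X 5559]]][N E[N E[][][E,X 6434,
X 6444]][L0 (X 6441),L1 (Y 6267),N (Y 6344)[][E,Y 6208,Y 6283,Y 6211][E,E,E,X 5378]][]][D0 (N E[][E,X 4829,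
X 4832][]),E,D0 (L2 (X 4852))])[][][]][N (L0 (L1 (Y 6147)))[][][],N (N E[N E[][E,N (X 6598)[][][E,E,X 6486],
N (X 6604)[][][E,E,X 6541,X 6495]][E,N (X 6361)[][E,E,X 6268][X 5598,E,Y 5574],N (X 6364)[][X 6287,E,X 6313,
X 6274][X 5598,E,X 5741,Y 5573]]][N E[][E,N (X 6114)[][E,X 6063][],N (Y 6122)[][E,X 6021,X 6078,X 6040][E,
Y 5349,Y 5513,Y 5357]][U2 (X 3603),E,N (Y 5073)[][E,E,Y 4953][]]][N E[][N E[][][E,X 3196,X 3196]][E,E,
L0 (X 2246)],E,N E[N E[][E,X 4736,E,X 4740][]][Y 4312][E,E,L0 (X 2547),L0 (X 2069)]])[][][]]"

definition "t4_3 = N (X 6291)[L2 (X 6278),U2 (X 6184),N E[][][E,X 6208,E,X 6164]][N E[][E,X 6002,X 5962][E,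
N E[][E,X 5452,X 5293][],X 5415],N (X 6188)[][E,X 6168,X 6102][E,N (X 5697)[][E,E,X 5557][E,E,X 4685],
N (X 5473)[][E,X 5352,X 5406,X 5299][]],N (X 6092)[][E,X 6036,X 6034,X 5992][U0 (X 4136),N (X 5407)[][E,
X 5343,X 5254,X 5201][E,E,X 4123],N (X 5439)[][E,X 5310][E,X 4308],N (Y 5294)[][][E,E,X 3914]]][E,
N (X 5249)[][N (X 4943)[][E,X 4889,X 4783][E,X 4123],N (X 5226)[][E,E,X 5105][],N (X 4950)[][E,X 4887,X 4883,
X 4793][E,X 4123]][E,L2 (X 3703),L2 (X 3438)],N (X 5028)[][N (X 4668)[][E,X 4523][E,E,X 3679],L1 (X 4724),
N (X 4877)[][E,X 4756][E,X 3879,E,X 3795],N E[][E,X 4552][E,E,X 3679,X 3697]][]]"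

definition "t4_4 = N (X 4727)[N E[][E,X 4719,X 4684][E,N (X 4455)[][E,X 4424,X 4324][E,X 3824,X 3458],
N (X 4295)[][E,X 4236,X 4215][E,X 3500,X 3482,X 3264]]][N (X 4259)[][N (X 4126)[][E,X 4071,X 3997][E,X 3494,
X 3295],N (X 4144)[][E,X 4112][E,X 3567,X 3216],N (X 3983)[][E,X 3925,X 3903,X 3831][E,X 3261,X 3221,
X 3079]][X 3067,X 3067,X 2798],N (X 4569)[][E,N E[][E,E,X 4432][E,E,X 3792],N E[][E,X 4285,X 4259,
X 4193][X 3396,X 3686,X 3590,X 3396]][E,L2 (X 3295),N E[][X 2801,E,E,X 2801][]],N (X 4283)[][E,N E[][E,X 4148,
X 4135][E,X 3567,X 3396,X 3216],N E[][E,X 4094,X 4122,X 4017][E,X 3494,E,X 3295],N E[][E,E,X 3958][X 3079,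
X 3261,X 3216,X 3221]][E,L3 (X 2737),N (X 3085)[][E,X 2842,E,X 2748][],N E[][X 2372,
X 2522][]]][N (Y 2540)[][X 2341][E,E,X 217],N (X 2989)[N E[][E,X 2983,X 2932][]][X 2482,N E[][E,Y 2936,
X 2671][],N (X 2491)[][E,E,E,X 2164][]][X 728,X 1334],N (X 2551)[N E[][E,X 2517,E,X 2489][]][X 2016,
N (X 2204)[][E,E,E,X 1918][],X 2357,N (X 2020)[][E,X 1799][]][X 217]]"

definition "t4_5 = N E[N E[][N (X 6575)[][][E,X 6453],N (X 6590)[][][E,X 6425,X 6422]][E,N E[][E,X 6232,
X 6189][E,N (Y 5629)[][][E,E,X 4327],N (X 5436)[][][E,X 4045,X 4229]]]][N (X 6234)[][N (X 6117)[][E,X 6028][E,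
Y 5456],N (X 6034)[][E,X 5977,X 5934][E,N E[][][X 4308,E,X 4170],N E[][][E,X 3914,X 4136]]][N (Y 5183)[][][E,
X 3603],N (Y 4986)[][X 4728,N (X 4845)[][E,X 4827,X 4692][E,E,X 3795],N (X 4643)[][E,X 4565,X 4558,X 4469][E,
X 3679,X 3697]][E,X 3536]],t4_3][N (Y 4674)[U1 (U2 (X 3559))][N (X 4515)[][E,N (Y 4285)[][][E,X 3590,
X 3396]][E,X 3173]][E,N (X 2543)[][X 2193][]],t4_4]"

definition "t4_6 = N E[N E[][E,E,X 6344][E,N (Y 6114)[][][X 5410],N (X 6122)[][X 6041,X 6030,X 6072][X 5411,E,
Y 5556]]][N E[][N (X 5952)[][E,E,X 5888][X 5545,E,Y 5404],E,N (X 5890)[][E,X 5798,X 5841][E,Y 5216,Y 5358,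
Y 5224]][E,E,L2 (Y 4816)],N E[][E,Y 5983][E,N E[][E,E,Y 4903][X 3603,E,X 3583]],N E[E,N E[][][E,E,X 6025,
X 5997]][E,N (X 5923)[][E,X 5872,X 5877,X 5849][Y 5219,Y 5353,Y 5351,Y 5240],N (X 6019)[][E,E,X 6001,
X 5956][E,Y 5425,X 5592,Y 5443],N (X 5949)[][E,E,X 5906,X 5901][E,Y 5236,Y 5361,Y 5387]][E,
N (X 4953)[][Y 4633,Y 4829,Y 4721,Y 4653][],N (X 5172)[][X 4922,E,X 5142,Y 4922][X 3603,E,X 4027,X 3583],
N E[][E,E,Y 4748,Y 4853][]]][N E[N E[][][E,Y 4389,Y 4350]][L2 (Y 4252)][L0 (Y 2908)],N E[L2 (Y 4607)][Y 4198,
E,N (Y 4224)[][E,Y 4130][]][],N E[][N (X 4219)[][E,E,Y 4127][],L1 (Y 4117),N (Y 4514)[][E,Y 4287,Y 4488,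
Y 4301][E,E,X 3603,X 3187],N (X 4246)[][E,Y 3995,Y 4154,Y 4138][E,E,X 3081]][E,E,L2 (X 2925)]]"

definition "t4_7 = N E[U2 (N (X 5073)[][][E,E,X 4913,X 4836])][N E[][L2 (X 4947),X 4912,N (X 4924)[][][E,
X 4673,X 4765,X 4688]][Y 4525,L2 (X 4368),N (X 4419)[][E,X 4260,X 4352,X 4266][E,E,Y 3473]],E,N E[][E,
N (Y 4953)[][][E,X 4778,X 4734,X 4674],E,N (X 4972)[][][E,E,X 4757,X 4749]][E,N (X 4405)[][X 4209,X 4332,E,
X 4239][E,E,Y 3204],N E[][E,E,X 4606,X 4440][Y 3452,E,X 3821,Y 3468],N (X 4435)[][X 4242,E,X 4301,X 4364][E,E,
Y 3262,Y 3439]]][N E[][L2 (X 3930)][N (Y 2825)[][][E,E,X 728]],N E[][N (X 3774)[][E,E,X 3707][],E,Y 3806][E,E,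
Y 2409],N E[N E[][][E,X 3925,X 4022,X 3937]][N (X 3817)[][X 3737,X 3663,X 3760,X 3676][Y 2971,E,Y 2981],
N (X 3825)[][E,X 3752][E,Y 2973],N (Y 4013)[][E,X 3904,E,X 3916][E,Y 3076,X 3418,Y 3095],N (X 3847)[][E,
X 3696,X 3792,X 3776][E,E,Y 3003,Y 3007]][Y 2432,N (Y 2432)[][E,Y 2257][],N (Y 2808)[][Y 2419,Y 2414,X 2773,
Y 2428][],N (Y 2453)[][E,E,Y 2155,Y 2300][]]]"

definition "t4_8 = N t4_5[][N (N E[L1 (Y 6470)][L1 (N E[][E,Y 5904,X 5863][]),N E[][N E[][E,X 5932,X 5892][E,
X 5411],N (X 6110)[][E,E,X 6032][],N (Y 6019)[][E,E,X 5975][]][E,N E[][E,X 5182][E,E,X 3583],N E[][E,X 4767,E,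
Y 4710][]]][E,N E[L2 (X 4646)][E,N (Y 4538)[][E,Y 4509,Y 4307][],N (X 4256)[][E,Y 4160,Y 4142,Y 4005][]][E,
L1 (X 2925)]])[][][],N t4_6[][][]][N (N E[U1 (L2 (X 5293))][N E[][E,N (X 5110)[][E,E,X 5086][]][E,
N (X 4525)[][E,E,X 4381][]],N E[][N E[][E,E,X 5123][E,E,X 4904],U2 (Y 5009),N (X 5172)[][][E,X 4892,X 4889,
X 4826]][E,N E[][E,Y 4695,X 4559][E,E,Y 3518],N E[][E,X 4402,X 4470,X 4354][]]][E,
N E[U2 (X 4027)][N (X 3872)[][E,E,X 3728][],N (Y 4109)[][E,E,X 3997][],N (X 3913)[][E,X 3862,X 3833,
X 3753][]][E,N (Y 2860)[][E,X 2846][],N (Y 2473)[][E,E,Y 2320][]]])[][][],N t4_7[][][]]"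

definition "t4_9 = N (X 4727)[][N (X 4631)[][E,E,X 4601][X 4371,E,N (X 4387)[][][E,E,X 3967]],N (X 4686)[][E,
E,X 4667][X 4393,X 4500,X 4426],N (X 4659)[][E,X 4640,X 4636,X 4634][E,N (X 4386)[][][E,E,X 3785],
N (X 4392)[][][X 3756,E,E,X 3786],N (X 4332)[][][E,E,X 3617,X 3754]]][N (X 4042)[][][Y 3264,E,X 2957],
N (X 4201)[][X 4051,E,N (X 4075)[][][E,X 3704,X 3694]][X 3262,N (X 3494)[][E,E,X 3300][E,E,X 2154],
N (X 3202)[][E,X 3013,X 3105][E,X 1629,X 1859]],N (X 4096)[][N (X 3908)[][][X 3340,E,X 3388],N (X 3970)[][][E,
X 3607],N (X 4026)[][][E,X 3508,E,X 3466],N (X 3944)[][E,E,E,X 3888][E,E,X 3407,X 3399]][X 2856,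
N (X 2999)[][E,X 2911,X 2804][E,X 1669,X 1352],N (X 3158)[][X 2905,X 2938,E,X 2906][E,X 1488],N (X 2882)[][E,
E,X 2663,X 2773][]]]"

definition "t4_10 = N (X 3866)[N E[][][E,N (X 3763)[][][E,E,X 3271],N (X 3654)[][][E,E,X 3191,
X 3075]]][N (X 3560)[][N (X 3478)[][][E,E,X 3088],E,N (X 3423)[][][E,X 3005,X 2972,X 2855]][X 2775,
N (Y 2772)[][][E,X 1567],N (X 2551)[][E,E,X 2447][E,E,X 1199]],N (Y 3763)[][E,U2 (X 3563)][E,N (X 3213)[][E,
X 3213,X 3017][X 1877,E,X 1877],N E[][E,X 2739][E,X 1529,X 1665]],N (X 3595)[][E,N (X 3535)[][][X 2983,X 3201,
X 3113,X 3000],N (X 3525)[][E,E,E,X 3470][E,X 3163,E,X 3036],N (X 3461)[][][E,X 3029,X 2974,X 2989]][E,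
N (X 2768)[][X 2500,X 2713,X 2573,X 2508][E,X 1567,X 1353],N (X 2779)[][E,X 2636,X 2756,X 2548][X 1232,X 1403,
E,X 1232],N (X 2573)[][E,E,X 2354,X 2464][E,E,X 954]]][N (X 2259)[U2 (X 2015)][N (X 2108)[][E,E,
X 1913][]][X 643,E,X 217],N (X 2605)[][N (X 2238)[][E,X 2173][X 1206,X 1270],N (X 2588)[][E,E,X 2439][E,E,
X 1494],N (X 2251)[][E,X 2187,X 2154][E,X 1270,X 1206]][X 690,N (X 1239)[][X 810,E,X 810][],N (X 712)[][E,
X 379,X 518][]],N (X 2288)[][N (X 1857)[][E,E,X 1767][X 748,E,X 721],N (X 1999)[][E,X 1944][E,X 1091,X 1021],
N (X 2126)[][E,X 1984,X 2100,X 1933][E,X 991,E,X 872],N (X 1872)[][E,X 1702,X 1781,X 1763][E,E,E,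
X 748]][X 217,N (X 418)[][E,X 311,X 112][],N (X 662)[][X 149,X 237,E,X 149][],N (X 217)[][E,E,E,X 3][]]]"

definition "t4_11 = N E[E,U2 (N (X 4312)[][][E,E,X 4166,X 4140])][E,N E[][U2 (X 4118),N (X 4228)[][][E,E,
X 4107],N (X 4219)[][][E,X 4095,X 4073,X 4047]][Y 3774,Y 3872,N (Y 3817)[][X 3683,E,X 3785,X 3725][]],N E[][E,
X 4232,Y 4256,Y 4246][E,N (Y 3825)[][][E,E,Y 2929],N (Y 3913)[][X 3805,X 3817,E,X 3833][E,E,X 3354,Y 3138],
N (Y 3847)[][X 3714,X 3725,X 3764,X 3804][E,E,Y 2939,X 3108]]][E,N E[U2 (X 3449)][N (X 3332)[][E,E,X 3226][],
E,N E[][E,X 3330,X 3321,X 3270][E,Y 2694,Y 2711]][E,E,N (X 2197)[][E,E,Y 2062][]],N E[][N (X 3364)[][E,E,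
X 3313][E,E,Y 2700],E,N (Y 3523)[][E,X 3447,E,X 3449][E,Y 2808,X 3036,Y 2819],N (X 3405)[][E,X 3293,E,
X 3350][E,E,Y 2731]][E,E,N (X 2506)[][E,E,X 2475,Y 2213][],L3 (Y 2098)]]"

definition "t4_12 = N E[][U2 (N (X 2461)[][][E,E,E,X 2286]),U2 (N (X 2432)[][][X 2045,E,X 2229,X 2133]),
N E[][][E,N (X 2432)[][][E,E,E,X 2232],N (X 2473)[][][X 2175,E,E,X 2249],N (X 2453)[][][X 2053,E,X 2180,
X 2212]]][E,N E[][U2 (X 1998),E,N (X 2195)[][][E,E,X 1949,X 1874]][X 1598,E,N (Y 1567)[][X 1334,E,E,
X 1405][]],N E[][N (Y 2197)[][][E,E,X 2063,X 1937],Y 2210,N (Y 2259)[][][E,X 2024,E,X 2044],N (X 2223)[][][E,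
X 1910,E,X 1993]][X 1567,X 1697,N (Y 1755)[][X 1604,E,E,X 1635][E,E,X 978,Y 601],N (X 1613)[][X 1391,X 1424,
X 1463,X 1539][E,E,Y 317,Y 534]]]"

definition "t4_13 = N (N E[N E[][E,X 4853][E,N (X 4748)[][E,E,X 4721][E,X 4547,X 4446]],N E[][E,E,X 4856][E,
N (X 4768)[][][E,E,X 4518],N (X 4766)[][X 4723,E,X 4743,X 4742][X 4392,E,N (X 4498)[][][E,E,E,X 3931],
N (X 4437)[][][E,E,X 3738,X 3874]]]][N (X 4674)[][E,N (X 4604)[][E,E,X 4577][E,N (X 4385)[][][E,E,X 3891],
X 4305]][E,N (X 4044)[][E,X 3977,X 3881][E,X 3209,N (X 2876)[][E,E,X 2778][]]],t4_9][N E[][L1 (Y 3778)][E,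
X 2281],t4_10])[][N (N E[U1 (N E[][E,X 4600,X 4600][])][N E[][E,N E[][E,Y 4457,Y 4457][]][E,L2 (Y 3896)],
N E[][E,N (X 4538)[][][E,E,X 4338],N (X 4514)[][][E,X 4289,X 4315,X 4249]][E,N (X 4109)[][E,E,X 3995][],
N E[][E,X 3897,X 3952,X 3873][]]][E,N E[][E,N (X 3676)[][E,E,X 3574][E,E,Y 2901],N (X 3523)[][E,X 3468,X 3463,
X 3401][]][E,L1 (X 2537)]])[][][],N t4_11[][][]][N (N E[][N E[][E,X 2953][E,L2 (X 2825)],N E[][E,E,X 2981][E,
N (X 2860)[][][E,E,X 2552],N (X 2808)[][E,E,E,X 2776][E,X 2442,X 2462,X 2356]]][E,N E[][E,N (Y 2574)[][][E,E,
X 2328],N (Y 2506)[][][E,X 2217,X 2192,X 2117]][X 1804,N (X 1973)[][E,E,X 1799][],N (X 1755)[][X 1535,X 1594,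
X 1672,X 1531][]]])[][][],N t4_12[][][]]"

definition "t4 = N (N (X 7036)[N E[][L1 (X 6966),N (X 6998)[][E,X 6974,X 6976][X 6727,N (X 6744)[][][E,E,
X 6237],N (X 6715)[][][E,X 6112]]][E,N (X 6622)[][N (X 6473)[][][E,X 6072],N (X 6534)[][][E,E,X 6029],
N (X 6469)[][][E,X 5949,X 5962]][E,L2 (X 5530),N E[][E,X 5341,X 5438][]]]][t4_0][t4_1])[t4_2][t4_8][t4_13]"

lemmas [compute] =
  arg_cong[OF t4_0_def, of descend] arg_cong[OF t4_1_def, of descend] arg_cong[OF t4_2_def, of descend]
  arg_cong[OF t4_3_def, of descend] arg_cong[OF t4_4_def, of descend] arg_cong[OF t4_5_def, of descend]
  arg_cong[OF t4_6_def, of descend] arg_cong[OF t4_7_def, of descend] arg_cong[OF t4_8_def, of descend]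
  arg_cong[OF t4_9_def, of descend] arg_cong[OF t4_10_def, of descend] arg_cong[OF t4_11_def, of descend]
  arg_cong[OF t4_12_def, of descend] arg_cong[OF t4_13_def, of descend] arg_cong[OF t4_def, of descend]

definition "p4 S T = search t4 (tidy (S, T))"

definition "c4 = pays p4 3033 4 15564"

lemma [compute]:
  "p4 S T = search t4 (tidy (S, T))"
  "c4 v m S T =
    (total p4 3033 S T m + (4 - m) * after p4 3033 S T m \<le> 4 * v + 15564)"
  "4 - 0 = (4::nat)" "4 - Suc 0 = (3::nat)" "4 - Suc (Suc 0) = (2::nat)" "4 - Suc (Suc (Suc 0)) = (1::nat)" "4 - Suc (Suc (Suc (Suc 0))) = (0::nat)"
  by (simp_all add: c4_def p4_def pays_def)

lemma t4_0[compute]: "below (leaf_ok c4 []) (Suc 0) [(0, Level)] t4_0"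
  unfolding t4_0_def by (simp only: compute cong: lazy_cong)

lemma t4_1[compute]: "below (leaf_ok c4 []) (Suc 0) [(0, Up)] t4_1"
  unfolding t4_1_def by (simp only: compute cong: lazy_cong)

lemma t4_2[compute]: "below (right_ok c4) (Suc 0) [(0, Down)] t4_2"
  unfolding t4_2_def by (simp only: compute cong: lazy_cong)

lemma t4_3[compute]: "below (leaf_ok c4 [(0, Level)]) (Suc (Suc 0)) [(Suc 0, Level)] t4_3"
  unfolding t4_3_def by (simp only: compute cong: lazy_cong)

lemma t4_4[compute]: "below (leaf_ok c4 [(0, Level)]) (Suc (Suc 0)) [(Suc 0, Up)] t4_4"
  unfolding t4_4_def by (simp only: compute cong: lazy_cong)

lemma t4_5[compute]: "below (leaf_ok c4 [(0, Level)]) (Suc 0) [] t4_5"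
  unfolding t4_5_def by (simp only: compute cong: lazy_cong)

lemma t4_6[compute]: "below (leaf_ok c4 [(0, Level), (Suc 0, Level)]) (Suc (Suc 0)) [] t4_6"
  unfolding t4_6_def by (simp only: compute cong: lazy_cong)

lemma t4_7[compute]: "below (leaf_ok c4 [(0, Level), (Suc 0, Up)]) (Suc (Suc 0)) [] t4_7"
  unfolding t4_7_def by (simp only: compute cong: lazy_cong)

lemma t4_8[compute]: "below (right_ok c4) (Suc 0) [(0, Level)] t4_8"
  unfolding t4_8_def by (simp only: compute cong: lazy_cong)

lemma t4_9[compute]: "below (leaf_ok c4 [(0, Up)]) (Suc (Suc 0)) [(Suc 0, Level)] t4_9"
  unfolding t4_9_def by (simp only: compute cong: lazy_cong)

lemma t4_10[compute]: "below (leaf_ok c4 [(0, Up)]) (Suc (Suc 0)) [(Suc 0, Up)] t4_10"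
  unfolding t4_10_def by (simp only: compute cong: lazy_cong)

lemma t4_11[compute]: "below (leaf_ok c4 [(0, Up), (Suc 0, Level)]) (Suc (Suc 0)) [] t4_11"
  unfolding t4_11_def by (simp only: compute cong: lazy_cong)

lemma t4_12[compute]: "below (leaf_ok c4 [(0, Up), (Suc 0, Up)]) (Suc (Suc 0)) [] t4_12"
  unfolding t4_12_def by (simp only: compute cong: lazy_cong)

lemma t4_13[compute]: "below (right_ok c4) (Suc 0) [(0, Up)] t4_13"
  unfolding t4_13_def by (simp only: compute cong: lazy_cong)

lemma t4[compute]: "below (right_ok c4) 0 [] t4"
  unfolding t4_def by (simp only: compute cong: lazy_cong)

lemma bound4: "\<alpha> 4 \<le> 0.56578"
  by (rule edit_constant_le[OF p4_def c4_def _ t4, where R = 858])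
    (simp_all only: compute trie.distinct, simp_all)

section \<open>Certificate for 5 letters\<close>

definition "t5_0 = N (X 9769)[N E[][E,N (X 9734)[][][E,X 9472,X 9437]][E,N (X 9271)[][E,X 9185,X 9111][E,E,
X 7941]]][N (X 9233)[U1 (X 9078)][N E[][E,X 8984][X 8377,N E[][E,X 7960,X 7804][]],N (X 8929)[][E,
N (X 8843)[][E,E,X 8793][]][E,X 7909,N E[][X 7506,X 7455,X 7583][]]][N (X 7571)[][][X 5725,X 5100],
N (X 7208)[][X 6872,N (X 7041)[][E,E,X 6857][],N (X 6741)[][E,E,E,X 6506][]][X 4703,X 5033,
X 4470]]][N (X 6622)[E,L2 (X 6575)][N (X 6437)[][E,X 6115][E,X 4417],N (X 6002)[][X 5875,E,N (X 5648)[][E,E,E,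
X 5479][]][N (X 4270)[][E,X 3941][],E,X 3919]][N (X 3976)[][E,N (X 3405)[][][E,X 1650]][X 1525],
N (X 3351)[][E,E,U2 (X 1025)][E,X 656]]]"

definition "t5_1 = N (Y 6450)[N E[][E,E,X 6411][E,E,X 5946]][N (X 5867)[][E,X 5747,N (X 5550)[][E,E,
X 5474][]][X 4275,N (X 4230)[][E,E,X 3826][],N (X 3874)[][E,X 3620,X 3696,X 3409][]],N (X 6283)[][E,
L2 (X 6188)][E,X 4978,N E[][X 3984,X 4216,X 4262][]],N (X 5893)[][E,E,N E[][E,X 5720,E,X 5637][]][E,
L1 (X 4217),E,N E[][X 3409,E,X 3518,X 3696][]]][N (Y 3312)[][N (X 3149)[][E,X 2919,X 2769][]][E,X 311,X 3],
N (Y 3931)[][E,N (X 3881)[][E,E,X 3594][],X 3324][X 718,E,X 718],N (Y 3327)[][X 2665,X 2935,N (X 3121)[][E,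
X 2919,E,X 2769][],X 2675][X 3,X 311,E,X 3]]"

definition "t5_2 = N E[N E[][E,X 9208][E,N E[][E,X 8807,X 8746][E,E,X 7862]]][N (X 8767)[][L1 (X 8673),
N (Y 8502)[][E,X 8457,X 8395][]][E,N (X 7003)[][E,Y 6890,N (Y 6640)[][E,E,X 6554][]][]],N (X 8804)[][E,
N (X 8706)[][E,E,X 8615][E,E,X 7834],N (X 8567)[][E,X 8510,E,X 8460][E,E,E,X 7616]][E,N (X 7371)[][E,X 7359,
N (X 7014)[][E,X 6981,X 6964,X 6866][]][],N (X 7047)[][E,N (Y 6756)[][E,X 6737,X 6714][],Y 6917,N E[][E,
X 6516,X 6565,X 6551][]][]]][N (Y 6390)[][N (Y 6260)[][E,Y 5986][]][Y 3896,Y 3310],t5_1]"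

definition "t5_3 = N E[U2 (N (Y 8643)[][E,E,E,X 8564][E,E,X 7965])][N E[][U2 (X 7890),E,N (X 8327)[][E,E,E,
X 8243][E,X 7539,X 7699,X 7570]][E,E,N E[][E,E,Y 6837,N (Y 6602)[][][E,E,E,X 5518]][]],E,N E[][E,
N (X 8356)[][E,E,X 8309,X 8277][E,E,X 7664,X 7500],N (Y 8486)[][E,E,E,Y 8437][E,E,X 7987],N (X 8387)[][E,E,
X 8340,X 8345,X 8311][E,E,E,X 7699]][E,N (Y 6966)[][Y 6587,E,N (Y 6689)[][E,E,E,X 6609][],X 6629][],
L2 (X 7278),N E[][E,E,Y 6709,Y 6863,X 6653][]]][D0 (N E[][][E,X 6088,X 6151]),E,N E[U2 (X 6126)][E,N E[][E,
X 5791][E,X 4253],N E[][E,Y 5957,N (X 6201)[][E,E,E,X 6120][],Y 5975][],N E[][E,X 5561,X 5767,X 5736,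
X 5570][E,X 3892,E,X 4253]][E,E,L0 (X 3310)]]"

definition "t5_4 = N t5_2[][N (N E[N E[][E,Y 9107][E,L2 (X 8855)]][L1 (Y 8440),N E[][L2 (X 8392),
N (X 8624)[][E,E,X 8545][],N (X 8486)[][E,X 8446,X 8443,X 8390][]][E,E,L3 (X 6692)]][E,N E[][E,N E[][E,X 6237,
Y 6008][],N E[][E,X 5785,X 5765,X 5599][]][]])[][E,N (L2 (N E[][L2 (X 8369),E,E,N E[][E,X 8344,E,X 8394,
X 8361][]][]))[][][]][],N t5_3[][][]][N (N E[][L1 (X 7245),N E[][E,E,X 7278][E,E,N E[][E,X 6303,X 6408,
X 6228][]]][E,N E[][N (Y 5423)[][E,E,X 5358][],L2 (Y 5594),N (X 5417)[][E,E,X 5370,X 5274][]][]])[][E,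
N (N E[][E,E,U2 (N E[][E,X 6508,X 6623,X 6570][])][E,E,L2 (L3 (Y 5508))])[][][]][],
N (N E[U2 (X 7133)][N E[][E,E,N (X 6936)[][][E,E,E,X 6705]][E,E,N (X 6298)[][E,E,E,X 6114][]],E,N E[][E,
N (X 6966)[][][E,E,E,X 6734],E,Y 6981][E,N (X 6248)[][E,E,E,X 6056][],E,N (X 6290)[][E,E,X 6117,E,
X 6094][]]][E,E,N E[U3 (X 5459)][N (X 5283)[][E,E,E,X 5130][],Y 5317,Y 5546,N (Y 5314)[][E,Y 5165,E,Y 5257,
Y 5190][E,E,E,Y 4226]][Y 3229,Y 3183,Y 3773,Y 3213]])[][][]]"

definition "t5_5 = N (X 5182)[U2 (X 4990)][N (X 4818)[][E,E,X 4675][X 3891,X 3900,N (X 3536)[][E,E,X 3433,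
X 3219][]],N (Y 5084)[][][E,L2 (X 4577)],N (X 4852)[][E,X 4793,X 4784,X 4713][E,N (X 3816)[][X 3496,E,
X 3605][],N (X 3864)[][E,X 3923,E,X 3613][],N (X 3534)[][E,E,X 3283,X 3425][]]][N (X 2947)[][X 2823][],
N (X 3412)[][X 3039,X 3399,X 3017][X 718,E,X 718],N (X 2945)[][X 2448,N (X 2643)[][][E,X 1500],N (X 2811)[][E,
X 2664,E,X 2605][],N (X 2452)[][E,X 2311,E,X 2343,X 2198][]][X 3,X 311,E,X 3]]"

definition "t5_6 = N E[U1 (N (X 6502)[][][E,E,X 6251]),U2 (N (X 6514)[][E,E,E,X 6492][E,E,X 6259,
X 6184])][N E[][E,X 6317][E,N (X 5603)[][E,E,X 5437][]],N (X 6450)[][N (X 6346)[][][E,E,X 6100],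
N (X 6409)[][][E,E,X 6189],N (X 6374)[][E,E,X 6353,X 6351][E,X 6126,X 6103,X 6028]][X 5582,N (X 5796)[][E,E,
X 5653][E,L2 (X 4884),N (X 4500)[][E,X 4263][]],N (X 5621)[][E,X 5493,X 5553,N (X 5458)[][][E,E,E,
X 4908]][X 4187,N (X 4193)[][E,E,X 3982][],N (X 4466)[][E,X 4213,E,X 4187][],N (X 4034)[][E,E,X 3783][]]]][E,
t5_5]"

definition "t5_7 = N t5_6[][N (N E[][U1 (L2 (X 5477)),N E[][E,E,X 6221][E,L2 (X 5586),N E[][E,X 5438,X 5492,
X 5402][]]][E,N E[][E,L2 (X 4907),N (X 4774)[][E,E,E,X 4659][]][E,L1 (L2 (X 3362))]])[][E,N (N E[][E,E,
N E[][][E,N E[][E,E,X 5355,X 5356][],E,L3 (X 5426)]][E,E,L1 (L3 (Y 4613))])[][][]][],N (N E[][E,N E[][E,E,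
N E[][E,E,X 5818,X 5818][]][E,E,Y 5283],N E[][E,E,Y 5872,Y 5851][E,E,N (Y 5417)[][E,E,E,X 5330][E,E,X 4685,
X 4442],N (X 5314)[][E,E,X 5216,E,X 5186][E,E,E,X 4352]]][E,N E[][X 4591,E,N (Y 4567)[][E,E,E,Y 4504][]][],
N E[][E,E,N (Y 4774)[][E,E,E,X 4712][E,X 3975,X 4216,X 3971],N (X 4614)[][E,E,X 4568,E,X 4502][]][E,E,
N (X 3291)[][E,E,N (X 3278)[][E,X 3186,E,X 3193][],N (X 2950)[][E,X 2746,E,X 2876,X 2753][]][],N E[][E,E,
N (X 2576)[][E,X 2387,X 2524,E,X 2393][],X 2765][]]])[][N (U2 (L0 (L3 (X 4445))))[][][],E,
N (U3 (L2 (L4 (Y 4439))))[][][]][]][N (N E[][E,U2 (N E[][E,E,X 3773,X 3773][E,E,E,X 3336])][E,N E[][E,E,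
Y 3291][E,L2 (Y 2420),N E[][E,Y 2038,X 2176,X 1971][]]])[][][],N (N E[][E,E,U3 (N (X 3213)[][][E,E,E,X 3069,
X 2865])][E,N E[][E,E,X 2886][E,E,Y 2054],N E[][N (X 2842)[][][E,E,E,X 2613],X 2860,E,N (Y 2863)[][][E,X 2577,
E,X 2730,X 2554]][X 2054,X 2094,N (X 2228)[][E,E,E,X 2088][],N (X 2048)[][E,E,X 1902,E,X 1814][]]])[][][]]"

definition "t5 = N t5_0[N E[][E,N (N E[N E[][E,L2 (X 9694),N (X 9704)[][E,E,E,X 9691][]][E,E,
U0 (X 8076)]][N E[][U2 (X 8035),E,N E[][E,X 8778,E,X 8778][E,X 7683]][]][D0 (L2 (X 6603))])[][][]][E,
N (N E[N E[][][E,L2 (X 8903),N (X 8978)[][E,E,E,X 8881][]]][N E[][N (X 8872)[][][E,E,X 8140],Y 8637,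
N (X 8643)[][E,X 8542,E,X 8546][E,X 7809,E,X 7841]][E,E,Y 7133]][])[][][]]][t5_4][t5_7]"

lemmas [compute] =
  arg_cong[OF t5_0_def, of descend] arg_cong[OF t5_1_def, of descend] arg_cong[OF t5_2_def, of descend]
  arg_cong[OF t5_3_def, of descend] arg_cong[OF t5_4_def, of descend] arg_cong[OF t5_5_def, of descend]
  arg_cong[OF t5_6_def, of descend] arg_cong[OF t5_7_def, of descend] arg_cong[OF t5_def, of descend]

definition "p5 S T = search t5 (tidy (S, T))"

definition "c5 = pays p5 4601 5 30280"

lemma [compute]:
  "p5 S T = search t5 (tidy (S, T))"
  "c5 v m S T =
    (total p5 4601 S T m + (5 - m) * after p5 4601 S T m \<le> 5 * v + 30280)"
  "5 - 0 = (5::nat)" "5 - Suc 0 = (4::nat)" "5 - Suc (Suc 0) = (3::nat)" "5 - Suc (Suc (Suc 0)) = (2::nat)" "5 - Suc (Suc (Suc (Suc 0))) = (1::nat)" "5 - Suc (Suc (Suc (Suc (Suc 0)))) = (0::nat)"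
  by (simp_all add: c5_def p5_def pays_def)

lemma t5_0[compute]: "below (leaf_ok c5 []) 0 [] t5_0"
  unfolding t5_0_def by (simp only: compute cong: lazy_cong)

lemma t5_1[compute]: "below (leaf_ok c5 [(0, Level)]) (Suc (Suc 0)) [(Suc 0, Up)] t5_1"
  unfolding t5_1_def by (simp only: compute cong: lazy_cong)

lemma t5_2[compute]: "below (leaf_ok c5 [(0, Level)]) (Suc 0) [] t5_2"
  unfolding t5_2_def by (simp only: compute cong: lazy_cong)

lemma t5_3[compute]: "below (leaf_ok c5 [(0, Level), (Suc 0, Level)]) (Suc (Suc 0)) [] t5_3"
  unfolding t5_3_def by (simp only: compute cong: lazy_cong)

lemma t5_4[compute]: "below (right_ok c5) (Suc 0) [(0, Level)] t5_4"
  unfolding t5_4_def by (simp only: compute cong: lazy_cong)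

lemma t5_5[compute]: "below (leaf_ok c5 [(0, Up)]) (Suc (Suc 0)) [(Suc 0, Up)] t5_5"
  unfolding t5_5_def by (simp only: compute cong: lazy_cong)

lemma t5_6[compute]: "below (leaf_ok c5 [(0, Up)]) (Suc 0) [] t5_6"
  unfolding t5_6_def by (simp only: compute cong: lazy_cong)

lemma t5_7[compute]: "below (right_ok c5) (Suc 0) [(0, Up)] t5_7"
  unfolding t5_7_def by (simp only: compute cong: lazy_cong)

lemma t5[compute]: "below (right_ok c5) 0 [] t5"
  unfolding t5_def by (simp only: compute cong: lazy_cong)

lemma bound5: "\<alpha> 5 \<le> 0.6325"
  by (rule edit_constant_le[OF p5_def c5_def _ t5, where R = 1455])
    (simp_all only: compute trie.distinct, simp_all)

section \<open>Certificate for 6 letters\<close>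

definition "t6_0 = N (X 11629)[N E[][E,U2 (X 11428)][E,N (X 11218)[][E,E,X 11112][X 10237,
L2 (X 10179)]]][N (X 11153)[][N E[][E,X 10988][E,X 10208],N (X 10902)[][E,E,L3 (X 10768)][E,
X 10104]][N (X 9641)[][][X 7771,X 7149],N (X 9215)[][N (X 8968)[][E,E,X 8844][],X 9130,N (X 8845)[][E,E,E,
X 8680][]][X 6772,N (X 7117)[][X 6716,E,X 6652][],X 6546]]][N (Y 8458)[E,L2 (X 8429)][L1 (X 8065),
N (X 7932)[][E,E,X 7639][L2 (X 5957),E,L3 (X 5522)]][N (Y 5796)[][E,L2 (X 4969)][N (Y 3318)[][][X 866],
X 2552],N (X 5185)[][L2 (X 4583),E,L3 (X 4282)][X 2163,N (X 2486)[][][E,X 3],X 1848]]]"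

definition "t6_1 = N E[U1 (N E[][E,E,X 10841][E,E,X 10205])][N (X 10730)[][E,Y 10524][E,N (Y 9043)[][E,E,
Y 8820][]],N (X 10767)[][E,L2 (X 10634),N (X 10591)[][E,E,E,X 10510][E,X 10038,E,X 9751]][E,N (Y 9413)[][E,E,
X 9145][E,L2 (X 7372)],N (X 9074)[][E,X 8851,E,X 8742][]]][E,N (Y 8311)[][N (Y 7804)[][E,X 7748,Y 7550][E,
X 6276,N (X 5891)[][E,X 5978][]],N (Y 8211)[][E,E,N (X 7989)[][E,E,E,X 7944][]][E,X 7028,X 6437],
N (X 7820)[][E,N (X 7758)[][E,E,E,X 7694][],X 7745,N E[][E,X 7549,E,E,X 7475][]][E,X 6276,X 6285,X 5891]][E,
N (Y 5765)[][X 5245,E,X 5245][],N (Y 5169)[][N (X 4601)[][E,X 4430][],X 4848,X 5033,N (X 4590)[][E,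
X 4430][]][]]]"

definition "t6_2 = N E[E,U2 (X 8385)][N E[][E,X 8233][E,N (X 7642)[][E,E,X 7525][]],N (X 8311)[][E,E,
N (X 8253)[][][E,E,E,X 8090]][X 7580,N (X 7746)[][][E,E,X 6866],N (X 7613)[][E,E,E,X 7512][E,X 6518,X 6756,
X 6340]]][E,N (X 7036)[][N (X 6758)[][E,E,X 6685][E,E,X 5887],U2 (X 6211),N (X 6766)[][E,E,E,X 6674][E,X 6024,
X 6095,X 5683]][Y 4810,N (X 5324)[][E,N (X 5324)[][E,E,X 5227][],N (Y 4919)[][E,E,E,X 4820][]][],
N (X 4825)[][E,N (X 4578)[][E,E,E,X 4402][],N (X 4749)[][E,X 4651,E,X 4575][],N (X 4390)[][E,X 4268,E,E,
X 4170][]][]]]"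

definition "t6 = N t6_0[N E[][E,N (N E[N E[][E,E,X 11591][E,E,U2 (X 10322)]][L2 (N E[][E,E,E,X 10795][E,
X 9849,E,X 9849])][])[][][]][E,N (L0 (L2 (N (Y 10696)[][][E,E,E,X 9964])))[][][]]][N t6_1[][N (N E[][E,
N E[][E,L2 (X 10638),Y 10533][]][E,L2 (L3 (Y 7572))])[][][],N (N E[U2 (L3 (X 10650))][L2 (N (X 10380)[][E,E,E,
X 10334][E,E,E,X 9851]),E,N E[][E,X 10417,L3 (X 10481),N (X 10417)[][E,E,E,E,X 10360][]][E,E,L2 (X 9399),
L3 (X 8963)]][E,E,L3 (N E[][E,Y 7545,X 7730,X 7717,Y 7554][])])[][][]][N (N E[][E,N E[][E,E,Y 9362][E,E,
N E[][E,X 8564,E,X 8524][]]][E,L2 (N (Y 7400)[][E,E,E,Y 7261][])])[][][],N (N E[][U2 (L3 (X 8740)),E,N E[][E,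
E,E,Y 9038][E,X 8634,L3 (X 8549),N (X 8488)[][E,E,E,E,X 8340][]]][E,E,N E[][L3 (X 7274),E,E,N (Y 7333)[][E,E,
E,E,Y 7207][]][E,E,E,Y 5114]])[][][]]][N t6_2[][N (N E[][E,U2 (L3 (X 7523))][E,L2 (N (Y 6725)[][E,E,E,
X 6656][])])[][][],N (N E[][E,U2 (Y 7386),N E[][][E,E,X 7400,N (X 7333)[][E,E,E,E,X 7267][]]][E,E,N E[][E,E,
N E[][E,E,E,X 6689][E,E,X 6413],N (X 6565)[][E,E,E,E,X 6498][]][]])[][][]][N (U1 (N E[][E,E,X 5248][E,E,
Y 4358]))[][][],N (N E[][][E,U2 (Y 4112),N E[][E,E,E,Y 4795][E,E,X 4358,N (X 4187)[][E,E,E,E,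
X 3992][]]])[][][]]]"

lemmas [compute] =
  arg_cong[OF t6_0_def, of descend] arg_cong[OF t6_1_def, of descend] arg_cong[OF t6_2_def, of descend]
  arg_cong[OF t6_def, of descend]

definition "p6 S T = search t6 (tidy (S, T))"

definition "c6 = pays p6 4820 6 38814"

lemma [compute]:
  "p6 S T = search t6 (tidy (S, T))"
  "c6 v m S T =
    (total p6 4820 S T m + (6 - m) * after p6 4820 S T m \<le> 6 * v + 38814)"
  "6 - 0 = (6::nat)" "6 - Suc 0 = (5::nat)" "6 - Suc (Suc 0) = (4::nat)" "6 - Suc (Suc (Suc 0)) = (3::nat)" "6 - Suc (Suc (Suc (Suc 0))) = (2::nat)" "6 - Suc (Suc (Suc (Suc (Suc 0)))) = (1::nat)"
  by (simp_all add: c6_def p6_def pays_def)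

lemma t6_0[compute]: "below (leaf_ok c6 []) 0 [] t6_0"
  unfolding t6_0_def by (simp only: compute cong: lazy_cong)

lemma t6_1[compute]: "below (leaf_ok c6 [(0, Level)]) (Suc 0) [] t6_1"
  unfolding t6_1_def by (simp only: compute cong: lazy_cong)

lemma t6_2[compute]: "below (leaf_ok c6 [(0, Up)]) (Suc 0) [] t6_2"
  unfolding t6_2_def by (simp only: compute cong: lazy_cong)

lemma t6[compute]: "below (right_ok c6) 0 [] t6"
  unfolding t6_def by (simp only: compute cong: lazy_cong)

lemma bound6: "\<alpha> 6 \<le> 0.68424"
  by (rule edit_constant_le[OF p6_def c6_def _ t6, where R = 1649])
    (simp_all only: compute trie.distinct, simp_all)

section \<open>Certificate for 7 letters\<close>

definition "t7_0 = N (N E[U1 (L2 (X 10137))][N E[][E,N (Y 9870)[][E,E,X 9781][]][E,N (Y 8172)[][E,E,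
Y 7874][]],N E[][E,X 10005,N (X 9879)[][][E,X 9150,E,X 9001]][E,N (X 8551)[][E,E,N (X 8265)[][E,E,E,
X 8185][]][E,X 6668],N (X 8193)[][E,N (X 7974)[][E,E,E,X 7911][],E,N (Y 7878)[][E,X 7825][]][]]][E,
N (Y 7226)[][N E[][E,E,N (X 6479)[][E,E,E,X 6386][]][E,X 5066,X 4645],N (X 7133)[][E,E,N (X 6922)[][E,E,E,
X 6888][]][E,E,X 5216],N (Y 6728)[][E,N (X 6673)[][E,E,E,X 6594][],E,N E[][E,X 6483,E,E,X 6391][]][E,X 5039,E,
X 4645]][E,N (X 4343)[][E,E,X 3818][],N (Y 3701)[][E,X 3416,E,X 3126][]]])[][N (N E[][E,L2 (N (Y 9816)[][E,E,
E,Y 9758][])][E,L2 (L3 (Y 6487))])[][][],N (N E[U2 (L3 (X 9963))][L2 (X 9703),E,N E[][E,L3 (Y 9650),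
N (X 9816)[][E,E,E,X 9763][],N (X 9700)[][E,E,E,E,X 9641][]][]][E,E,N E[][L2 (X 6661),E,X 7100,
L4 (Y 6462)][]])[][][]][N (N E[][E,U2 (L3 (Y 7622))][E,L2 (N (Y 6271)[][E,E,E,Y 6119][])])[][][],
N (N E[][U2 (L3 (Y 7502)),E,N E[][E,E,E,X 8152][E,E,L3 (X 7594),N (X 7560)[][E,E,E,E,X 7403][]]][E,E,
N E[][L3 (X 6130),E,E,N (Y 6177)[][E,E,E,E,Y 6045][]][E,E,E,Y 3631]])[][][]]"

definition "t7_1 = N (N E[E,U2 (X 7304)][N E[][E,X 7150][E,X 6491],N (X 7226)[][E,E,X 7169][X 6443,X 6601,
N (X 6474)[][E,E,E,X 6387][E,E,E,N (X 5087)[][E,E,E,E,X 4737][]]]][E,N (X 5777)[][X 5498,U2 (X 4874),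
N (X 5508)[][E,E,E,X 5423][E,X 4858,E,X 4359]][Y 3281,N (Y 3814)[][E,X 3820,N (X 3516)[][E,E,E,X 3336][]][],
N (X 3302)[][E,N (X 3065)[][E,E,E,X 2902][],X 3237,N (X 2860)[][E,X 2733,E,E,X 2660][]][]]])[][N (N E[][E,
U2 (X 6487)][E,L2 (Y 5468)])[][][],N (N E[][E,N E[][E,E,L3 (Y 6720)][E,E,Y 6245],N E[][][E,E,L3 (X 6254),
N E[][E,E,X 6124,E,X 6119][]]][E,E,N E[][E,E,L3 (X 5432),X 5298][]])[][][]][N (U1 (U2 (L3 (Y 2737))))[][][],
N (U2 (N E[][E,E,E,Y 3260][E,E,E,N (X 2653)[][E,E,E,E,X 2455][]]))[][][]]"

definition "t7 = N (N (X 10945)[U1 (N (X 10533)[][E,E,X 10434][X 9507,X 9586,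
X 9400])][N (X 10457)[][U1 (X 9523),N (X 10210)[][E,E,L3 (X 10110)][E,E,N (X 9125)[][E,E,E,
X 8939][]]][N (X 8775)[][][E,X 6114],N (X 8350)[][E,E,N (X 7974)[][E,E,E,X 7822][]][X 5673,X 6011,
X 5391]]][N (Y 7379)[][N E[][E,X 7060][E,L2 (X 4867)],N (X 6851)[][E,E,Y 6570][L2 (X 4701),E,N E[][X 4483,E,E,
X 4256][]]][N (X 4367)[][E,L2 (X 3558)][E,X 762],N (X 3721)[][L2 (X 3138),E,N E[][X 2997,E,E,X 2835][]][X 353,
E,X 2]]])[N E[][E,N (L0 (L2 (L3 (X 10110))))[][][]][E,N (L0 (L2 (Y 10013)))[][][]]][t7_0][t7_1]"

lemmas [compute] =
  arg_cong[OF t7_0_def, of descend] arg_cong[OF t7_1_def, of descend] arg_cong[OF t7_def, of descend]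

definition "p7 S T = search t7 (tidy (S, T))"

definition "c7 = pays p7 5571 7 53039"

lemma [compute]:
  "p7 S T = search t7 (tidy (S, T))"
  "c7 v m S T =
    (total p7 5571 S T m + (7 - m) * after p7 5571 S T m \<le> 7 * v + 53039)"
  "7 - 0 = (7::nat)" "7 - Suc 0 = (6::nat)" "7 - Suc (Suc 0) = (5::nat)" "7 - Suc (Suc (Suc 0)) = (4::nat)" "7 - Suc (Suc (Suc (Suc 0))) = (3::nat)" "7 - Suc (Suc (Suc (Suc (Suc 0)))) = (2::nat)"
  by (simp_all add: c7_def p7_def pays_def)

lemma t7_0[compute]: "below (right_ok c7) (Suc 0) [(0, Level)] t7_0"
  unfolding t7_0_def by (simp only: compute cong: lazy_cong)

lemma t7_1[compute]: "below (right_ok c7) (Suc 0) [(0, Up)] t7_1"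
  unfolding t7_1_def by (simp only: compute cong: lazy_cong)

lemma t7[compute]: "below (right_ok c7) 0 [] t7"
  unfolding t7_def by (simp only: compute cong: lazy_cong)

lemma bound7: "\<alpha> 7 \<le> 0.72016"
  by (rule edit_constant_le[OF p7_def c7_def _ t7, where R = 2006])
    (simp_all only: compute trie.distinct, simp_all)

section \<open>Certificate for 8 letters\<close>

definition "t8_0 = N (N E[][N E[][E,Y 8555][E,N (Y 7110)[][E,E,Y 6876][]],N (X 8730)[][E,E,Y 8574][E,
N (X 7421)[][E,E,N (X 7232)[][E,E,E,X 7163][]][],N (X 7135)[][E,N (X 6968)[][E,E,E,X 6920][],E,N (X 6887)[][E,
X 6832,E,E,X 6801][]][]]][E,N (Y 6231)[][N E[][E,X 5778,Y 5640][E,X 4391,X 4073],N (X 6189)[][E,E,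
N (X 6002)[][E,E,E,X 5974][]][],N (Y 5838)[][E,X 5793,E,N (X 5650)[][E,X 5650,E,E,X 5600][]][E,X 4391,E,
X 4073]][E,L2 (X 3299),N (Y 3180)[][E,X 2965,E,X 2740][]]])[][N (L1 (L2 (Y 8546)))[][][],N (N E[][L2 (X 8442),
E,N E[][E,L2 (X 8432),L3 (X 8505),N E[][E,E,X 8442,E,X 8403][]][]][])[][][]][N (N E[][E,U2 (L3 (Y 6711))][E,
L2 (N (Y 5440)[][E,E,E,Y 5324][])])[][][],N (N E[][U2 (L3 (Y 6566)),E,N E[][][E,E,L3 (X 6612),N (X 6591)[][E,
E,E,E,X 6460][]]][E,E,N E[][E,E,E,N (Y 5344)[][E,E,E,E,Y 5246][]][E,E,E,Y 3128]])[][][]]"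

definition "t8 = N (N (X 9441)[U1 (N (X 9118)[][E,E,X 9043][E,E,X 8202])][N (X 9054)[][U1 (X 8283),
N (X 8860)[][E,E,X 8785][E,E,X 7997]][N (X 7600)[][][E,X 5340],N (X 7261)[][L2 (X 7010),E,N (X 6979)[][E,E,E,
X 6873][]][X 4951,E,X 4744]]][N (X 6354)[][N E[][E,X 6142][E,X 4559],N (X 5925)[][E,E,Y 5740][L2 (X 4128),E,
N E[][X 3948,E,E,X 3777][]]][N (X 3745)[][E,L2 (X 3102)][E,X 629],N (X 3199)[][L2 (X 2873),E,N E[][X 2644,E,E,
X 2520][]][X 283,E,X 4]]])[U1 (N (L0 (L2 (Y 8695)))[][][])][t8_0][N (N E[E,U2 (X 6294)][N E[][E,X 6182][E,
X 5758],N (X 6231)[][E,E,X 6185][E,X 5703,N (X 5585)[][E,E,E,X 5522][E,E,E,X 4525]]][E,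
N (X 4954)[][L2 (X 4739),U2 (X 4196),N (Y 4745)[][E,E,E,Y 4681][E,X 4188,E,X 3833]][Y 2901,N (X 3231)[][E,E,
N (X 3001)[][E,E,E,X 2873][]][],N (X 2812)[][E,N (X 2633)[][E,E,E,X 2514][],E,N (X 2472)[][E,X 2385,E,E,
X 2325][]][]]])[][N (U1 (L2 (Y 4747)))[][][],N (U2 (L3 (N (X 4575)[][E,E,E,E,
Y 4521][])))[][][]][N (U1 (U2 (L3 (Y 2581))))[][][],N (U2 (N E[][E,E,E,X 2785][E,E,E,N (X 2280)[][E,E,E,E,
X 2111][]]))[][][]]]"

lemmas [compute] =
  arg_cong[OF t8_0_def, of descend] arg_cong[OF t8_def, of descend]

definition "p8 S T = search t8 (tidy (S, T))"

definition "c8 = pays p8 4935 8 54264"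

lemma [compute]:
  "p8 S T = search t8 (tidy (S, T))"
  "c8 v m S T =
    (total p8 4935 S T m + (8 - m) * after p8 4935 S T m \<le> 8 * v + 54264)"
  "8 - 0 = (8::nat)" "8 - Suc 0 = (7::nat)" "8 - Suc (Suc 0) = (6::nat)" "8 - Suc (Suc (Suc 0)) = (5::nat)" "8 - Suc (Suc (Suc (Suc 0))) = (4::nat)" "8 - Suc (Suc (Suc (Suc (Suc 0)))) = (3::nat)"
  by (simp_all add: c8_def p8_def pays_def)

lemma t8_0[compute]: "below (right_ok c8) (Suc 0) [(0, Level)] t8_0"
  unfolding t8_0_def by (simp only: compute cong: lazy_cong)

lemma t8[compute]: "below (right_ok c8) 0 [] t8"
  unfolding t8_def by (simp only: compute cong: lazy_cong)

lemma bound8: "\<alpha> 8 \<le> 0.74896"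
  by (rule edit_constant_le[OF p8_def c8_def _ t8, where R = 1848])
    (simp_all only: compute trie.distinct, simp_all)

section \<open>Certificate for 9 letters\<close>

definition "t9_0 = N (N E[][L1 (X 6995),N (X 7144)[][E,E,Y 7001][E,N (X 5692)[][E,E,N (X 5504)[][E,E,E,
X 5439][]][],N (Y 5396)[][E,N (X 5270)[][E,E,E,X 5225][],E,N (X 5141)[][E,X 5093,E,E,X 5069][]][E,E,E,
X 2774]]][E,N (Y 4293)[][E,N (Y 4253)[][E,E,X 4079][],N (Y 3892)[][E,E,E,X 3701][E,X 2353,E,X 1966]][E,
L2 (X 1023),N (X 877)[][E,X 681,X 825,X 429][]]])[][N (L1 (L2 (L3 (X 6939))))[][][],N (N E[][L2 (L3 (X 6874)),
E,N E[][E,L3 (X 6818),L3 (X 6938),L4 (X 6816)][]][E,E,N E[][L3 (X 3714),E,E,N (Y 3861)[][E,E,X 3844,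
X 3837][]][]])[][][]][N (N E[][E,U2 (L3 (Y 4977))][E,L2 (N (Y 3481)[][E,E,E,Y 3363][])])[][][],N (N E[][E,E,
N E[][][E,E,L3 (X 4872),X 4851]][E,E,L3 (N (Y 3393)[][E,E,E,E,Y 3291][])])[][][]]"

definition "t9 = N (N (X 7882)[U1 (N (X 7561)[][E,E,X 7497][])][N (X 7481)[][E,N (X 7290)[][E,E,X 7225][E,E,
X 6441]][N (X 5873)[][][E,X 3417],N (X 5525)[][E,E,X 5248][X 2998]]][N (X 4422)[][U1 (X 2471),
N (X 3994)[][][L2 (X 2070),E,N E[][X 1975,E,E,X 1697][]]][X 1468,
X 898]])[U1 (N (L0 (L2 (Y 7166)))[][][])][t9_0][N (N E[E,U2 (X 4363)][N E[][E,X 4285][E,Y 3892],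
N (X 4293)[][E,E,X 4251][E,X 3761,N (X 3668)[][E,E,E,X 3639][E,E,E,X 2940]]][E,N (X 2866)[][L2 (X 2651),
U2 (X 2071),N (Y 2653)[][E,E,E,Y 2596][E,X 2084,E,X 1789]][E,N (X 958)[][E,E,N (X 714)[][E,E,E,X 581][]][],
N (X 499)[][E,N (X 317)[][E,E,E,X 201][],E,N (X 150)[][E,X 69,E,E,
X 3][]][]]])[][N (U1 (L2 (L3 (Y 2594))))[][][],N (N E[][E,L2 (Y 3872)][E,E,L3 (N (X 2487)[][E,E,E,E,
Y 2437][])])[][][]][E,N (U2 (U3 (X 241)))[][][]]]"

lemmas [compute] =
  arg_cong[OF t9_0_def, of descend] arg_cong[OF t9_def, of descend]

definition "p9 S T = search t9 (tidy (S, T))"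

definition "c9 = pays p9 5638 9 70344"

lemma [compute]:
  "p9 S T = search t9 (tidy (S, T))"
  "c9 v m S T =
    (total p9 5638 S T m + (9 - m) * after p9 5638 S T m \<le> 9 * v + 70344)"
  "9 - 0 = (9::nat)" "9 - Suc 0 = (8::nat)" "9 - Suc (Suc 0) = (7::nat)" "9 - Suc (Suc (Suc 0)) = (6::nat)" "9 - Suc (Suc (Suc (Suc 0))) = (5::nat)" "9 - Suc (Suc (Suc (Suc (Suc 0)))) = (4::nat)"
  by (simp_all add: c9_def p9_def pays_def)

lemma t9_0[compute]: "below (right_ok c9) (Suc 0) [(0, Level)] t9_0"
  unfolding t9_0_def by (simp only: compute cong: lazy_cong)

lemma t9[compute]: "below (right_ok c9) 0 [] t9"
  unfolding t9_def by (simp only: compute cong: lazy_cong)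

lemma bound9: "\<alpha> 9 \<le> 0.77264"
  by (rule edit_constant_le[OF p9_def c9_def _ t9, where R = 2178])
    (simp_all only: compute trie.distinct, simp_all)

section \<open>Certificate for 10 letters\<close>

definition "t10 = N (N (X 6085)[U1 (X 5870)][N (X 5799)[][E,N (X 5665)[][E,E,X 5621][E,E,X 5069]][E,
N (X 4329)[][E,E,X 4137][]]][N (X 3391)[][U1 (X 1919),
X 3092][X 1076]])[U1 (N (L0 (L2 (Y 5580)))[][][])][N (N E[][L1 (X 5521),N (X 5551)[][E,E,Y 5448][E,
N (X 4443)[][E,E,N (X 4307)[][E,E,E,X 4294][]][],N (Y 4218)[][E,N (X 4128)[][E,E,E,X 4126][],E,N (X 4040)[][E,
X 4010,E,E,X 3993][]][]]][E,N E[][E,N (Y 3278)[][E,E,X 3157][],N (Y 3011)[][E,E,E,X 2876][E,X 1831,E,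
X 1554]][E,L2 (X 759),N (X 640)[][E,X 506,X 612,X 318][]]])[][N (L1 (L2 (L3 (X 5411))))[][][],
N (N E[][L2 (L3 (X 5370)),E,N E[][E,L3 (X 5320),L3 (X 5416),L4 (X 5319)][]][E,E,N E[][L3 (X 2883),E,E,
N (Y 2990)[][E,E,X 2978,X 2982][]][]])[][][]][N (U1 (L2 (N (Y 2735)[][E,E,E,Y 2652][])))[][][],N (N E[][E,E,
U3 (L4 (X 3766))][E,E,L3 (N (Y 2636)[][E,E,E,E,Y 2563][])])[][][]]][N (N E[][E,N (X 3301)[][E,E,X 3272][E,
X 2941,X 2837]][E,N (X 2192)[][E,E,N (Y 2045)[][E,E,E,Y 2012][E,X 1900,E,X 1425]][E,N (X 689)[][E,E,
N (X 513)[][E,E,E,X 421][]][],N (X 356)[][E,N (X 231)[][E,E,E,X 150][],E,N (X 104)[][E,X 53,E,E,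
X 3][]][]]])[][N (U1 (L2 (L3 (Y 2005))))[][][],N (U2 (L3 (N (X 1924)[][E,E,E,E,Y 1896][])))[][][]][]]"

lemmas [compute] =
  arg_cong[OF t10_def, of descend]

definition "p10 S T = search t10 (tidy (S, T))"

definition "c10 = pays p10 4462 10 62300"

lemma [compute]:
  "p10 S T = search t10 (tidy (S, T))"
  "c10 v m S T =
    (total p10 4462 S T m + (10 - m) * after p10 4462 S T m \<le> 10 * v + 62300)"
  "10 - 0 = (10::nat)" "10 - Suc 0 = (9::nat)" "10 - Suc (Suc 0) = (8::nat)" "10 - Suc (Suc (Suc 0)) = (7::nat)" "10 - Suc (Suc (Suc (Suc 0))) = (6::nat)" "10 - Suc (Suc (Suc (Suc (Suc 0)))) = (5::nat)"
  by (simp_all add: c10_def p10_def pays_def)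

lemma t10[compute]: "below (right_ok c10) 0 [] t10"
  unfolding t10_def by (simp only: compute cong: lazy_cong)

lemma bound10: "\<alpha> 10 \<le> 0.7925"
  by (rule edit_constant_le[OF p10_def c10_def _ t10, where R = 1768])
    (simp_all only: compute trie.distinct, simp_all)

section \<open>Certificate for 11 letters\<close>

definition "t11 = N (N (X 6207)[U1 (X 6000)][N (X 5931)[][E,N (X 5804)[][][E,E,X 5208]][E,N (X 4445)[][E,E,
X 4286][]]][N (X 3445)[][U1 (X 1956),X 3165][X 1055]])[U1 (N (L0 (L2 (Y 5718)))[][][])][N (N E[][L1 (X 5670),
N (X 5698)[][E,E,Y 5606][E,N (X 4552)[][E,E,X 4425][],N (Y 4335)[][E,X 4249,E,X 4180][]]][E,N E[][E,
N (X 3345)[][E,E,X 3249][],N (Y 3087)[][E,E,E,N (X 2962)[][E,E,E,E,X 2937][]][E,X 1869,E,X 1613]][E,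
L2 (X 768),N (X 630)[][E,X 508,E,X 331][]]])[][N (L1 (L2 (L3 (Y 5614))))[][][],N (N E[][L2 (L3 (X 5515)),E,
N E[][E,L3 (X 5482),E,L4 (X 5485)][]][E,E,N E[][L3 (X 2962),E,E,N (Y 3066)[][E,E,
X 3058][]][]])[][][]][N (U1 (L2 (Y 2789)))[][][],N (N E[][E,E,U3 (L4 (X 3862))][E,E,L3 (N (Y 2697)[][E,E,E,E,
Y 2628][])])[][][]]][N (N E[][E,N (X 3356)[][E,E,X 3329][E,E,X 2885]][E,N (X 2207)[][E,E,N (X 2075)[][][E,
X 1934,E,X 1437]][E,N (X 679)[][E,E,N (X 513)[][E,E,E,X 429][]][],N (X 327)[][E,N (X 211)[][E,E,E,X 136][],E,
N (X 95)[][E,X 49,E,E,X 3][]][]]])[][E,N (U2 (L3 (N (X 1957)[][E,E,E,E,X 1928][])))[][][]][]]"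

lemmas [compute] =
  arg_cong[OF t11_def, of descend]

definition "p11 S T = search t11 (tidy (S, T))"

definition "c11 = pays p11 4640 11 71698"

lemma [compute]:
  "p11 S T = search t11 (tidy (S, T))"
  "c11 v m S T =
    (total p11 4640 S T m + (11 - m) * after p11 4640 S T m \<le> 11 * v + 71698)"
  "11 - 0 = (11::nat)" "11 - Suc 0 = (10::nat)" "11 - Suc (Suc 0) = (9::nat)" "11 - Suc (Suc (Suc 0)) = (8::nat)" "11 - Suc (Suc (Suc (Suc 0))) = (7::nat)" "11 - Suc (Suc (Suc (Suc (Suc 0)))) = (6::nat)"
  by (simp_all add: c11_def p11_def pays_def)

lemma t11[compute]: "below (right_ok c11) 0 [] t11"
  unfolding t11_def by (simp only: compute cong: lazy_cong)

lemma bound11: "\<alpha> 11 \<le> 0.8095"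
  by (rule edit_constant_le[OF p11_def c11_def _ t11, where R = 1878])
    (simp_all only: compute trie.distinct, simp_all)

section \<open>Certificate for 12 letters\<close>

definition "t12 = N (N (X 1240)[U1 (N (X 1203)[][][E,E,X 1092])][N (X 1189)[][E,N (X 1166)[][][E,E,
X 1055]][U1 (X 555),N (X 897)[][E,E,X 868][E,E,X 470]]][N (X 685)[][U1 (X 389),X 632][X 201]])[][N (N E[][E,
N (X 1144)[][E,E,X 1127][E,N (X 913)[][E,E,N (X 889)[][E,E,E,X 888][]][],N (Y 874)[][E,N (X 856)[][E,E,E,
X 856][],E,N (X 843)[][E,X 837,E,E,X 835][]][E,X 550]]][E,N E[][E,N (X 666)[][E,E,X 649][],N (Y 618)[][E,E,E,
X 596][E,X 374,E,X 328]][E,L2 (X 147),N (X 121)[][E,X 98,E,X 65][]]])[][E,N (N E[][L2 (L3 (X 1135)),E,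
L3 (L4 (X 1105))][E,E,L3 (N (Y 615)[][E,E,X 613][])])[][][]][N (U1 (L2 (L3 (Y 547))))[][][],N (N E[][E,E,
U3 (L4 (X 779))][E,E,L3 (N (Y 545)[][E,E,E,E,Y 531][])])[][][]]][N (N E[][E,N (X 669)[][E,E,X 665][E,E,
X 583]][E,N (X 437)[][E,E,N (Y 411)[][][E,X 388,E,X 287]][E,N (X 131)[][E,E,N (X 100)[][E,E,E,X 83][]][],
N (Y 68)[][E,N (X 50)[][E,E,E,X 36][],E,N (X 20)[][E,X 9,E,E,X 3][]][]]])[][N (U1 (L2 (L3 (Y 404))))[][][],
N (U2 (L3 (N (X 389)[][E,E,E,E,Y 384][])))[][][]][]]"

lemmas [compute] =
  arg_cong[OF t12_def, of descend]

definition "p12 S T = search t12 (tidy (S, T))"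

definition "c12 = pays p12 944 12 15996"

lemma [compute]:
  "p12 S T = search t12 (tidy (S, T))"
  "c12 v m S T =
    (total p12 944 S T m + (12 - m) * after p12 944 S T m \<le> 12 * v + 15996)"
  "12 - 0 = (12::nat)" "12 - Suc 0 = (11::nat)" "12 - Suc (Suc 0) = (10::nat)" "12 - Suc (Suc (Suc 0)) = (9::nat)" "12 - Suc (Suc (Suc (Suc 0))) = (8::nat)" "12 - Suc (Suc (Suc (Suc (Suc 0)))) = (7::nat)"
  by (simp_all add: c12_def p12_def pays_def)

lemma t12[compute]: "below (right_ok c12) 0 [] t12"
  unfolding t12_def by (simp only: compute cong: lazy_cong)

lemma bound12: "\<alpha> 12 \<le> 0.82432"
  by (rule edit_constant_le[OF p12_def c12_def _ t12, where R = 389])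
    (simp_all only: compute trie.distinct, simp_all)

section \<open>Certificate for 13 letters\<close>

definition "t13 = N (N (X 4675)[U1 (X 4544)][N (X 4546)[][E,N (X 4415)[][][E,E,X 3981]][E,N (X 3366)[][E,E,
X 3239][]]][N (X 2529)[][E,L2 (L3 (X 2244))][N (X 644)[][E,X 450][],N (X 362)[][E,E,N (X 164)[][E,E,E,
X 97][]][]]])[U1 (N (L0 (L2 (Y 4382)))[][][])][N (N E[][L1 (Y 4303),N (X 4331)[][E,E,X 4270][E,N (X 3442)[][E,
E,X 3355][],Y 3323]][E,N E[][L2 (Y 2242),N (X 2468)[][E,E,X 2404][E,E,X 1410],N (Y 2293)[][E,X 2288,E,
X 2229][E,X 1473,E,X 1213]][E,E,L1 (X 277)]])[][E,N (L2 (L3 (X 4218)))[][][]][N (N E[][E,U2 (Y 3002)][E,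
L2 (Y 2081)])[][][],N (N E[][E,E,N E[][E,E,E,X 3305][E,E,E,X 2943]][E,E,L3 (Y 2015)])[][][]]][N (N E[][E,
N E[][E,E,X 2459][E,E,X 2128]][E,N (X 1598)[][E,U2 (X 1392),N (X 1492)[][E,E,E,X 1464][E,X 1089,E,X 981]][E,
N (X 361)[][E,E,X 247][],N (X 130)[][E,X 51,E,X 2][]]])[][][]]"

lemmas [compute] =
  arg_cong[OF t13_def, of descend]

definition "p13 S T = search t13 (tidy (S, T))"

definition "c13 = pays p13 3690 13 68055"

lemma [compute]:
  "p13 S T = search t13 (tidy (S, T))"
  "c13 v m S T =
    (total p13 3690 S T m + (13 - m) * after p13 3690 S T m \<le> 13 * v + 68055)"
  "13 - 0 = (13::nat)" "13 - Suc 0 = (12::nat)" "13 - Suc (Suc 0) = (11::nat)" "13 - Suc (Suc (Suc 0)) = (10::nat)" "13 - Suc (Suc (Suc (Suc 0))) = (9::nat)"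
  by (simp_all add: c13_def p13_def pays_def)

lemma t13[compute]: "below (right_ok c13) 0 [] t13"
  unfolding t13_def by (simp only: compute cong: lazy_cong)

lemma bound13: "\<alpha> 13 \<le> 0.83744"
  by (rule edit_constant_le[OF p13_def c13_def _ t13, where R = 1545])
    (simp_all only: compute trie.distinct, simp_all)

section \<open>Certificate for 14 letters\<close>

definition "t14 = N (N (X 1194)[U1 (N (X 1160)[][][E,E,X 1056])][N (X 1148)[][E,N (X 1129)[][][E,E,
X 1025]][U1 (X 536),N (X 871)[][][E,E,X 464]]][N (X 657)[][U1 (X 376),L2 (X 593)][X 180]])[][N (N E[][E,
N (X 1111)[][E,E,Y 1094][E,N (X 885)[][E,E,X 865][],N (Y 851)[][E,X 852,E,X 826][E,X 535]]][E,N E[][E,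
N (X 639)[][E,E,X 624][],N (X 599)[][E,X 597,E,X 579][E,X 379,E,X 322]][E,E,X 111]])[][E,
N (N E[][L2 (L3 (X 1093)),E,L3 (N (X 1081)[][E,E,E,E,X 1076][])][E,E,
L3 (X 595)])[][][]][N (U1 (L2 (L3 (Y 528))))[][][],N (N E[][E,E,U3 (L4 (X 758))][E,E,L3 (N (Y 528)[][E,E,E,E,
Y 516][])])[][][]]][N (N E[][E,N (X 641)[][E,E,X 637][E,E,X 558]][E,N (X 415)[][E,E,N (Y 394)[][][E,X 374,E,
X 275]][E,N (X 111)[][E,E,N (X 84)[][E,E,E,X 71][]][],N (Y 56)[][E,N (X 43)[][E,E,E,X 33][],E,N (X 17)[][E,
X 8,E,E,X 3][]][]]])[][E,N (U2 (L3 (L4 (X 370))))[][][]][]]"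

lemmas [compute] =
  arg_cong[OF t14_def, of descend]

definition "p14 S T = search t14 (tidy (S, T))"

definition "c14 = pays p14 931 14 18550"

lemma [compute]:
  "p14 S T = search t14 (tidy (S, T))"
  "c14 v m S T =
    (total p14 931 S T m + (14 - m) * after p14 931 S T m \<le> 14 * v + 18550)"
  "14 - 0 = (14::nat)" "14 - Suc 0 = (13::nat)" "14 - Suc (Suc 0) = (12::nat)" "14 - Suc (Suc (Suc 0)) = (11::nat)" "14 - Suc (Suc (Suc (Suc 0))) = (10::nat)" "14 - Suc (Suc (Suc (Suc (Suc 0)))) = (9::nat)"
  by (simp_all add: c14_def p14_def pays_def)

lemma t14[compute]: "below (right_ok c14) 0 [] t14"
  unfolding t14_def by (simp only: compute cong: lazy_cong)

lemma bound14: "\<alpha> 14 \<le> 0.84646"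
  by (rule edit_constant_le[OF p14_def c14_def _ t14, where R = 394])
    (simp_all only: compute trie.distinct, simp_all)

section \<open>Certificate for 15 letters\<close>

definition "t15 = N (N (X 4008)[U1 (X 3915)][N (Y 3870)[][E,N (X 3815)[][][E,E,X 3521]][N (X 3073)[][][E,
X 2115],N (X 2959)[][E,E,X 2883][]]][N (X 2188)[][U1 (X 1298),X 2040][X 614]])[][N (N E[][L1 (X 3729),
N (X 3744)[][E,E,Y 3693][E,L2 (X 2968),N (Y 2909)[][E,E,E,X 2834][E,X 1895,E,X 1572]]][E,N E[][E,L2 (X 2093),
N (Y 2002)[][E,E,E,N (X 1944)[][E,E,E,E,X 1937][]][E,X 1324,E,X 1114]][E,L2 (X 427),N (X 349)[][E,X 285,E,
X 193][]]])[][N (L1 (L2 (L3 (Y 3695))))[][][],N (N E[][E,E,L3 (L4 (X 3638))][E,E,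
L3 (L2 (X 1990))])[][][]][N (U1 (L2 (L3 (Y 1789))))[][][],N (N E[][E,E,U3 (L4 (X 2686))][E,E,
L3 (L4 (Y 1752))])[][][]]][N (N E[][E,N E[][E,E,X 2140][E,E,X 1933]][E,N (X 1413)[][E,E,N (X 1348)[][][E,E,E,
X 1014]][E,L2 (L3 (X 263)),N (Y 212)[][E,N (X 250)[][E,E,E,X 209][],E,N (X 45)[][E,X 22,E,E,X 3][]][]]])[][E,
N (U2 (L3 (L4 (X 1280))))[][][]][]]"

lemmas [compute] =
  arg_cong[OF t15_def, of descend]

definition "p15 S T = search t15 (tidy (S, T))"

definition "c15 = pays p15 3182 15 68160"

lemma [compute]:
  "p15 S T = search t15 (tidy (S, T))"
  "c15 v m S T =
    (total p15 3182 S T m + (15 - m) * after p15 3182 S T m \<le> 15 * v + 68160)"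
  "15 - 0 = (15::nat)" "15 - Suc 0 = (14::nat)" "15 - Suc (Suc 0) = (13::nat)" "15 - Suc (Suc (Suc 0)) = (12::nat)" "15 - Suc (Suc (Suc (Suc 0))) = (11::nat)" "15 - Suc (Suc (Suc (Suc (Suc 0)))) = (10::nat)"
  by (simp_all add: c15_def p15_def pays_def)

lemma t15[compute]: "below (right_ok c15) 0 [] t15"
  unfolding t15_def by (simp only: compute cong: lazy_cong)

lemma bound15: "\<alpha> 15 \<le> 0.85608"
  by (rule edit_constant_le[OF p15_def c15_def _ t15, where R = 1362])
    (simp_all only: compute trie.distinct, simp_all)

section \<open>Certificate for 16 letters\<close>

definition "t16 = N (N (X 6607)[U1 (X 6459)][N (Y 6386)[][E,N (X 6297)[][][E,E,X 5868]][U1 (X 2964),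
N (X 4819)[][][E,E,X 2621]]][N (X 3479)[][U1 (X 1948),N (X 3243)[][][X 1995]][X 753,
X 323]])[][N (N E[][L1 (X 6154),N (X 6178)[][E,E,N (Y 6101)[][][E,E,E,X 5774]][E,N (X 4912)[][E,E,X 4832][],
N (Y 4740)[][E,E,E,X 4617][E,X 2945]]][E,N E[][E,L2 (X 3323),N (X 3180)[][E,E,E,X 3093][E,E,E,
X 1652]][]])[][N (L1 (L2 (Y 6092)))[][][],N (N E[][E,E,L3 (N (X 6030)[][E,E,E,E,X 6021][])][E,E,
L3 (L2 (X 3165))])[][][]][E,N (N E[][E,E,U3 (L4 (X 4211))][E,E,L3 (L4 (X 2958))])[][][]]][N (N E[][E,N E[][E,
E,X 3406][E,E,X 3127]][E,N (X 2132)[][E,E,N (X 2031)[][][E,E,E,X 1359]][E,L2 (X 297),N (Y 177)[][E,E,E,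
X 2][]]])[][E,N (N E[][E,E,U3 (L4 (X 2988))][E,E,L3 (L4 (X 1914))])[][][]][]]"

lemmas [compute] =
  arg_cong[OF t16_def, of descend]

definition "p16 S T = search t16 (tidy (S, T))"

definition "c16 = pays p16 5510 16 126272"

lemma [compute]:
  "p16 S T = search t16 (tidy (S, T))"
  "c16 v m S T =
    (total p16 5510 S T m + (16 - m) * after p16 5510 S T m \<le> 16 * v + 126272)"
  "16 - 0 = (16::nat)" "16 - Suc 0 = (15::nat)" "16 - Suc (Suc 0) = (14::nat)" "16 - Suc (Suc (Suc 0)) = (13::nat)" "16 - Suc (Suc (Suc (Suc 0))) = (12::nat)" "16 - Suc (Suc (Suc (Suc (Suc 0)))) = (11::nat)"
  by (simp_all add: c16_def p16_def pays_def)

lemma t16[compute]: "below (right_ok c16) 0 [] t16"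
  unfolding t16_def by (simp only: compute cong: lazy_cong)

lemma bound16: "\<alpha> 16 \<le> 0.86462"
  by (rule edit_constant_le[OF p16_def c16_def _ t16, where R = 2382])
    (simp_all only: compute trie.distinct, simp_all)

section \<open>Certificate for 17 letters\<close>

definition "t17 = N (N (X 4841)[U1 (N (X 4738)[][][E,E,X 4340])][N E[][E,N (X 4639)[][][E,E,
X 4240]][U1 (X 2586),N (X 3603)[][E,E,X 3519][E,E,X 1921]]][N (X 2661)[][U1 (X 1590),X 2549][X 748,
N (X 464)[][E,E,L3 (X 222)][]]])[U1 (N (L0 (L2 (Y 4582)))[][][])][N (N E[][E,N (X 4557)[][][E,L2 (X 3597),
N (Y 3522)[][E,E,E,X 3446][E,X 2312]]][E,N E[][E,E,N (Y 2465)[][E,E,E,N (X 2399)[][E,E,E,E,X 2387][]][E,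
X 1628,E,X 1373]][E,L2 (X 636),L3 (X 292)]])[][E,N (N E[][L2 (L3 (X 4476)),E,L3 (L4 (X 4445))][E,E,
L0 (L3 (Y 2419))])[][][]][N (U1 (L2 (L3 (Y 2145))))[][][],N (N E[][E,E,U3 (L4 (X 3358))][E,E,
L3 (L4 (Y 2102))])[][][]]][N (N E[][E,N E[][E,E,X 2604][E,E,X 2291]][E,N (X 1758)[][E,E,N (Y 1627)[][][E,E,E,
X 1380]][E,L2 (L3 (X 290)),N (Y 212)[][E,L3 (X 232),E,N (X 47)[][E,X 26,E,E,X 4][]][]]])[][E,
N (U2 (L3 (L4 (X 1554))))[][][]][]]"

lemmas [compute] =
  arg_cong[OF t17_def, of descend]

definition "p17 S T = search t17 (tidy (S, T))"

definition "c17 = pays p17 3866 17 94384"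

lemma [compute]:
  "p17 S T = search t17 (tidy (S, T))"
  "c17 v m S T =
    (total p17 3866 S T m + (17 - m) * after p17 3866 S T m \<le> 17 * v + 94384)"
  "17 - 0 = (17::nat)" "17 - Suc 0 = (16::nat)" "17 - Suc (Suc 0) = (15::nat)" "17 - Suc (Suc (Suc 0)) = (14::nat)" "17 - Suc (Suc (Suc (Suc 0))) = (13::nat)" "17 - Suc (Suc (Suc (Suc (Suc 0)))) = (12::nat)"
  by (simp_all add: c17_def p17_def pays_def)

lemma t17[compute]: "below (right_ok c17) 0 [] t17"
  unfolding t17_def by (simp only: compute cong: lazy_cong)

lemma bound17: "\<alpha> 17 \<le> 0.87228"
  by (rule edit_constant_le[OF p17_def c17_def _ t17, where R = 1686])
    (simp_all only: compute trie.distinct, simp_all)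

section \<open>Certificate for 18 letters\<close>

definition "t18 = N (N (X 1420)[U1 (X 1393)][N (Y 1377)[][E,N (X 1361)[][][E,E,X 1274]][U1 (X 727),
N (X 1045)[][E,E,Y 1019][E,E,X 575]]][N (X 748)[][U1 (X 421),N (X 702)[][][L2 (X 411),E,N E[][X 376,E,E,
X 335][]]][X 155,X 72]])[][N (N E[][E,N (X 1337)[][E,E,N (Y 1322)[][][E,E,E,X 1255]][E,N (X 1060)[][E,E,
X 1045][],N (Y 1026)[][E,E,E,L4 (X 998)][E,X 646]]][E,N E[][E,L2 (X 718),N (Y 691)[][E,E,E,X 674][E,X 433,E,
X 362]][E,L2 (X 95),L3 (X 23)]])[][E,N (L2 (N E[][E,E,E,L4 (X 1307)][E,E,E,L4 (Y 1001)]))[][][]][E,N (N E[][E,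
E,U3 (L4 (Y 922))][E,E,L3 (L4 (X 642))])[][][]]][N (N E[][E,N E[][E,E,X 735][E,E,X 677]][E,N (X 455)[][E,E,
N (X 436)[][][E,E,E,N (X 302)[][E,E,E,E,X 283][]]][E,E,N (Y 40)[][E,E,E,X 3][]]])[][E,N (N E[][E,E,
U3 (L4 (X 650))][E,E,L3 (L4 (X 412))])[][][]][]]"

lemmas [compute] =
  arg_cong[OF t18_def, of descend]

definition "p18 S T = search t18 (tidy (S, T))"

definition "c18 = pays p18 1199 18 31068"

lemma [compute]:
  "p18 S T = search t18 (tidy (S, T))"
  "c18 v m S T =
    (total p18 1199 S T m + (18 - m) * after p18 1199 S T m \<le> 18 * v + 31068)"
  "18 - 0 = (18::nat)" "18 - Suc 0 = (17::nat)" "18 - Suc (Suc 0) = (16::nat)" "18 - Suc (Suc (Suc 0)) = (15::nat)" "18 - Suc (Suc (Suc (Suc 0))) = (14::nat)" "18 - Suc (Suc (Suc (Suc (Suc 0)))) = (13::nat)"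
  by (simp_all add: c18_def p18_def pays_def)

lemma t18[compute]: "below (right_ok c18) 0 [] t18"
  unfolding t18_def by (simp only: compute cong: lazy_cong)

lemma bound18: "\<alpha> 18 \<le> 0.87916"
  by (rule edit_constant_le[OF p18_def c18_def _ t18, where R = 527])
    (simp_all only: compute trie.distinct, simp_all)

section \<open>Certificate for 19 letters\<close>

definition "t19 = N (N (X 6004)[U1 (X 5891)][N E[][E,X 5771][N (X 4619)[][][E,X 3059],N (X 4419)[][][E,E,
X 2454]]][N (X 3146)[][U1 (X 1773),X 2959][X 607,X 270]])[][N (N E[][L1 (X 5656),N (X 5668)[][E,E,
N (Y 5607)[][][E,E,E,X 5338]][E,L2 (X 4431),N E[][E,E,E,X 4267][E,X 2730]]][E,N E[][E,L2 (X 3040),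
N (Y 2917)[][E,E,E,X 2848][]][E,L2 (X 378),L3 (X 73)]])[][E,N (L2 (L3 (L4 (X 5546))))[][][]][E,N (N E[][E,E,
U3 (L4 (X 4061))][E,E,L3 (L4 (X 2725))])[][][]]][N (N E[][E,N E[][E,E,X 3088][E,E,X 2853]][E,N (X 1968)[][E,E,
N (Y 1830)[][][E,E,E,X 1384]][E,E,N (Y 142)[][E,E,E,X 3][]]])[][E,N (N E[][E,E,U3 (L4 (X 2757))][E,E,
L3 (L4 (X 1744))])[][][]][]]"

lemmas [compute] =
  arg_cong[OF t19_def, of descend]

definition "p19 S T = search t19 (tidy (S, T))"

definition "c19 = pays p19 5128 19 140562"

lemma [compute]:
  "p19 S T = search t19 (tidy (S, T))"
  "c19 v m S T =
    (total p19 5128 S T m + (19 - m) * after p19 5128 S T m \<le> 19 * v + 140562)"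
  "19 - 0 = (19::nat)" "19 - Suc 0 = (18::nat)" "19 - Suc (Suc 0) = (17::nat)" "19 - Suc (Suc (Suc 0)) = (16::nat)" "19 - Suc (Suc (Suc (Suc 0))) = (15::nat)" "19 - Suc (Suc (Suc (Suc (Suc 0)))) = (14::nat)"
  by (simp_all add: c19_def p19_def pays_def)

lemma t19[compute]: "below (right_ok c19) 0 [] t19"
  unfolding t19_def by (simp only: compute cong: lazy_cong)

lemma bound19: "\<alpha> 19 \<le> 0.88536"
  by (rule edit_constant_le[OF p19_def c19_def _ t19, where R = 2270])
    (simp_all only: compute trie.distinct, simp_all)

section \<open>Certificate for 20 letters\<close>

definition "t20 = N (N (X 14861)[U1 (X 14538)][N (Y 14373)[][E,X 14231][E,X 11094]][N (X 7835)[][E,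
X 7321][X 1341,X 781]])[][N (N E[][E,N (X 14074)[][E,E,N (X 13849)[][][E,E,E,X 13180]][E,N (X 11259)[][E,E,
X 11091][],L3 (X 10748)]][E,L1 (N (X 7608)[][E,E,X 7479][])])[][E,N (N E[][E,E,L3 (L4 (X 13724))][E,E,
L3 (L4 (X 7079))])[][][]][E,N (N E[][E,E,U3 (L4 (X 10508))][E,E,L3 (L4 (X 6717))])[][][]]][N (N E[][E,N E[][E,
E,Y 7633][E,E,Y 7098]][E,N (X 4996)[][E,E,N (Y 4694)[][][E,E,E,X 3812]][E,E,L3 (X 3)]])[][E,N (N E[][E,E,
N E[][E,E,E,Y 7211][E,E,E,X 6777]][E,E,L3 (L4 (X 4499))])[][][]][]]"

lemmas [compute] =
  arg_cong[OF t20_def, of descend]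

definition "p20 S T = search t20 (tidy (S, T))"

definition "c20 = pays p20 12671 20 366320"

lemma [compute]:
  "p20 S T = search t20 (tidy (S, T))"
  "c20 v m S T =
    (total p20 12671 S T m + (20 - m) * after p20 12671 S T m \<le> 20 * v + 366320)"
  "20 - 0 = (20::nat)" "20 - Suc 0 = (19::nat)" "20 - Suc (Suc 0) = (18::nat)" "20 - Suc (Suc (Suc 0)) = (17::nat)" "20 - Suc (Suc (Suc (Suc 0))) = (16::nat)" "20 - Suc (Suc (Suc (Suc (Suc 0)))) = (15::nat)"
  by (simp_all add: c20_def p20_def pays_def)

lemma t20[compute]: "below (right_ok c20) 0 [] t20"
  unfolding t20_def by (simp only: compute cong: lazy_cong)

lemma bound20: "\<alpha> 20 \<le> 0.89102"
  by (rule edit_constant_le[OF p20_def c20_def _ t20, where R = 5645])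
    (simp_all only: compute trie.distinct, simp_all)

section \<open>Certificate for 21 letters\<close>

definition "t21 = N (N (X 6369)[][N E[][E,X 6140][U1 (X 3252),N (X 4772)[][][E,E,X 2642]]][N (X 3335)[][E,
X 3145][X 611,X 285]])[][N (N E[][L1 (X 6023),N (X 6044)[][E,E,N (Y 5976)[][][E,E,E,X 5710]][E,N (X 4849)[][E,
E,X 4782][],L3 (X 4635)]][E,N E[][E,L2 (X 3220),N (Y 3117)[][E,E,E,X 3042][]][E,E,L3 (X 86)]])[][E,
N (L2 (L3 (L4 (X 5920))))[][][]][E,N (U2 (L3 (L4 (X 2908))))[][][]]][N (N E[][E,N E[][E,E,Y 3274][E,E,
Y 3069]][E,N (X 2128)[][E,E,Y 2007][E,E,N (Y 226)[][E,E,E,X 3][]]])[][E,N (N E[][E,E,U3 (L4 (X 2940))][E,E,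
L3 (L4 (X 1939))])[][][]][]]"

lemmas [compute] =
  arg_cong[OF t21_def, of descend]

definition "p21 S T = search t21 (tidy (S, T))"

definition "c21 = pays p21 5497 21 167160"

lemma [compute]:
  "p21 S T = search t21 (tidy (S, T))"
  "c21 v m S T =
    (total p21 5497 S T m + (21 - m) * after p21 5497 S T m \<le> 21 * v + 167160)"
  "21 - 0 = (21::nat)" "21 - Suc 0 = (20::nat)" "21 - Suc (Suc 0) = (19::nat)" "21 - Suc (Suc (Suc 0)) = (18::nat)" "21 - Suc (Suc (Suc (Suc 0))) = (17::nat)" "21 - Suc (Suc (Suc (Suc (Suc 0)))) = (16::nat)"
  by (simp_all add: c21_def p21_def pays_def)

lemma t21[compute]: "below (right_ok c21) 0 [] t21"
  unfolding t21_def by (simp only: compute cong: lazy_cong)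

lemma bound21: "\<alpha> 21 \<le> 0.89614"
  by (rule edit_constant_le[OF p21_def c21_def _ t21, where R = 2463])
    (simp_all only: compute trie.distinct, simp_all)

section \<open>Certificate for 22 letters\<close>

definition "t22 = N (N (X 1297)[][N (Y 1263)[][E,X 1252][X 1012,X 984]][N (X 682)[][U1 (X 429),X 646][X 128,
X 64]])[][N (N E[][E,N (X 1234)[][E,E,N (Y 1221)[][][E,E,E,X 1167]][E,E,N (Y 974)[][E,E,E,X 958][]]][E,
N E[][E,L2 (X 660),N (Y 640)[][E,E,E,X 625][E,X 414,E,X 364]][E,E,L3 (X 25)]])[][E,
N (L2 (L3 (L4 (X 1210))))[][][]][E,N (U2 (L3 (L4 (X 595))))[][][]]][N (N E[][E,N E[][E,E,Y 671][E,E,Y 627]][E,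
N (X 436)[][E,E,X 420][E,E,L3 (X 4)]])[][E,N (N E[][E,E,U3 (L4 (X 602))][E,E,L3 (L4 (X 408))])[][][]][]]"

lemmas [compute] =
  arg_cong[OF t22_def, of descend]

definition "p22 S T = search t22 (tidy (S, T))"

definition "c22 = pays p22 1119 22 35706"

lemma [compute]:
  "p22 S T = search t22 (tidy (S, T))"
  "c22 v m S T =
    (total p22 1119 S T m + (22 - m) * after p22 1119 S T m \<le> 22 * v + 35706)"
  "22 - 0 = (22::nat)" "22 - Suc 0 = (21::nat)" "22 - Suc (Suc 0) = (20::nat)" "22 - Suc (Suc (Suc 0)) = (19::nat)" "22 - Suc (Suc (Suc (Suc 0))) = (18::nat)" "22 - Suc (Suc (Suc (Suc (Suc 0)))) = (17::nat)"
  by (simp_all add: c22_def p22_def pays_def)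

lemma t22[compute]: "below (right_ok c22) 0 [] t22"
  unfolding t22_def by (simp only: compute cong: lazy_cong)

lemma bound22: "\<alpha> 22 \<le> 0.90084"
  by (rule edit_constant_le[OF p22_def c22_def _ t22, where R = 504])
    (simp_all only: compute trie.distinct, simp_all)

section \<open>Certificate for 23 letters\<close>

definition "t23 = N (N (X 2342)[][N E[][E,X 2264][X 1828,X 1807]][N (X 1224)[][U1 (X 768),X 1159][X 212,
X 101]])[][N (N E[][E,N (X 2232)[][E,E,N (Y 2208)[][][E,E,E,X 2123]][E,E,N (Y 1763)[][E,E,E,X 1735][]]][E,
N E[][E,L2 (X 1186),N (Y 1151)[][E,E,E,X 1125][E,X 767,E,X 653]][E,E,L3 (X 33)]])[][E,
N (N E[][L2 (L3 (Y 2224)),E,L3 (L4 (X 2191))][])[][][]][E,N (U2 (L3 (L4 (X 1080))))[][][]]][N (N E[][E,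
L2 (Y 1203)][E,N (X 779)[][][E,E,L3 (X 4)]])[][E,N (N E[][E,E,U3 (L4 (X 1094))][E,E,
L3 (L4 (X 735))])[][][]][]]"

lemmas [compute] =
  arg_cong[OF t23_def, of descend]

definition "p23 S T = search t23 (tidy (S, T))"

definition "c23 = pays p23 2042 23 68218"

lemma [compute]:
  "p23 S T = search t23 (tidy (S, T))"
  "c23 v m S T =
    (total p23 2042 S T m + (23 - m) * after p23 2042 S T m \<le> 23 * v + 68218)"
  "23 - 0 = (23::nat)" "23 - Suc 0 = (22::nat)" "23 - Suc (Suc 0) = (21::nat)" "23 - Suc (Suc (Suc 0)) = (20::nat)" "23 - Suc (Suc (Suc (Suc 0))) = (19::nat)" "23 - Suc (Suc (Suc (Suc (Suc 0)))) = (18::nat)"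
  by (simp_all add: c23_def p23_def pays_def)

lemma t23[compute]: "below (right_ok c23) 0 [] t23"
  unfolding t23_def by (simp only: compute cong: lazy_cong)

lemma bound23: "\<alpha> 23 \<le> 0.90514"
  by (rule edit_constant_le[OF p23_def c23_def _ t23, where R = 924])
    (simp_all only: compute trie.distinct, simp_all)

section \<open>Certificate for 24 letters\<close>

definition "t24 = N (N (X 1825)[][N E[][E,X 1771][X 1436,X 1403]][N (X 955)[][U1 (X 608)][X 164,
X 81]])[][N (N E[][E,N (X 1743)[][E,E,U3 (X 1657)][E,E,N (Y 1389)[][E,E,E,X 1370][]]][E,N E[][E,E,
N (Y 900)[][E,E,E,X 882][E,X 593,E,X 527]][E,E,L3 (X 31)]])[][E,N (N E[][E,E,L3 (L4 (X 1713))][E,E,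
L3 (L2 (X 897))])[][][]][E,N (U2 (L3 (L4 (X 844))))[][][]]][N (N E[][E,L2 (X 944)][E,N (X 618)[][E,E,X 600][E,
E,L3 (X 5)]])[][E,N (N E[][E,E,U3 (L4 (X 853))][E,E,L3 (L4 (X 586))])[][][]][]]"

lemmas [compute] =
  arg_cong[OF t24_def, of descend]

definition "p24 S T = search t24 (tidy (S, T))"

definition "c24 = pays p24 1595 24 55680"

lemma [compute]:
  "p24 S T = search t24 (tidy (S, T))"
  "c24 v m S T =
    (total p24 1595 S T m + (24 - m) * after p24 1595 S T m \<le> 24 * v + 55680)"
  "24 - 0 = (24::nat)" "24 - Suc 0 = (23::nat)" "24 - Suc (Suc 0) = (22::nat)" "24 - Suc (Suc (Suc 0)) = (21::nat)" "24 - Suc (Suc (Suc (Suc 0))) = (20::nat)" "24 - Suc (Suc (Suc (Suc (Suc 0)))) = (19::nat)"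
  by (simp_all add: c24_def p24_def pays_def)

lemma t24[compute]: "below (right_ok c24) 0 [] t24"
  unfolding t24_def by (simp only: compute cong: lazy_cong)

lemma bound24: "\<alpha> 24 \<le> 0.90912"
  by (rule edit_constant_le[OF p24_def c24_def _ t24, where R = 725])
    (simp_all only: compute trie.distinct, simp_all)

section \<open>Certificate for 25 letters\<close>

definition "t25 = N (N (X 3399)[][N (Y 3344)[][][E,X 2842]][N (Y 2272)[][E,X 2214][N (X 1244)[][][E,X 174],
N (Y 1140)[][][X 72,E,X 3]]])[][N (N E[][E,N E[][E,E,N (Y 3278)[][][E,E,E,X 3185]][E,L2 (X 2843),
L3 (X 2801)]][E,N E[][E,E,L3 (X 2182)][E,E,L3 (X 1079)]])[][N (L1 (L2 (L3 (X 3292))))[][][],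
N (L2 (L3 (L4 (X 3260))))[][][]][E,N (U2 (L3 (L4 (X 2128))))[][][]]][N (U1 (N (X 1856)[][E,E,Y 1800][]))[][E,
N (N E[][E,E,U3 (Y 2141)][E,E,L3 (L4 (X 1780))])[][][]][]]"

lemmas [compute] =
  arg_cong[OF t25_def, of descend]

definition "p25 S T = search t25 (tidy (S, T))"

definition "c25 = pays p25 2073 25 75475"

lemma [compute]:
  "p25 S T = search t25 (tidy (S, T))"
  "c25 v m S T =
    (total p25 2073 S T m + (25 - m) * after p25 2073 S T m \<le> 25 * v + 75475)"
  "25 - 0 = (25::nat)" "25 - Suc 0 = (24::nat)" "25 - Suc (Suc 0) = (23::nat)" "25 - Suc (Suc (Suc 0)) = (22::nat)" "25 - Suc (Suc (Suc (Suc 0))) = (21::nat)" "25 - Suc (Suc (Suc (Suc (Suc 0)))) = (20::nat)"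
  by (simp_all add: c25_def p25_def pays_def)

lemma t25[compute]: "below (right_ok c25) 0 [] t25"
  unfolding t25_def by (simp only: compute cong: lazy_cong)

lemma bound25: "\<alpha> 25 \<le> 0.91278"
  by (rule edit_constant_le[OF p25_def c25_def _ t25, where R = 946])
    (simp_all only: compute trie.distinct, simp_all)

section \<open>Certificate for 32 letters\<close>

definition "t32 = N (N (X 7876)[][N E[][E,Y 7686][L1 (X 6210),N (X 6045)[][E,E,
X 5974][]]][N (X 4015)[][U1 (X 2597),N E[][E,E,X 3812][X 2385,E,X 2187]][L1 (X 418),N (X 145)[][E,E,
X 2][]]])[][N (N E[][E,N (X 7603)[][E,E,X 7558][E,X 6103,Y 6013]][E,
L2 (Y 3842)])[][][]][N (U1 (N (X 2478)[][E,E,X 2415][]))[][][]]"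

lemmas [compute] =
  arg_cong[OF t32_def, of descend]

definition "p32 S T = search t32 (tidy (S, T))"

definition "c32 = pays p32 7232 32 339296"

lemma [compute]:
  "p32 S T = search t32 (tidy (S, T))"
  "c32 v m S T =
    (total p32 7232 S T m + (32 - m) * after p32 7232 S T m \<le> 32 * v + 339296)"
  "32 - 0 = (32::nat)" "32 - Suc 0 = (31::nat)" "32 - Suc (Suc 0) = (30::nat)" "32 - Suc (Suc (Suc 0)) = (29::nat)"
  by (simp_all add: c32_def p32_def pays_def)

lemma t32[compute]: "below (right_ok c32) 0 [] t32"
  unfolding t32_def by (simp only: compute cong: lazy_cong)

lemma bound32: "\<alpha> 32 \<le> 0.93228"
  by (rule edit_constant_le[OF p32_def c32_def _ t32, where R = 3371])
    (simp_all only: compute trie.distinct, simp_all)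

section \<open>Certificate for 100 letters\<close>

definition "t100 = N (N (X 1895)[][U1 (X 1552)][N (Y 954)[][E,L2 (X 929)][E,X 3]])[][N (N E[][E,
L2 (Y 1862)][E,L2 (X 933)])[][][]][N (U1 (L2 (X 632)))[][][]]"

lemmas [compute] =
  arg_cong[OF t100_def, of descend]

definition "p100 S T = search t100 (tidy (S, T))"

definition "c100 = pays p100 1844 100 274700"

lemma [compute]:
  "p100 S T = search t100 (tidy (S, T))"
  "c100 v m S T =
    (total p100 1844 S T m + (100 - m) * after p100 1844 S T m \<le> 100 * v + 274700)"
  "100 - 0 = (100::nat)" "100 - Suc 0 = (99::nat)" "100 - Suc (Suc 0) = (98::nat)" "100 - Suc (Suc (Suc 0)) = (97::nat)"
  by (simp_all add: c100_def p100_def pays_def)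

lemma t100[compute]: "below (right_ok c100) 0 [] t100"
  unfolding t100_def by (simp only: compute cong: lazy_cong)

lemma bound100: "\<alpha> 100 \<le> 0.97946"
  by (rule edit_constant_le[OF p100_def c100_def _ t100, where R = 903])
    (simp_all only: compute trie.distinct, simp_all)

section \<open>Certificate for 1000 letters\<close>

definition "t1000 = N (N (X 2072)[][U1 (X 1724)][N (Y 1038)[][E,L2 (X 1035)][E,X 2]])[][N (N E[][E,
L2 (Y 2068)][E,L2 (X 1035)])[][][]][N (U1 (L2 (X 692)))[][][]]"

lemmas [compute] =
  arg_cong[OF t1000_def, of descend]

definition "p1000 S T = search t1000 (tidy (S, T))"

definition "c1000 = pays p1000 2064 1000 3094000"

lemma [compute]:
  "p1000 S T = search t1000 (tidy (S, T))"
  "c1000 v m S T =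
    (total p1000 2064 S T m + (1000 - m) * after p1000 2064 S T m \<le> 1000 * v + 3094000)"
  "1000 - 0 = (1000::nat)" "1000 - Suc 0 = (999::nat)" "1000 - Suc (Suc 0) = (998::nat)" "1000 - Suc (Suc (Suc 0)) = (997::nat)"
  by (simp_all add: c1000_def p1000_def pays_def)

lemma t1000[compute]: "below (right_ok c1000) 0 [] t1000"
  unfolding t1000_def by (simp only: compute cong: lazy_cong)

lemma bound1000: "\<alpha> 1000 \<le> 0.9982"
  by (rule edit_constant_le[OF p1000_def c1000_def _ t1000, where R = 1030])
    (simp_all only: compute trie.distinct, simp_all)

section \<open>The bounds\<close>

theorem mainTheorem1:
  shows "\<alpha> 2 \<le> 0.315514 \<and> \<alpha> 3 \<le> 0.47276 \<and> \<alpha> 4 \<le> 0.56578 \<and>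
     \<alpha> 5 \<le> 0.6325 \<and> \<alpha> 6 \<le> 0.68424 \<and> \<alpha> 7 \<le> 0.72016 \<and>
     \<alpha> 8 \<le> 0.74896 \<and> \<alpha> 9 \<le> 0.77264 \<and> \<alpha> 10 \<le> 0.7925 \<and>
     \<alpha> 11 \<le> 0.8095 \<and> \<alpha> 12 \<le> 0.82432 \<and> \<alpha> 13 \<le> 0.83744 \<and>
     \<alpha> 14 \<le> 0.84646 \<and> \<alpha> 15 \<le> 0.85608 \<and> \<alpha> 16 \<le> 0.86462 \<and>
     \<alpha> 17 \<le> 0.87228 \<and> \<alpha> 18 \<le> 0.87916 \<and> \<alpha> 19 \<le> 0.88536 \<and>
     \<alpha> 20 \<le> 0.89102 \<and> \<alpha> 21 \<le> 0.89614 \<and> \<alpha> 22 \<le> 0.90084 \<and>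
     \<alpha> 23 \<le> 0.90514 \<and> \<alpha> 24 \<le> 0.90912 \<and> \<alpha> 25 \<le> 0.91278 \<and>
     \<alpha> 32 \<le> 0.93228 \<and> \<alpha> 100 \<le> 0.97946 \<and> \<alpha> 1000 \<le> 0.9982"
  using bound2 bound3 bound4 bound5 bound6 bound7 bound8 bound9 bound10
    bound11 bound12 bound13 bound14 bound15 bound16 bound17 bound18 bound19
    bound20 bound21 bound22 bound23 bound24 bound25 bound32 bound100 bound1000
  by (intro conjI)

end
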